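(* Let $S=[0,1]$, let $\nu_0\in M_1(S)$ have topological support equal to $S$, and let $f\in C(S)$. Then the family of laws of $\{\langle\mathcal{V}_{n,\nu_0},f\rangle:n\ge1\}$ and the family of laws of $\{\langle\mathcal{W}_{n,\nu_0},f\rangle:n\ge1\}$ satisfy large deviation principles on $\mathbb{R}$ (with speed $n$) with respective good rate functions $$I_{1,f}(u;\nu_0)=\inf_{\mu\in M_1(S)}\{H(\nu_0|\mu):\langle\mu,f\rangle=u\}$$ and $$I_{2,f}(u;\nu_0)=\inf_{\mu\in M_1(S)}\{J(\mu,\nu_0):\langle\mu,f\rangle=u\},$$ $u\in\mathbb{R}$. Moreover, let $\nu_1$ denote the law of $M_{1,\nu_0}=\langle\mathcal{V}_{1,\nu_0},x\rangle=\int_0^1x\,\mathcal{V}_{1,\nu_0}(dx)$, and for $i=1,2$ let $I_i(\cdot;\nu)=I_{i,f}(\cdot;\nu)$ with $f(x)=x$. Then for all $u$, $$I_1(u;\nu_0)=I_2(u;\nu_1).$$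
   Context: $M_1(S)$ is the space of Borel probability measures on $S$ with the weak topology, $C(S)$ the continuous real functions on $S$, $\langle\mu,f\rangle=\int f\,d\mu$, $\delta_x$ the Dirac measure at $x$. Dirichlet process: for $\theta>0$, $\mathcal{V}_{\theta,\nu_0}=\sum_{i=1}^\infty V_i\delta_{\xi_i}$, where $\xi_1,\xi_2,\dots$ are i.i.d. with law $\nu_0$, independent of $U_1,U_2,\dots$ i.i.d. Beta$(1,\theta)$, and $V_1=U_1$, $V_i=(1-U_1)\cdots(1-U_{i-1})U_i$ for $i\ge2$. $\mathcal{V}_{n,\nu_0}$ is the case $\theta=n$. $\mathcal{W}_{n,\nu_0}=\sum_{i=1}^nX_{ni}\delta_{\xi_i}$, where $\xi_1,\xi_2,\dots$ are i.i.d. with law $\nu_0$ and, independently, $(X_{n1},\dots,X_{nn})$ is Dirichlet$(1,\dots,1)$ (i.e. normalized i.i.d. exponential variables of parameter $1$). Relative entropy: $H(\mu|\nu)=\sup\{\langle\mu,g\rangle-\log\langle\nu,e^g\rangle:g\in C(S)\}\in[0,\infty]$. $J$-divergence: $J(\mu,\nu)=\inf_{\upsilon\in M_1(S)}\{H(\upsilon|\mu)+H(\upsilon|\nu)\}$. The infimum over the empty set is $+\infty$. Large deviation principle with speed $n$ and rate function $I$ for laws $P_n$: $\limsup_n \frac1n\log P_n(C)\le-\inf_C I$ for closed $C$ and $\liminf_n\frac1n\log P_n(G)\ge-\inf_G I$ for open $G$; good means the sublevel sets $\{I\le c\}$, $c<\infty$, are compact. *)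

theory Defs
  imports "HOL-Probability.Probability"
begin

abbreviation S01 :: "real set" where
  "S01 \<equiv> {0..1}"

abbreviation borel_S01 :: "real measure" where
  "borel_S01 \<equiv> restrict_space borel S01"

abbreviation M1 :: "real measure set" where
  "M1 \<equiv> space (prob_algebra borel_S01)"

definition topological_support :: "real measure \<Rightarrow> real set" where
  "topological_support \<nu> =
     {x \<in> S01. \<forall>G. open G \<longrightarrow> x \<in> G \<longrightarrow> 0 < emeasure \<nu> (G \<inter> S01)}"

text \<open>Elements of \<open>C(S)\<close> are represented by functions on the whole line that are continuous
  on \<^term>\<open>S01\<close>; a measure on \<^term>\<open>borel_S01\<close> ignores their values elsewhere.\<close>

definition relative_entropy :: "real measure \<Rightarrow> real measure \<Rightarrow> ereal" where
  "relative_entropy \<mu> \<nu> =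
     (SUP g \<in> {g. continuous_on S01 g}.
        ereal (integral\<^sup>L \<mu> g - ln (integral\<^sup>L \<nu> (\<lambda>x. exp (g x)))))"

definition J_divergence :: "real measure \<Rightarrow> real measure \<Rightarrow> ereal" where
  "J_divergence \<mu> \<nu> = (INF \<upsilon> \<in> M1. relative_entropy \<upsilon> \<mu> + relative_entropy \<upsilon> \<nu>)"

text \<open>In \<^typ>\<open>ereal\<close> the infimum over the empty set is \<open>\<infinity>\<close>.\<close>

definition rate1 :: "(real \<Rightarrow> real) \<Rightarrow> real measure \<Rightarrow> real \<Rightarrow> ereal" where
  "rate1 f \<nu> u = (INF \<mu> \<in> {\<mu> \<in> M1. integral\<^sup>L \<mu> f = u}. relative_entropy \<nu> \<mu>)"

definition rate2 :: "(real \<Rightarrow> real) \<Rightarrow> real measure \<Rightarrow> real \<Rightarrow> ereal" where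
  "rate2 f \<nu> u = (INF \<mu> \<in> {\<mu> \<in> M1. integral\<^sup>L \<mu> f = u}. J_divergence \<mu> \<nu>)"

text \<open>The measure \<open>\<Sum>i\<in>I. w i \<delta>\<^bsub>x i\<^esub>\<close> on \<^term>\<open>S01\<close>, as the image under \<open>x\<close> of the measure
  on \<open>I\<close> with weights \<open>w\<close>.\<close>

definition atomic_measure :: "nat set \<Rightarrow> (nat \<Rightarrow> real) \<Rightarrow> (nat \<Rightarrow> real) \<Rightarrow> real measure" where
  "atomic_measure I w x =
     distr (density (count_space I) (\<lambda>i. ennreal (w i))) borel_S01 x"

lemma emeasure_atomic_measure:
  assumes "\<And>i. i \<in> I \<Longrightarrow> x i \<in> S01" and "A \<in> sets borel_S01"
  shows "emeasure (atomic_measure I w x) A =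
    (\<Sum>i. ennreal (w i) * indicator A (x i) * indicator I i)"
proof -
  have x: "x \<in> measurable (density (count_space I) (\<lambda>i. ennreal (w i))) borel_S01"
    using assms(1) by (simp add: space_restrict_space measurable_count_space_eq1 Pi_iff)
  have "emeasure (atomic_measure I w x) A
      = (\<integral>\<^sup>+i. ennreal (w i) * indicator (x -` A \<inter> I) i \<partial>count_space I)"
    unfolding atomic_measure_def
    by (subst emeasure_distr[OF x assms(2)]) (simp add: emeasure_density)
  also have "\<dots> = (\<integral>\<^sup>+i. ennreal (w i) * indicator (x -` A \<inter> I) i * indicator I i
                    \<partial>count_space UNIV)"
    by (subst nn_integral_count_space_indicator) simp_all
  also have "\<dots> = (\<Sum>i. ennreal (w i) * indicator (x -` A \<inter> I) i * indicator I i)"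
    by (rule nn_integral_count_space_nat)
  also have "\<dots> = (\<Sum>i. ennreal (w i) * indicator A (x i) * indicator I i)"
    by (intro suminf_cong) (auto simp: indicator_def)
  finally show ?thesis .
qed

definition iid_with_law ::
    "'a measure \<Rightarrow> real measure \<Rightarrow> (nat \<Rightarrow> 'a \<Rightarrow> real) \<Rightarrow> bool" where
  "iid_with_law P \<mu> X \<longleftrightarrow>
     prob_space.indep_vars P (\<lambda>_. \<mu>) X UNIV \<and> (\<forall>i. distr P \<mu> (X i) = \<mu>)"

definition beta_law :: "real \<Rightarrow> real \<Rightarrow> real measure" where
  "beta_law a b =
     density lborel (\<lambda>x. ennreal (x powr (a - 1) * (1 - x) powr (b - 1) / Beta a b
                                   * indicator {0<..<1} x))"

definition stick_breaking :: "(nat \<Rightarrow> real) \<Rightarrow> nat \<Rightarrow> real" where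
  "stick_breaking U i = (\<Prod>j<i. 1 - U j) * U i"

text \<open>Sequences are indexed from \<open>0\<close>. The predicate says that the random measure \<open>V\<close> on the
  probability space \<open>P\<close> is obtained by stick breaking from some \<open>\<xi>\<close> and \<open>U\<close>.\<close>

definition dirichlet_process ::
    "'a measure \<Rightarrow> real \<Rightarrow> real measure \<Rightarrow> ('a \<Rightarrow> real measure) \<Rightarrow> bool" where
  "dirichlet_process P \<theta> \<nu> V \<longleftrightarrow> prob_space P \<and>
     (\<exists>\<xi> U. iid_with_law P \<nu> \<xi> \<and> iid_with_law P (beta_law 1 \<theta>) U \<and>
        prob_space.indep_var P
          (PiM UNIV (\<lambda>_. borel_S01)) (\<lambda>\<omega> i. \<xi> i \<omega>) (PiM UNIV (\<lambda>_. borel)) (\<lambda>\<omega> i. U i \<omega>) \<and>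
        (\<forall>\<omega> \<in> space P. V \<omega> =
           atomic_measure UNIV (stick_breaking (\<lambda>i. U i \<omega>)) (\<lambda>i. \<xi> i \<omega>)))"

text \<open>The law Dirichlet\<open>(1,\<dots>,1)\<close> of a vector of length \<open>n\<close>: normalized i.i.d. exponential
  variables of parameter \<open>1\<close>.\<close>

definition dirichlet_ones_law :: "nat \<Rightarrow> (nat \<Rightarrow> real) measure" where
  "dirichlet_ones_law n =
     distr (PiM {..<n} (\<lambda>_. density lborel (exponential_density 1))) (PiM {..<n} (\<lambda>_. borel))
       (\<lambda>e. \<lambda>i\<in>{..<n}. e i / (\<Sum>j<n. e j))"

definition dirichlet_weighted_sample ::
    "'a measure \<Rightarrow> nat \<Rightarrow> real measure \<Rightarrow> ('a \<Rightarrow> real measure) \<Rightarrow> bool" where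
  "dirichlet_weighted_sample P n \<nu> W \<longleftrightarrow> prob_space P \<and>
     (\<exists>\<xi> X. iid_with_law P \<nu> \<xi> \<and>
        distr P (PiM {..<n} (\<lambda>_. borel)) (\<lambda>\<omega>. \<lambda>i\<in>{..<n}. X i \<omega>) = dirichlet_ones_law n \<and>
        prob_space.indep_var P
          (PiM UNIV (\<lambda>_. borel_S01)) (\<lambda>\<omega> i. \<xi> i \<omega>)
          (PiM {..<n} (\<lambda>_. borel)) (\<lambda>\<omega>. \<lambda>i\<in>{..<n}. X i \<omega>) \<and>
        (\<forall>\<omega> \<in> space P. W \<omega> = atomic_measure {..<n} (\<lambda>i. X i \<omega>) (\<lambda>i. \<xi> i \<omega>)))"

definition log_prob :: "real \<Rightarrow> ereal" where
  "log_prob p = (if p = 0 then -\<infinity> else ereal (ln p))"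

definition LDP :: "(nat \<Rightarrow> 'x::topological_space measure) \<Rightarrow> ('x \<Rightarrow> ereal) \<Rightarrow> bool" where
  "LDP P I \<longleftrightarrow>
     (\<forall>C. closed C \<longrightarrow>
        limsup (\<lambda>n. ereal (1 / real n) * log_prob (measure (P n) C)) \<le> - (INF x\<in>C. I x)) \<and>
     (\<forall>G. open G \<longrightarrow>
        - (INF x\<in>G. I x) \<le> liminf (\<lambda>n. ereal (1 / real n) * log_prob (measure (P n) G)))"

definition good_rate_function :: "('x::topological_space \<Rightarrow> ereal) \<Rightarrow> bool" where
  "good_rate_function I \<longleftrightarrow> (\<forall>x. 0 \<le> I x) \<and> (\<forall>c<\<infinity>. compact {x. I x \<le> c})"

text \<open>The law of the random integral \<open>\<langle>V, f\<rangle>\<close>.\<close>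

definition mean_law ::
    "'a measure \<Rightarrow> ('a \<Rightarrow> real measure) \<Rightarrow> (real \<Rightarrow> real) \<Rightarrow> real measure" where
  "mean_law P V f = distr P borel (\<lambda>\<omega>. integral\<^sup>L (V \<omega>) f)"

end

theory Submission
  imports Defs "HOL-Real_Asymp.Real_Asymp"
begin

text \<open>Both random means have explicit inverse moments: for positive \<open>h \<in> C(S)\<close>,
  \<open>E \<langle>V\<^sub>n, h\<rangle>\<^sup>-\<^sup>n = exp (-n \<integral> ln h d\<nu>\<^sub>0)\<close> and \<open>E \<langle>W\<^sub>n, h\<rangle>\<^sup>-\<^sup>n = (\<integral> 1/h d\<nu>\<^sub>0)\<^sup>n\<close>. The first follows from the
  self-similarity of stick breaking, which gives a recursion in the exponent and so a differential
  equation in a constant added to \<open>h\<close>; the second from polar coordinates for exponential variables.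
  With \<open>h = 1 + t (f - u)\<close> these moments play the role that exponential moments play in Cramer's
  theorem: they give the Chernoff bound, and tilting at a critical point \<open>t\<close> gives the lower bound, with
  rate the supremum over \<open>t\<close> of \<open>\<integral> ln (1 + t (f - u)) d\<nu>\<^sub>0\<close>, respectively of
  \<open>- ln (\<integral> 1/(1 + t (f - u)) d\<nu>\<^sub>0)\<close>. A critical point need not exist, but it does once \<open>f\<close> is cut off slightly
  above its minimum. At a critical point the tilted densities are optimal in the variational problems
  defining the rate functions, and compactness of \<open>M\<^sub>1(S)\<close> removes the cut-off. For \<open>n = 1\<close> and
  \<open>f(x) = x\<close> the first moment formula says that the two dual expressions, for \<open>\<nu>\<^sub>0\<close> and for \<open>\<nu>\<^sub>1\<close>, agree
  for every \<open>t\<close>.\<close>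

section \<open>Probability measures on the unit interval and relative entropy\<close>

text \<open>Integrating an affine function of \<open>f\<close> against a random probability measure
  gives the same affine function of the mean X of \<open>f\<close>. So
  \<open>1 + t * (X - u)\<close> is itself the mean of a positive function, which is why powers of
  affine functions, and not exponentials, serve as tilts. The order of the moment equals the
  parameter n of the law, so the moments are exactly exponential in n and no limit of logarithmic
  moments is taken. The obstacle is the end of the interval of admissible t. There
  \<open>1 + t * (f - u)\<close> vanishes at an extremum of \<open>f\<close>, but if the measure is
  thin near that extremum the derivative of the kernel may keep its sign up to the end, and there is
  no point at which to tilt. An atom at the minimum forces a sign change. The cut-off that creates
  it raises \<open>f\<close> by at most d and \<open>u\<close> by 2d, so \<open>f - u\<close>
  decreases; by monotonicity of the kernels the dual value then stays below the original rate.
  Values above the mean reduce to values below it by reflection. For the law of the first mean the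
  support is not computed: mass near 0 and near 1 is what the sign change asks for.\<close>

lemma M1_iff: "\<mu> \<in> M1 \<longleftrightarrow> sets \<mu> = sets borel_S01 \<and> prob_space \<mu>"
  by (simp add: space_prob_algebra)

lemma M1_prob_space: "\<mu> \<in> M1 \<Longrightarrow> prob_space \<mu>"
  by (simp add: M1_iff)

lemma M1_space: "\<mu> \<in> M1 \<Longrightarrow> space \<mu> = S01"
  using sets_eq_imp_space_eq[of \<mu> borel_S01] by (simp add: M1_iff space_restrict_space)

lemma M1_borel_measurable:
  fixes g :: "real \<Rightarrow> real"
  assumes "\<mu> \<in> M1" "continuous_on S01 g"
  shows "g \<in> borel_measurable \<mu>"
proof -
  have "g \<in> borel_measurable borel_S01"
    by (rule borel_measurable_continuous_on_restrict[OF assms(2)])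
  moreover have "sets \<mu> = sets borel_S01"
    using assms(1) by (simp add: M1_iff)
  ultimately show ?thesis
    using measurable_cong_sets by blast
qed

lemma continuous_on_S01_bound:
  fixes g :: "real \<Rightarrow> real"
  assumes "continuous_on S01 g"
  obtains B where "0 < B" "\<And>x. x \<in> S01 \<Longrightarrow> \<bar>g x\<bar> \<le> B"
proof -
  have "compact (g ` S01)" using assms by (intro compact_continuous_image) auto
  then obtain B where "0 < B" "\<forall>y\<in>g ` S01. norm y \<le> B"
    using bounded_pos compact_imp_bounded by blast
  then show ?thesis using that by auto
qed

lemma continuous_on_S01_pos_bound:
  fixes g :: "real \<Rightarrow> real"
  assumes "continuous_on S01 g" "\<And>x. x \<in> S01 \<Longrightarrow> 0 < g x"
  obtains c where "0 < c" "\<And>x. x \<in> S01 \<Longrightarrow> c \<le> g x"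
proof -
  obtain x where "x \<in> S01" "\<forall>y\<in>S01. g x \<le> g y"
    using continuous_attains_inf[OF _ _ assms(1)] by auto
  then show ?thesis using that[of "g x"] assms(2) by auto
qed

lemma M1_integrable:
  fixes g :: "real \<Rightarrow> real"
  assumes "\<mu> \<in> M1" "continuous_on S01 g"
  shows "integrable \<mu> g"
proof -
  interpret prob_space \<mu> using assms(1) by (rule M1_prob_space)
  obtain B where "\<And>x. x \<in> S01 \<Longrightarrow> \<bar>g x\<bar> \<le> B" using continuous_on_S01_bound[OF assms(2)] by metis
  then show ?thesis
    using M1_borel_measurable[OF assms] M1_space[OF assms(1)]
    by (intro integrable_const_bound[where B = B]) auto
qed

lemma M1_integral_mono:
  fixes g h :: "real \<Rightarrow> real"
  assumes "\<mu> \<in> M1" "continuous_on S01 g" "continuous_on S01 h" "\<And>x. x \<in> S01 \<Longrightarrow> g x \<le> h x"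
  shows "integral\<^sup>L \<mu> g \<le> integral\<^sup>L \<mu> h"
  using assms M1_space by (intro integral_mono M1_integrable) auto

lemma M1_integral_cong:
  fixes g h :: "real \<Rightarrow> real"
  assumes "\<mu> \<in> M1" "\<And>x. x \<in> S01 \<Longrightarrow> g x = h x"
  shows "integral\<^sup>L \<mu> g = integral\<^sup>L \<mu> h"
  using assms M1_space by (intro Bochner_Integration.integral_cong) auto

lemma M1_measure_space [simp]: "\<mu> \<in> M1 \<Longrightarrow> measure \<mu> (space \<mu>) = 1"
  by (rule prob_space.prob_space[OF M1_prob_space])

lemma M1_integral_ge:
  fixes g :: "real \<Rightarrow> real"
  assumes "\<mu> \<in> M1" "continuous_on S01 g" "\<And>x. x \<in> S01 \<Longrightarrow> c \<le> g x"
  shows "c \<le> integral\<^sup>L \<mu> g"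
  using M1_integral_mono[OF assms(1) continuous_on_const assms(2), of c] assms by simp

lemma M1_integral_le:
  fixes g :: "real \<Rightarrow> real"
  assumes "\<mu> \<in> M1" "continuous_on S01 g" "\<And>x. x \<in> S01 \<Longrightarrow> g x \<le> c"
  shows "integral\<^sup>L \<mu> g \<le> c"
  using M1_integral_mono[OF assms(1,2) continuous_on_const, of c] assms by simp

lemma M1_integral_pos:
  fixes g :: "real \<Rightarrow> real"
  assumes "\<mu> \<in> M1" "continuous_on S01 g" "\<And>x. x \<in> S01 \<Longrightarrow> 0 < g x"
  shows "0 < integral\<^sup>L \<mu> g"
  by (metis M1_integral_ge[OF assms(1,2)] continuous_on_S01_pos_bound[OF assms(2,3)] less_le_trans)

text \<open>The link between tilts and moments: through it the tilt \<open>1 + t * (X - u)\<close>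
  of a random mean X becomes the mean of a positive function, and critical-point equations become
  normalizations of densities.\<close>

lemma M1_integral_affine:
  fixes g :: "real \<Rightarrow> real"
  assumes "\<mu> \<in> M1" "continuous_on S01 g"
  shows "(\<integral>x. a + t * (g x - u) \<partial>\<mu>) = a + t * (integral\<^sup>L \<mu> g - u)"
proof -
  interpret prob_space \<mu> using assms(1) by (rule M1_prob_space)
  show ?thesis
    using M1_integrable[OF assms] by (simp add: prob_space)
qed

text \<open>Compactness of \<open>M1\<close> is obtained on the whole line: measures carried by a
  bounded interval are tight, and a weak limit gives full mass to the closed set \<open>S01\<close>,
  so it can be restricted back.\<close>

lemma M1_convergent_subsequence:
  assumes "\<And>k. \<mu> k \<in> M1"
  obtains r \<mu>' where "strict_mono (r :: nat \<Rightarrow> nat)" "\<mu>' \<in> M1"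
    "\<And>g :: real \<Rightarrow> real. continuous_on S01 g \<Longrightarrow> (\<lambda>k. integral\<^sup>L (\<mu> (r k)) g) \<longlonglongrightarrow> integral\<^sup>L \<mu>' g"
proof -
  define N where "N k = distr (\<mu> k) borel (\<lambda>x. x)" for k
  have id: "(\<lambda>x. x) \<in> borel_measurable (\<mu> k)" for k
    using M1_borel_measurable[OF assms] by (simp add: continuous_on_id)
  have N_prob: "prob_space (N k)" for k
    unfolding N_def using M1_prob_space[OF assms] id by (rule prob_space.prob_space_distr)
  have N: "real_distribution (N k)" for k
    using N_prob unfolding real_distribution_def real_distribution_axioms_def by (simp add: N_def)
  have N_int: "integral\<^sup>L (N k) g = integral\<^sup>L (\<mu> k) g" if "g \<in> borel_measurable borel" for k and g :: "real \<Rightarrow> real"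
    unfolding N_def by (rule integral_distr[OF id that])
  have "tight N"
    unfolding tight_def
  proof (intro conjI allI impI N)
    fix \<epsilon> :: real assume "0 < \<epsilon>"
    \<comment> \<open>Tightness is phrased with half-open intervals, so the left end lies strictly
      below 0 to keep a possible atom at 0.\<close>
    have "measure (N k) {-1<..1} = 1" for k
    proof -
      interpret prob_space "\<mu> k" using assms by (rule M1_prob_space)
      have "measure (N k) {-1<..1} = measure (\<mu> k) ({-1<..1} \<inter> space (\<mu> k))"
        unfolding N_def by (subst measure_distr[OF id]) auto
      also have "{-1<..1} \<inter> space (\<mu> k) = space (\<mu> k)"
        using M1_space[OF assms] by auto
      finally show ?thesis by (simp add: prob_space)
    qed
    then show "\<exists>a b. a < b \<and> (\<forall>n. 1 - \<epsilon> < measure (N n) {a<..b})"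
      using \<open>0 < \<epsilon>\<close> by (intro exI[of _ "-1"] exI[of _ 1]) simp
  qed
  then obtain r M where r: "strict_mono r" and M: "real_distribution M"
    and conv: "weak_conv_m (N \<circ> id \<circ> r) M"
    using tight_imp_convergent_subsubsequence[of N id] by (auto simp: strict_mono_def)
  interpret M: real_distribution M by (rule M)
  \<comment> \<open>The retraction of the line onto \<open>S01\<close>: composing with it extends a
    function continuous on \<open>S01\<close> to a bounded continuous function on the line, the
    class of test functions that weak convergence controls.\<close>
  define cl :: "real \<Rightarrow> real" where "cl x = max 0 (min 1 x)" for x
  have cl_cont: "continuous_on A cl" for A unfolding cl_def by (intro continuous_intros)
  have cl_in: "cl x \<in> S01" for x by (simp add: cl_def)
  have cl_id: "x \<in> S01 \<Longrightarrow> cl x = x" for x by (simp add: cl_def)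
  have lim: "(\<lambda>k. integral\<^sup>L (\<mu> (r k)) h) \<longlonglongrightarrow> integral\<^sup>L M h"
    if h: "continuous_on UNIV h" "\<And>x. \<bar>h x\<bar> \<le> B" for h :: "real \<Rightarrow> real" and B
  proof -
    have "(\<lambda>n. integral\<^sup>L ((N \<circ> id \<circ> r) n) h) \<longlonglongrightarrow> integral\<^sup>L M h"
      by (rule weak_conv_imp_integral_bdd_continuous_conv[OF _ M conv, where B = B])
        (use h N in \<open>auto simp: continuous_on_eq_continuous_at isCont_def\<close>)
    then show ?thesis
      using N_int[OF borel_measurable_continuous_onI[OF h(1)]] by simp
  qed
  have "AE x in M. x \<in> S01"
  proof -
    \<comment> \<open>A bounded continuous function that vanishes exactly on \<open>S01\<close>: its
      integrals along the sequence are 0, so the limit puts no mass outside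
      \<open>S01\<close>.\<close>
    define q where "q x = min 1 \<bar>x - cl x\<bar>" for x
    have q: "continuous_on UNIV q" "\<And>x. \<bar>q x\<bar> \<le> 1"
      unfolding q_def by (intro continuous_intros cl_cont, simp)
    have "integral\<^sup>L (\<mu> k) q = 0" for k
      using M1_integral_cong[OF assms, of q "\<lambda>_. 0" k] by (simp add: q_def cl_id)
    then have "integral\<^sup>L M q = 0"
      using lim[OF q] by (simp add: LIMSEQ_const_iff)
    moreover have "integrable M q"
      using q(2) borel_measurable_continuous_onI[OF q(1)]
      by (intro M.integrable_const_bound[where B = 1]) auto
    ultimately have "AE x in M. q x = 0"
      by (subst (asm) integral_nonneg_eq_0_iff_AE) (auto simp: q_def)
    then show ?thesis
    proof (rule AE_mp, intro AE_I2 impI)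
      fix x assume "q x = 0"
      then have "x = cl x" by (auto simp: q_def min_def split: if_splits)
      then show "x \<in> S01" using cl_in[of x] by simp
    qed
  qed note ae = this
  define \<mu>' where "\<mu>' = restrict_space M S01"
  have sets: "sets \<mu>' = sets borel_S01"
    unfolding \<mu>'_def by (intro sets_restrict_space_cong) simp
  have S: "S01 \<in> sets M" by simp
  have "emeasure \<mu>' (space \<mu>') = 1"
    using ae M.emeasure_eq_1_AE[of S01]
    by (simp add: \<mu>'_def space_restrict_space emeasure_restrict_space)
  then have \<mu>': "\<mu>' \<in> M1" using sets by (simp add: M1_iff prob_spaceI)
  show ?thesis
  proof (rule that[OF r \<mu>'])
    fix g :: "real \<Rightarrow> real" assume g: "continuous_on S01 g"
    obtain B where B: "\<And>x. x \<in> S01 \<Longrightarrow> \<bar>g x\<bar> \<le> B" using continuous_on_S01_bound[OF g] by metis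
    have h: "continuous_on UNIV (\<lambda>x. g (cl x))" "\<And>x. \<bar>g (cl x)\<bar> \<le> B"
      using cl_in B by (auto intro!: continuous_on_compose2[OF g cl_cont])
    have "(\<lambda>k. integral\<^sup>L (\<mu> (r k)) (\<lambda>x. g (cl x))) \<longlonglongrightarrow> integral\<^sup>L M (\<lambda>x. g (cl x))"
      by (rule lim[OF h])
    also have "(\<lambda>k. integral\<^sup>L (\<mu> (r k)) (\<lambda>x. g (cl x))) = (\<lambda>k. integral\<^sup>L (\<mu> (r k)) g)"
      by (intro ext M1_integral_cong assms) (simp add: cl_id)
    also have "integral\<^sup>L M (\<lambda>x. g (cl x)) = (\<integral>x. indicator S01 x *\<^sub>R g (cl x) \<partial>M)"
      using ae borel_measurable_continuous_onI[OF h(1)]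
      by (intro integral_cong_AE) (auto elim!: AE_mp)
    also have "\<dots> = (\<integral>x. g (cl x) \<partial>\<mu>')"
      unfolding \<mu>'_def by (subst integral_restrict_space) auto
    also have "\<dots> = integral\<^sup>L \<mu>' g"
      by (intro M1_integral_cong \<mu>') (simp add: cl_id)
    finally show "(\<lambda>k. integral\<^sup>L (\<mu> (r k)) g) \<longlonglongrightarrow> integral\<^sup>L \<mu>' g" .
  qed
qed

section \<open>Relative entropy: variational bounds and lower semicontinuity\<close>

lemma relative_entropy_ge:
  assumes "continuous_on S01 g"
  shows "ereal (integral\<^sup>L \<mu> g - ln (integral\<^sup>L \<nu> (\<lambda>x. exp (g x)))) \<le> relative_entropy \<mu> \<nu>"
  unfolding relative_entropy_def using assms by (intro SUP_upper) auto

lemma relative_entropy_nonneg: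
  assumes "\<mu> \<in> M1" "\<nu> \<in> M1"
  shows "0 \<le> relative_entropy \<mu> \<nu>"
  using relative_entropy_ge[of "\<lambda>_. 0" \<mu> \<nu>] assms by (simp add: zero_ereal_def)

lemma integral_density_M1:
  fixes g h :: "real \<Rightarrow> real"
  assumes \<beta>: "\<beta> \<in> M1" and h: "continuous_on S01 h" "\<And>x. x \<in> S01 \<Longrightarrow> 0 < h x"
    and g: "continuous_on S01 g"
  shows "integral\<^sup>L (density \<beta> (\<lambda>x. ennreal (h x))) g = (\<integral>x. h x * g x \<partial>\<beta>)"
  using h M1_space[OF \<beta>] M1_borel_measurable[OF \<beta>] g
  by (subst integral_density) (auto intro!: AE_I2 less_imp_le)

text \<open>Jensen's inequality: the exponential lies above its tangent at the mean of
  \<open>g + ln h\<close>, which bounds every term of the supremum at once. The cost of all explicit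
  minimizers below is estimated by this bound.\<close>

lemma relative_entropy_density_le:
  assumes \<beta>: "\<beta> \<in> M1" and h: "continuous_on S01 h" "\<And>x. x \<in> S01 \<Longrightarrow> 0 < h x"
  shows "relative_entropy \<beta> (density \<beta> (\<lambda>x. ennreal (h x))) \<le> ereal (- (\<integral>x. ln (h x) \<partial>\<beta>))"
  unfolding relative_entropy_def
proof (intro SUP_least)
  fix g :: "real \<Rightarrow> real" assume "g \<in> {g. continuous_on S01 g}"
  then have g: "continuous_on S01 g" by simp
  interpret prob_space \<beta> using \<beta> by (rule M1_prob_space)
  \<comment> \<open>The point of tangency; with it the linear term integrates to zero.\<close>
  define m where "m = (\<integral>x. g x + ln (h x) \<partial>\<beta>)"
  have lnh: "continuous_on S01 (\<lambda>x. ln (h x))"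
    using h(1) by (rule continuous_on_ln) (use h(2) in fastforce)
  have m: "m = integral\<^sup>L \<beta> g + (\<integral>x. ln (h x) \<partial>\<beta>)"
    unfolding m_def by (intro Bochner_Integration.integral_add M1_integrable \<beta> g lnh)
  have "(\<integral>x. exp (g x) \<partial>density \<beta> (\<lambda>x. ennreal (h x))) = (\<integral>x. h x * exp (g x) \<partial>\<beta>)"
    using g by (intro integral_density_M1 \<beta> h continuous_on_exp)
  also have "\<dots> \<ge> (\<integral>x. exp m * (1 + 1 * ((g x + ln (h x)) - m)) \<partial>\<beta>)"
  proof (rule M1_integral_mono[OF \<beta>])
    fix x assume "x \<in> S01"
    then have "h x * exp (g x) = exp m * exp (g x + ln (h x) - m)"
      using h by (simp add: exp_add exp_diff)
    moreover have "1 + 1 * ((g x + ln (h x)) - m) \<le> exp (g x + ln (h x) - m)"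
      using exp_ge_add_one_self by simp
    ultimately show "exp m * (1 + 1 * ((g x + ln (h x)) - m)) \<le> h x * exp (g x)"
      by simp
  qed (intro continuous_intros g lnh h | simp)+
  also have "(\<integral>x. exp m * (1 + 1 * ((g x + ln (h x)) - m)) \<partial>\<beta>) = exp m * (1 + 1 * (m - m))"
    unfolding m_def using g lnh
    by (subst Bochner_Integration.integral_mult_right_zero, subst M1_integral_affine[OF \<beta>])
      (auto intro!: continuous_intros)
  finally have "exp m \<le> (\<integral>x. exp (g x) \<partial>density \<beta> (\<lambda>x. ennreal (h x)))" by simp
  then have "m \<le> ln (\<integral>x. exp (g x) \<partial>density \<beta> (\<lambda>x. ennreal (h x)))"
    by (metis exp_gt_zero less_le_trans ln_exp ln_le_cancel_iff)
  then show "ereal (integral\<^sup>L \<beta> g - ln (\<integral>x. exp (g x) \<partial>density \<beta> (\<lambda>x. ennreal (h x))))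
      \<le> ereal (- (\<integral>x. ln (h x) \<partial>\<beta>))"
    unfolding m by simp
qed

lemma density_in_M1:
  assumes \<beta>: "\<beta> \<in> M1" and h: "continuous_on S01 h" "\<And>x. x \<in> S01 \<Longrightarrow> 0 < h x"
    and "integral\<^sup>L \<beta> h = 1"
  shows "density \<beta> (\<lambda>x. ennreal (h x)) \<in> M1"
proof -
  have "(\<integral>\<^sup>+x. ennreal (h x) \<partial>\<beta>) = 1"
    using assms M1_space[OF \<beta>]
    by (subst nn_integral_eq_integral[OF M1_integrable[OF \<beta> h(1)]]) (auto intro!: AE_I2 less_imp_le)
  then have "prob_space (density \<beta> (\<lambda>x. ennreal (h x)))"
    using M1_borel_measurable[OF \<beta> h(1)]
    by (intro prob_spaceI) (simp add: emeasure_density cong: nn_integral_cong)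
  then show ?thesis using \<beta> by (simp add: M1_iff)
qed

text \<open>Both \<open>g\<close> and its exponential are continuous test functions, and the second
  integral stays positive in the limit. Relative entropy, a supremum of such terms, is therefore
  jointly lower semicontinuous.\<close>

lemma relative_entropy_term_tendsto:
  fixes g :: "real \<Rightarrow> real"
  assumes \<mu>: "\<And>k. \<mu> k \<in> M1" "\<mu>' \<in> M1" and \<nu>: "\<And>k. \<nu> k \<in> M1" "\<nu>' \<in> M1"
    and lim: "\<And>g :: real \<Rightarrow> real. continuous_on S01 g \<Longrightarrow> (\<lambda>k. integral\<^sup>L (\<mu> k) g) \<longlonglongrightarrow> integral\<^sup>L \<mu>' g"
      "\<And>g :: real \<Rightarrow> real. continuous_on S01 g \<Longrightarrow> (\<lambda>k. integral\<^sup>L (\<nu> k) g) \<longlonglongrightarrow> integral\<^sup>L \<nu>' g"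
    and g: "continuous_on S01 g"
  shows "(\<lambda>k. integral\<^sup>L (\<mu> k) g - ln (integral\<^sup>L (\<nu> k) (\<lambda>x. exp (g x))))
    \<longlonglongrightarrow> integral\<^sup>L \<mu>' g - ln (integral\<^sup>L \<nu>' (\<lambda>x. exp (g x)))"
proof -
  have "0 < integral\<^sup>L \<nu>' (\<lambda>x. exp (g x))"
    using g by (intro M1_integral_pos \<nu>) (auto intro!: continuous_intros)
  then show ?thesis using g
    by (intro tendsto_intros lim) (auto intro!: continuous_intros)
qed

text \<open>The sum is treated as one object because along the sequence only the sum is bounded; two
  independent test functions \<open>g\<close> and \<open>h\<close> pass to the limit
  together.\<close>

lemma relative_entropy_sum_lsc:
  assumes M1: "\<And>k. \<mu> k \<in> M1" "\<mu>' \<in> M1" "\<And>k. \<upsilon> k \<in> M1" "\<upsilon>' \<in> M1" "\<nu> \<in> M1"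
    and lim: "\<And>g :: real \<Rightarrow> real. continuous_on S01 g \<Longrightarrow> (\<lambda>k. integral\<^sup>L (\<mu> k) g) \<longlonglongrightarrow> integral\<^sup>L \<mu>' g"
      "\<And>g :: real \<Rightarrow> real. continuous_on S01 g \<Longrightarrow> (\<lambda>k. integral\<^sup>L (\<upsilon> k) g) \<longlonglongrightarrow> integral\<^sup>L \<upsilon>' g"
    and le: "\<And>k. relative_entropy (\<upsilon> k) (\<mu> k) + relative_entropy (\<upsilon> k) \<nu> \<le> c k" and c: "c \<longlonglongrightarrow> c'"
  shows "relative_entropy \<upsilon>' \<mu>' + relative_entropy \<upsilon>' \<nu> \<le> c'"
proof -
  define F where "F \<alpha> \<beta> g = integral\<^sup>L \<alpha> g - ln (integral\<^sup>L \<beta> (\<lambda>x. exp (g x)))"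
    for \<alpha> \<beta> :: "real measure" and g :: "real \<Rightarrow> real"
  have le': "ereal (F \<upsilon>' \<mu>' g) + ereal (F \<upsilon>' \<nu> h) \<le> c'" if gh: "continuous_on S01 g" "continuous_on S01 h" for g h
  proof (rule LIMSEQ_le[OF _ c])
    have "(\<lambda>k. F (\<upsilon> k) (\<mu> k) g + F (\<upsilon> k) \<nu> h) \<longlonglongrightarrow> F \<upsilon>' \<mu>' g + F \<upsilon>' \<nu> h"
      unfolding F_def by (intro tendsto_add relative_entropy_term_tendsto M1 lim gh tendsto_const)
    then show "(\<lambda>k. ereal (F (\<upsilon> k) (\<mu> k) g + F (\<upsilon> k) \<nu> h)) \<longlonglongrightarrow> ereal (F \<upsilon>' \<mu>' g) + ereal (F \<upsilon>' \<nu> h)"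
      by simp
    have "ereal (F (\<upsilon> k) (\<mu> k) g) + ereal (F (\<upsilon> k) \<nu> h) \<le> c k" for k
      using relative_entropy_ge[OF gh(1)] relative_entropy_ge[OF gh(2)] le[of k]
      unfolding F_def by (meson add_mono order_trans)
    then show "\<exists>N. \<forall>k\<ge>N. ereal (F (\<upsilon> k) (\<mu> k) g + F (\<upsilon> k) \<nu> h) \<le> c k" by simp
  qed
  have eq: "relative_entropy \<alpha> \<beta> = (SUP g\<in>{g. continuous_on S01 g}. ereal (F \<alpha> \<beta> g))" for \<alpha> \<beta>
    by (simp add: relative_entropy_def F_def)
  have ne: "{g :: real \<Rightarrow> real. continuous_on S01 g} \<noteq> {}"
    using continuous_on_id by blast
  \<comment> \<open>The two suprema are restored one at a time: in \<open>ereal\<close> a supremum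
    may be pulled out of a sum when the other summand is not minus infinity, which nonnegativity of
    relative entropy ensures in the second round.\<close>
  have "ereal (F \<upsilon>' \<mu>' g) + relative_entropy \<upsilon>' \<nu> \<le> c'" if "continuous_on S01 g" for g
    unfolding eq using le'[OF that] ne
    by (subst SUP_ereal_add_right[symmetric]) (auto intro!: SUP_least)
  moreover have "relative_entropy \<upsilon>' \<nu> \<noteq> -\<infinity>"
    using relative_entropy_nonneg[OF M1(4,5)] by auto
  ultimately show ?thesis
    unfolding eq[of \<upsilon>' \<mu>'] using ne
    by (subst SUP_ereal_add_left[symmetric]) (auto intro!: SUP_least)
qed

lemma relative_entropy_lsc:
  assumes M1: "\<And>k. \<mu> k \<in> M1" "\<mu>' \<in> M1" "\<nu> \<in> M1"
    and lim: "\<And>g :: real \<Rightarrow> real. continuous_on S01 g \<Longrightarrow> (\<lambda>k. integral\<^sup>L (\<mu> k) g) \<longlonglongrightarrow> integral\<^sup>L \<mu>' g"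
    and le: "\<And>k. relative_entropy \<nu> (\<mu> k) \<le> c k" and c: "c \<longlonglongrightarrow> c'"
  shows "relative_entropy \<nu> \<mu>' \<le> c'"
  unfolding relative_entropy_def
proof (intro SUP_least)
  fix g :: "real \<Rightarrow> real" assume "g \<in> {g. continuous_on S01 g}"
  then have g: "continuous_on S01 g" by simp
  show "ereal (integral\<^sup>L \<nu> g - ln (integral\<^sup>L \<mu>' (\<lambda>x. exp (g x)))) \<le> c'"
  proof (rule LIMSEQ_le[OF _ c])
    show "(\<lambda>k. ereal (integral\<^sup>L \<nu> g - ln (integral\<^sup>L (\<mu> k) (\<lambda>x. exp (g x)))))
        \<longlonglongrightarrow> ereal (integral\<^sup>L \<nu> g - ln (integral\<^sup>L \<mu>' (\<lambda>x. exp (g x))))"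
      using relative_entropy_term_tendsto[OF M1(3,3,1,2) tendsto_const lim g] by simp
    show "\<exists>N. \<forall>k\<ge>N. ereal (integral\<^sup>L \<nu> g - ln (integral\<^sup>L (\<mu> k) (\<lambda>x. exp (g x)))) \<le> c k"
      using relative_entropy_ge[OF g] le order_trans by blast
  qed
qed

section \<open>Dual kernels and their critical points\<close>

text \<open>Strict positivity on the compact set \<open>S01\<close> already gives a positive lower
  bound for continuous \<open>f\<close>, so integrands built from
  \<open>1 / (1 + t * (f x - u))\<close> are bounded. The condition does not involve the measure, so
  kernels of different measures can be compared on the same parameters.\<close>

definition admissible :: "(real \<Rightarrow> real) \<Rightarrow> real \<Rightarrow> real \<Rightarrow> bool" where
  "admissible f u t \<longleftrightarrow> (\<forall>x\<in>S01. 0 < 1 + t * (f x - u))"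

text \<open>This is \<open>1 / n\<close> times the logarithm of the \<open>n\<close>-th inverse
  moment of \<open>1 + t * (X - u)\<close>, where X is the mean of \<open>f\<close> under the
  Dirichlet process of parameter \<open>n\<close>; \<open>inverse_kernel\<close> is the analogue for
  Dirichlet weights. Both take the place of a logarithmic moment generating function centred at
  \<open>u\<close>.\<close>

definition log_kernel :: "real measure \<Rightarrow> (real \<Rightarrow> real) \<Rightarrow> real \<Rightarrow> real \<Rightarrow> real" where
  "log_kernel \<nu> f u t = - (\<integral>x. ln (1 + t * (f x - u)) \<partial>\<nu>)"

definition inverse_kernel :: "real measure \<Rightarrow> (real \<Rightarrow> real) \<Rightarrow> real \<Rightarrow> real \<Rightarrow> real" where
  "inverse_kernel \<nu> f u t = ln (\<integral>x. 1 / (1 + t * (f x - u)) \<partial>\<nu>)"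

text \<open>A transform of Legendre type in which \<open>u\<close> enters through the kernel instead
  of a linear term. Since \<open>t = 0\<close> is always admissible, the supremum is over a nonempty
  set.\<close>

definition dual_rate ::
    "((real \<Rightarrow> real) \<Rightarrow> real \<Rightarrow> real \<Rightarrow> real) \<Rightarrow> (real \<Rightarrow> real) \<Rightarrow> real \<Rightarrow> ereal" where
  "dual_rate \<kappa> f u = (SUP t\<in>{t. admissible f u t}. ereal (- \<kappa> f u t))"

text \<open>The trace of full support that the argument consumes: mass near the minimum of
  \<open>f\<close> and, for \<open>- f\<close>, near the maximum. It can be checked for the law of a
  random mean without determining the support of that law.\<close>

definition charges_below :: "real measure \<Rightarrow> (real \<Rightarrow> real) \<Rightarrow> bool" where
  "charges_below \<nu> f \<longleftrightarrow>
     (\<forall>c. (\<exists>x\<in>S01. f x < c) \<longrightarrow> 0 < measure \<nu> {x\<in>S01. f x \<le> c})"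

lemma admissible_pos: "admissible f u t \<Longrightarrow> x \<in> S01 \<Longrightarrow> 0 < 1 + t * (f x - u)"
  by (simp add: admissible_def)

lemma admissible_zero [simp]: "admissible f u 0"
  by (simp add: admissible_def)

lemma admissible_mono:
  assumes "admissible g v t" "0 \<le> t" "\<And>x. x \<in> S01 \<Longrightarrow> g x - v \<le> f x - u"
  shows "admissible f u t"
  unfolding admissible_def
  using assms by (metis add_left_mono admissible_pos less_le_trans mult_left_mono)

lemma admissible_reflect: "admissible (\<lambda>x. - f x) (- u) (- t) \<longleftrightarrow> admissible f u t"
  by (simp add: admissible_def algebra_simps)

lemma continuous_on_admissible:
  assumes "continuous_on S01 f" "admissible f u t"
  shows "continuous_on S01 (\<lambda>x. ln (1 + t * (f x - u)))"
    and "continuous_on S01 (\<lambda>x. 1 / (1 + t * (f x - u)))"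
    and "continuous_on S01 (\<lambda>x. (f x - u) / (1 + t * (f x - u)) ^ j)"
proof -
  have "1 + t * (f x - u) \<noteq> 0" "(1 + t * (f x - u)) ^ j \<noteq> 0" if "x \<in> S01" for x
    using admissible_pos[OF assms(2) that] by auto
  then show "continuous_on S01 (\<lambda>x. ln (1 + t * (f x - u)))"
    "continuous_on S01 (\<lambda>x. 1 / (1 + t * (f x - u)))"
    "continuous_on S01 (\<lambda>x. (f x - u) / (1 + t * (f x - u)) ^ j)"
    by (intro continuous_intros assms; blast)+
qed

lemma dual_rate_ge: "admissible f u t \<Longrightarrow> ereal (- \<kappa> f u t) \<le> dual_rate \<kappa> f u"
  unfolding dual_rate_def by (intro SUP_upper) simp

text \<open>Factoring out the unperturbed term leaves \<open>1 + r * q\<close> with \<open>q\<close>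
  bounded by \<open>B\<close>; for |r| below \<open>1 / (2 * B)\<close> the product
  \<open>r * q\<close> stays within 1/2, the range of the quadratic estimates for logarithm and
  reciprocal.\<close>

lemma admissible_perturb:
  assumes "continuous_on S01 f" "admissible f u t"
  obtains B s where "0 < B" "0 < s"
    "\<And>x. x \<in> S01 \<Longrightarrow> \<bar>(f x - u) / (1 + t * (f x - u))\<bar> \<le> B"
    "\<And>r x. \<bar>r\<bar> < s \<Longrightarrow> x \<in> S01 \<Longrightarrow> \<bar>r * ((f x - u) / (1 + t * (f x - u)))\<bar> \<le> 1 / 2"
    "\<And>r x. x \<in> S01 \<Longrightarrow> 1 + (t + r) * (f x - u) =
        (1 + t * (f x - u)) * (1 + r * ((f x - u) / (1 + t * (f x - u))))"
    "\<And>r. \<bar>r\<bar> < s \<Longrightarrow> admissible f u (t + r)"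
proof -
  define q where "q x = (f x - u) / (1 + t * (f x - u))" for x
  have "continuous_on S01 q"
    using continuous_on_admissible(3)[OF assms, of 1] by (simp add: q_def)
  then obtain B where B: "0 < B" "\<And>x. x \<in> S01 \<Longrightarrow> \<bar>q x\<bar> \<le> B"
    using continuous_on_S01_bound by blast
  have small: "\<bar>r * q x\<bar> \<le> 1 / 2" if "\<bar>r\<bar> < 1 / (2 * B)" "x \<in> S01" for r x
  proof -
    have "\<bar>r\<bar> * \<bar>q x\<bar> \<le> 1 / (2 * B) * B"
      using that B by (intro mult_mono) auto
    then show ?thesis using B by (simp add: abs_mult)
  qed
  have factor: "1 + (t + r) * (f x - u) = (1 + t * (f x - u)) * (1 + r * q x)" if "x \<in> S01" for r x
    using admissible_pos[OF assms(2) that] by (simp add: q_def field_simps)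
  have "admissible f u (t + r)" if "\<bar>r\<bar> < 1 / (2 * B)" for r
    unfolding admissible_def
  proof
    fix x assume x: "x \<in> S01"
    have "0 < 1 + r * q x" using small[OF that x] by auto
    then show "0 < 1 + (t + r) * (f x - u)"
      using admissible_pos[OF assms(2) x] by (simp add: factor[OF x])
  qed
  then show ?thesis
    using that[of B "1 / (2 * B)"] B small factor by (simp add: q_def)
qed

text \<open>Dominated convergence: the lower bound \<open>d\<close>, uniform in \<open>t\<close>,
  yields the dominating constant \<open>B / d ^ j\<close>.\<close>

lemma continuous_on_weighted_mean:
  fixes f :: "real \<Rightarrow> real"
  assumes \<nu>: "\<nu> \<in> M1" and f: "continuous_on S01 f"
    and d: "0 < d" "\<And>t x. t \<in> A \<Longrightarrow> x \<in> S01 \<Longrightarrow> d \<le> 1 + t * (f x - u)"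
  shows "continuous_on A (\<lambda>t. \<integral>x. (f x - u) / (1 + t * (f x - u)) ^ j \<partial>\<nu>)"
  unfolding continuous_on_sequentially comp_def
proof (intro allI ballI impI, elim conjE)
  fix X t assume t: "t \<in> A" and X: "\<forall>n. X n \<in> A" and lim: "X \<longlonglongrightarrow> t"
  have adm: "admissible f u s" if "s \<in> A" for s
    using d less_le_trans[OF d(1)] that by (simp add: admissible_def)
  interpret prob_space \<nu> using \<nu> by (rule M1_prob_space)
  obtain B where B: "0 < B" "\<And>x. x \<in> S01 \<Longrightarrow> \<bar>f x - u\<bar> \<le> B"
    using continuous_on_S01_bound[OF continuous_on_diff[OF f continuous_on_const], of u] by blast
  show "(\<lambda>n. \<integral>x. (f x - u) / (1 + X n * (f x - u)) ^ j \<partial>\<nu>)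
      \<longlonglongrightarrow> (\<integral>x. (f x - u) / (1 + t * (f x - u)) ^ j \<partial>\<nu>)"
  proof (rule integral_dominated_convergence[where w = "\<lambda>_. B / d ^ j"])
    show "AE x in \<nu>. (\<lambda>n. (f x - u) / (1 + X n * (f x - u)) ^ j)
        \<longlonglongrightarrow> (f x - u) / (1 + t * (f x - u)) ^ j"
    proof (intro AE_I2 tendsto_intros lim)
      fix x assume "x \<in> space \<nu>"
      then show "(1 + t * (f x - u)) ^ j \<noteq> 0"
        using admissible_pos[OF adm[OF t], of x] M1_space[OF \<nu>] by simp
    qed
    show "AE x in \<nu>. norm ((f x - u) / (1 + X n * (f x - u)) ^ j) \<le> B / d ^ j" for n
    proof (intro AE_I2)
      fix x assume "x \<in> space \<nu>"
      then have x: "x \<in> S01" using M1_space[OF \<nu>] by simp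
      have "\<bar>f x - u\<bar> / (1 + X n * (f x - u)) ^ j \<le> B / d ^ j"
        using B(1) B(2)[OF x] d(2)[OF X[rule_format] x, of n] d(1)
        by (intro frac_le power_mono) auto
      then show "norm ((f x - u) / (1 + X n * (f x - u)) ^ j) \<le> B / d ^ j"
        using admissible_pos[OF adm[OF X[rule_format, of n]] x] by (simp add: abs_divide)
    qed
  qed (use X t in \<open>auto intro!: M1_borel_measurable \<nu> continuous_on_admissible f adm\<close>)
qed

text \<open>Intermediate value theorem: the weighted mean is positive at 0 because \<open>u\<close>
  lies below the mean of \<open>f\<close>, and towards the end of the admissible interval the atom
  at the minimum \<open>c\<close> contributes an arbitrarily large negative term.\<close>

lemma critical_point_exists:
  fixes f :: "real \<Rightarrow> real"
  assumes \<nu>: "\<nu> \<in> M1" and f: "continuous_on S01 f" and c: "\<And>x. x \<in> S01 \<Longrightarrow> c \<le> f x"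
    and mass: "0 < measure \<nu> {x\<in>S01. f x = c}" and u: "c < u" "u < integral\<^sup>L \<nu> f" and j: "1 \<le> j"
  obtains t where "0 < t" "admissible f u t" "(\<integral>x. (f x - u) / (1 + t * (f x - u)) ^ j \<partial>\<nu>) = 0"
proof -
  interpret prob_space \<nu> using \<nu> by (rule M1_prob_space)
  define \<psi> where "\<psi> t = (\<integral>x. (f x - u) / (1 + t * (f x - u)) ^ j \<partial>\<nu>)" for t
  define p where "p = measure \<nu> {x\<in>S01. f x = c}"
  obtain B where B: "0 < B" "\<And>x. x \<in> S01 \<Longrightarrow> \<bar>f x - u\<bar> \<le> B"
    using continuous_on_S01_bound[OF continuous_on_diff[OF f continuous_on_const], of u] by blast
  \<comment> \<open>\<open>r\<close> is the value of \<open>1 + t * (f - u)\<close> on the atom. It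
    is small enough for the atom's term \<open>p * (u - c) / r\<close> to outweigh the bound
    \<open>B\<close> for the rest; the cap 1/2 keeps \<open>t\<close> positive.\<close>
  define r where "r = min (1 / 2) (p * (u - c) / B)"
  define t where "t = (1 - r) / (u - c)"
  have r: "0 < r" "r < 1" "r \<le> p * (u - c) / B"
    using mass u B(1) by (auto simp: r_def p_def)
  have t: "0 < t" "1 - t * (u - c) = r" using r u by (auto simp: t_def)
  have lb: "r \<le> 1 + s * (f x - u)" if "s \<in> {0..t}" "x \<in> S01" for s x
  proof -
    have "s * (u - f x) \<le> s * (u - c)"
      using that c[OF that(2)] by (intro mult_left_mono) auto
    also have "\<dots> \<le> t * (u - c)" using that u by (intro mult_right_mono) auto
    finally show ?thesis using t(2) by (simp add: algebra_simps)
  qed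
  have adm: "admissible f u s" if "s \<in> {0..t}" for s
    using lb[OF that] r(1) less_le_trans[OF r(1)] by (simp add: admissible_def)
  have cont: "continuous_on {0..t} \<psi>"
    unfolding \<psi>_def by (rule continuous_on_weighted_mean[OF \<nu> f r(1) lb])
  have "\<psi> 0 = integral\<^sup>L \<nu> f - u"
    using M1_integral_affine[OF \<nu> f, of 0 1 u] by (simp add: \<psi>_def)
  then have pos: "0 < \<psi> 0" using u by simp
  have A: "{x\<in>S01. f x = c} \<in> sets \<nu>"
    using borel_measurable_eq[OF M1_borel_measurable[OF \<nu> f] borel_measurable_const, of c] M1_space[OF \<nu>]
    by simp
  \<comment> \<open>Pointwise bound: where \<open>f >= u\<close> the denominator is at least 1,
    below \<open>u\<close> the integrand is nonpositive, and on the atom \<open>r ^ j <= r\<close>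
    since \<open>j >= 1\<close> and \<open>r < 1\<close>.\<close>
  have "\<psi> t \<le> (\<integral>x. B - (u - c) / r * indicator {x\<in>S01. f x = c} x \<partial>\<nu>)"
    unfolding \<psi>_def
  proof (rule integral_mono)
    show "integrable \<nu> (\<lambda>x. (f x - u) / (1 + t * (f x - u)) ^ j)"
      using t(1) by (intro M1_integrable \<nu> continuous_on_admissible f adm) auto
    show "integrable \<nu> (\<lambda>x. B - (u - c) / r * indicator {x\<in>S01. f x = c} x)"
      using A by (intro Bochner_Integration.integrable_diff integrable_mult_right integrable_const
          integrable_real_indicator) (auto simp: emeasure_eq_measure)
    fix x assume "x \<in> space \<nu>"
    then have x: "x \<in> S01" using M1_space[OF \<nu>] by simp
    have den: "0 < (1 + t * (f x - u)) ^ j"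
      using admissible_pos[OF adm x, of t] t(1) by simp
    show "(f x - u) / (1 + t * (f x - u)) ^ j \<le> B - (u - c) / r * indicator {x\<in>S01. f x = c} x"
    proof (cases "f x = c")
      case True
      have "r ^ j \<le> r" using r j power_decreasing[of 1 j r] by simp
      then have "(u - c) / r \<le> (u - c) / r ^ j" using u r by (intro divide_left_mono) auto
      moreover have "1 + t * (f x - u) = r" using t(2) True by (simp add: algebra_simps)
      ultimately show ?thesis using True x B(1) by (simp add: diff_divide_distrib)
    next
      case False
      have "(f x - u) / (1 + t * (f x - u)) ^ j \<le> B"
      proof (cases "0 \<le> f x - u")
        case True
        then have "1 \<le> (1 + t * (f x - u)) ^ j" using t(1) by (intro one_le_power) auto
        then have "(f x - u) / (1 + t * (f x - u)) ^ j \<le> (f x - u) / 1"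
          using True by (intro divide_left_mono) auto
        then show ?thesis using B(2)[OF x] by simp
      next
        case False
        then have "(f x - u) / (1 + t * (f x - u)) ^ j \<le> 0"
          using den by (intro divide_nonpos_pos) auto
        then show ?thesis using B(1) by simp
      qed
      then show ?thesis using False by simp
    qed
  qed
  also have "\<dots> = B - (u - c) / r * p"
    using A by (subst Bochner_Integration.integral_diff) (auto simp: p_def prob_space emeasure_eq_measure)
  also have "\<dots> \<le> 0"
  proof -
    have "r * B \<le> p * (u - c)" using r(3) B(1) by (simp add: field_simps)
    then show ?thesis using r(1) by (simp add: field_simps)
  qed
  finally have "\<psi> t \<le> 0" .
  then obtain s where s: "0 \<le> s" "s \<le> t" "\<psi> s = 0"
    using IVT2'[of \<psi> t 0 0] cont pos t(1) by force
  then have "0 < s" using pos by (cases "s = 0") auto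
  then show ?thesis using that[of s] s adm by (simp add: \<psi>_def)
qed

section \<open>Common framework for the two kernels\<close>

text \<open>\<open>j\<close> is the power in the derivative: up to a positive factor, the derivative
  of the kernel in \<open>t\<close> is minus the integral of
  \<open>(f x - u) / (1 + t * (f x - u)) ^ j\<close>, with \<open>j = 1\<close> for the logarithmic
  and \<open>j = 2\<close> for the inverse kernel. \<open>kernel_nonneg\<close> discards parameters
  pointing to the wrong side of the mean; \<open>kernel_critical\<close> is a second-order
  expansion, in the direction that bounds the tails of a tilted law.\<close>

locale dual_kernel =
  fixes \<nu> :: "real measure" and \<kappa> :: "(real \<Rightarrow> real) \<Rightarrow> real \<Rightarrow> real \<Rightarrow> real" and j :: nat
  assumes \<nu>: "\<nu> \<in> M1" and j: "1 \<le> j"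
    and kernel_mono: "\<And>f g u v t. \<lbrakk>continuous_on S01 f; continuous_on S01 g; 0 \<le> t; admissible g v t;
      \<And>x. x \<in> S01 \<Longrightarrow> g x - v \<le> f x - u\<rbrakk> \<Longrightarrow> \<kappa> f u t \<le> \<kappa> g v t"
    and kernel_reflect: "\<And>f u t. \<kappa> (\<lambda>x. - f x) (- u) (- t) = \<kappa> f u t"
    and kernel_const: "\<And>c u t. \<kappa> (\<lambda>_. c) u t = - ln (1 + t * (c - u))"
    and kernel_zero: "\<And>f u. \<kappa> f u 0 = 0"
    and kernel_nonneg: "\<And>f u t. \<lbrakk>continuous_on S01 f; admissible f u t; t * (integral\<^sup>L \<nu> f - u) \<le> 0\<rbrakk>
      \<Longrightarrow> 0 \<le> \<kappa> f u t"
    and kernel_critical: "\<And>f u t. \<lbrakk>continuous_on S01 f; admissible f u t;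
      (\<integral>x. (f x - u) / (1 + t * (f x - u)) ^ j \<partial>\<nu>) = 0\<rbrakk>
      \<Longrightarrow> \<exists>C>0. \<exists>s>0. \<forall>r. \<bar>r\<bar> < s \<longrightarrow> admissible f u (t + r) \<and> \<kappa> f u (t + r) \<le> \<kappa> f u t + C * r\<^sup>2"
begin

lemma dual_rate_nonneg: "0 \<le> dual_rate \<kappa> f u"
  using dual_rate_ge[of f u 0 \<kappa>] by (simp add: kernel_zero zero_ereal_def)

text \<open>The change of parameter from \<open>t\<close> to \<open>- t\<close>; it reduces values
  of \<open>u\<close> above the mean to values below it.\<close>

lemma dual_rate_reflect: "dual_rate \<kappa> (\<lambda>x. - f x) (- u) = dual_rate \<kappa> f u"
proof -
  have "{t. admissible (\<lambda>x. - f x) (- u) t} = uminus ` {t. admissible f u t}"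
  proof (intro set_eqI)
    fix t show "t \<in> {t. admissible (\<lambda>x. - f x) (- u) t} \<longleftrightarrow> t \<in> uminus ` {t. admissible f u t}"
      using admissible_reflect[of f u "- t"] by (force simp: image_iff)
  qed
  then show ?thesis
    by (simp add: dual_rate_def image_image kernel_reflect)
qed

text \<open>Below the range of \<open>f\<close> every \<open>t >= 0\<close> is admissible, and
  comparison with the constant \<open>m\<close> sends the kernel to minus infinity.\<close>

lemma dual_rate_below_range:
  assumes f: "continuous_on S01 f" and m: "\<And>x. x \<in> S01 \<Longrightarrow> m \<le> f x" and u: "u < m"
  shows "dual_rate \<kappa> f u = \<infinity>"
proof (rule ereal_top)
  fix B :: real
  \<comment> \<open>Makes \<open>t * (m - u)\<close> equal to \<open>exp B\<close>, so that the
    kernel of the constant falls below \<open>- B\<close>.\<close>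
  define t where "t = (exp B) / (m - u)"
  have t: "0 < t" using u by (simp add: t_def)
  have adm: "admissible (\<lambda>_. m) u t" using t u by (simp add: admissible_def add_pos_pos)
  have "\<kappa> f u t \<le> \<kappa> (\<lambda>_. m) u t"
    using t m by (intro kernel_mono f adm) (auto intro!: continuous_intros)
  also have "\<dots> = - ln (1 + exp B)"
    using u by (simp add: kernel_const t_def)
  also have "\<dots> \<le> - B"
    using ln_le_cancel_iff[of "exp B" "1 + exp B"] by (simp add: add_pos_pos)
  finally have "ereal B \<le> ereal (- \<kappa> f u t)" by simp
  also have "\<dots> \<le> dual_rate \<kappa> f u"
    using t m by (intro dual_rate_ge admissible_mono[OF adm]) auto
  finally show "ereal B \<le> dual_rate \<kappa> f u" .
qed

text \<open>Cutting \<open>f\<close> off slightly above its minimum produces an atom there, which forces an interior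
  critical point.\<close>

lemma approx_critical_below:
  assumes f: "continuous_on S01 f" and low: "charges_below \<nu> f"
    and fin: "dual_rate \<kappa> f u < \<infinity>" and u: "u < integral\<^sup>L \<nu> f" and e: "0 < e"
  shows "\<exists>g v t. continuous_on S01 g \<and> (\<forall>x\<in>S01. \<bar>g x - f x\<bar> \<le> e) \<and> \<bar>v - u\<bar> \<le> e \<and> admissible g v t \<and>
    (\<integral>x. (g x - v) / (1 + t * (g x - v)) ^ j \<partial>\<nu>) = 0 \<and> ereal (- \<kappa> g v t) \<le> dual_rate \<kappa> f u"
proof -
  obtain x0 where x0: "x0 \<in> S01" "\<And>x. x \<in> S01 \<Longrightarrow> f x0 \<le> f x"
    using continuous_attains_inf[OF _ _ f] by auto
  have mu: "f x0 \<le> u" using dual_rate_below_range[OF f x0(2), of u] fin by force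
  \<comment> \<open>Half of \<open>e\<close> because \<open>u\<close> is moved by
    \<open>2 * d\<close>; a quarter of the gap keeps \<open>u + 2 * d\<close> below the
    mean.\<close>
  define d where "d = min (e / 2) ((integral\<^sup>L \<nu> f - u) / 4)"
  have d: "0 < d" "d \<le> e" "2 * d \<le> e" "u + 2 * d < integral\<^sup>L \<nu> f"
    using e u unfolding d_def by (auto simp: min_def field_simps)
  define g where "g x = max (f x) (f x0 + d)" for x
  \<comment> \<open>The shift must exceed \<open>d\<close>: the minimum of \<open>g\<close> is
    \<open>f x0 + d\<close>, \<open>u\<close> may equal \<open>f x0\<close>, and \<open>v\<close>
    has to lie strictly above that minimum. The shift also outweighs the rise from \<open>f\<close>
    to \<open>g\<close>, so \<open>g - v <= f - u\<close>.\<close>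
  define v where "v = u + 2 * d"
  have g: "continuous_on S01 g" unfolding g_def by (intro continuous_intros f)
  have gf: "f x \<le> g x" "g x \<le> f x + d" if "x \<in> S01" for x
    using x0(2)[OF that] d by (auto simp: g_def)
  have "{x\<in>S01. g x = f x0 + d} = {x\<in>S01. f x \<le> f x0 + d}" by (auto simp: g_def)
  moreover have "\<exists>x\<in>S01. f x < f x0 + d" using x0(1) d(1) by force
  ultimately have mass: "0 < measure \<nu> {x\<in>S01. g x = f x0 + d}"
    using low unfolding charges_below_def by simp
  have "integral\<^sup>L \<nu> f \<le> integral\<^sup>L \<nu> g" by (intro M1_integral_mono \<nu> f g gf)
  then have v: "f x0 + d < v" "v < integral\<^sup>L \<nu> g" using mu d by (auto simp: v_def)
  have ge: "f x0 + d \<le> g x" if "x \<in> S01" for x by (simp add: g_def)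
  obtain t where t: "0 < t" "admissible g v t" "(\<integral>x. (g x - v) / (1 + t * (g x - v)) ^ j \<partial>\<nu>) = 0"
    by (rule critical_point_exists[OF \<nu> g ge mass v j])
  have le: "g x - v \<le> f x - u" if "x \<in> S01" for x
    using gf(2)[OF that] d by (simp add: v_def)
  \<comment> \<open>The same \<open>t\<close> is admissible for the original pair, and the kernel
    there is no larger, so the cut-off cannot lift the dual value above the rate.\<close>
  have "\<kappa> f u t \<le> \<kappa> g v t" using t by (intro kernel_mono f g le) auto
  then have "ereal (- \<kappa> g v t) \<le> ereal (- \<kappa> f u t)" by simp
  also have "\<dots> \<le> dual_rate \<kappa> f u"
    using t by (intro dual_rate_ge admissible_mono[OF t(2) _ le]) auto
  finally have "ereal (- \<kappa> g v t) \<le> dual_rate \<kappa> f u" .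
  moreover have "\<forall>x\<in>S01. \<bar>g x - f x\<bar> \<le> e"
  proof
    fix x assume "x \<in> S01"
    from gf[OF this] d(2) show "\<bar>g x - f x\<bar> \<le> e" by simp
  qed
  moreover have "\<bar>v - u\<bar> \<le> e" using d by (simp add: v_def)
  ultimately show ?thesis using g t by blast
qed

text \<open>Three positions of \<open>u\<close>: below the mean the cut-off applies; at the mean
  \<open>t = 0\<close> is already critical for \<open>f\<close> itself; above it the cut-off is
  applied to \<open>- f\<close>, the critical integrand being odd under reflection.\<close>

lemma approx_critical:
  assumes f: "continuous_on S01 f" and low: "charges_below \<nu> f" "charges_below \<nu> (\<lambda>x. - f x)"
    and fin: "dual_rate \<kappa> f u < \<infinity>" and e: "0 < e"
  shows "\<exists>g v t. continuous_on S01 g \<and> (\<forall>x\<in>S01. \<bar>g x - f x\<bar> \<le> e) \<and> \<bar>v - u\<bar> \<le> e \<and> admissible g v t \<and>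
    (\<integral>x. (g x - v) / (1 + t * (g x - v)) ^ j \<partial>\<nu>) = 0 \<and> ereal (- \<kappa> g v t) \<le> dual_rate \<kappa> f u"
proof (cases u "integral\<^sup>L \<nu> f" rule: linorder_cases)
  case less
  then show ?thesis by (intro approx_critical_below f low(1) fin e)
next
  case equal
  then have "(\<integral>x. f x - u \<partial>\<nu>) = 0"
    using M1_integral_affine[OF \<nu> f, of 0 1 u] by simp
  then show ?thesis
    using f e dual_rate_nonneg
    by (intro exI[of _ f] exI[of _ u] exI[of _ 0]) (simp add: kernel_zero zero_ereal_def)
next
  case greater
  have "- u < (\<integral>x. - f x \<partial>\<nu>)" using greater by simp
  moreover have "dual_rate \<kappa> (\<lambda>x. - f x) (- u) < \<infinity>" using fin by (simp only: dual_rate_reflect)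
  ultimately have "\<exists>g v t. continuous_on S01 g \<and> (\<forall>x\<in>S01. \<bar>g x - - f x\<bar> \<le> e) \<and> \<bar>v - - u\<bar> \<le> e \<and>
      admissible g v t \<and> (\<integral>x. (g x - v) / (1 + t * (g x - v)) ^ j \<partial>\<nu>) = 0 \<and>
      ereal (- \<kappa> g v t) \<le> dual_rate \<kappa> (\<lambda>x. - f x) (- u)"
    by (intro approx_critical_below continuous_on_minus f low(2) e)
  then
  obtain g v t where g: "continuous_on S01 g" "\<forall>x\<in>S01. \<bar>g x - - f x\<bar> \<le> e" "\<bar>v - - u\<bar> \<le> e"
    "admissible g v t" "(\<integral>x. (g x - v) / (1 + t * (g x - v)) ^ j \<partial>\<nu>) = 0"
    "ereal (- \<kappa> g v t) \<le> dual_rate \<kappa> f u"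
    unfolding dual_rate_reflect by blast
  have eq: "(- g x - - v) / (1 + - t * (- g x - - v)) ^ j = - ((g x - v) / (1 + t * (g x - v)) ^ j)" for x
    by (simp add: algebra_simps minus_divide_left)
  show ?thesis
  proof (intro exI conjI)
    show "continuous_on S01 (\<lambda>x. - g x)" using g(1) by (rule continuous_on_minus)
    show "\<forall>x\<in>S01. \<bar>- g x - f x\<bar> \<le> e" using g(2) by (fastforce simp: abs_le_iff)
    show "\<bar>- v - u\<bar> \<le> e" using g(3) by (simp add: abs_le_iff)
    show "admissible (\<lambda>x. - g x) (- v) (- t)" using g(4) by (simp add: admissible_reflect)
    show "(\<integral>x. (- g x - - v) / (1 + - t * (- g x - - v)) ^ j \<partial>\<nu>) = 0"
      unfolding eq using g(5) by simp
    show "ereal (- \<kappa> (\<lambda>x. - g x) (- v) (- t)) \<le> dual_rate \<kappa> f u"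
      using g(6) by (simp add: kernel_reflect)
  qed
qed

end

section \<open>The logarithmic and the inverse kernel as instances of the framework\<close>

lemma ln_add_one_quadratic_bound:
  fixes y :: real
  assumes "\<bar>y\<bar> \<le> 1 / 2"
  shows "y - 2 * y\<^sup>2 \<le> ln (1 + y)"
proof (cases "0 \<le> y")
  case True
  then have "y - y\<^sup>2 \<le> ln (1 + y)" using assms by (intro ln_one_plus_pos_lower_bound) auto
  then show ?thesis using zero_le_power2[of y] by linarith
next
  case False
  then show ?thesis using ln_one_minus_pos_lower_bound[of "- y"] assms by simp
qed

lemma inverse_quadratic_bound:
  fixes y :: real
  assumes "\<bar>y\<bar> \<le> 1 / 2"
  shows "1 / (1 + y) \<le> 1 - y + 2 * y\<^sup>2"
proof -
  have "0 \<le> y\<^sup>2 * (1 + 2 * y)" using assms by (intro mult_nonneg_nonneg) auto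
  then have "1 \<le> (1 - y + 2 * y\<^sup>2) * (1 + y)"
    by (simp add: algebra_simps power2_eq_square)
  moreover have "0 < 1 + y" using assms by auto
  ultimately show ?thesis by (simp add: pos_divide_le_eq)
qed

text \<open>The sign condition follows from \<open>ln y <= y - 1\<close>; the expansion comes from
  splitting the logarithm of the perturbed product, whose linear part is the integral that vanishes
  at a critical point.\<close>

lemma dual_kernel_log:
  assumes \<nu>: "\<nu> \<in> M1"
  shows "dual_kernel \<nu> (log_kernel \<nu>) 1"
proof
  show "\<nu> \<in> M1" by fact
next
  fix f g :: "real \<Rightarrow> real" and u v t :: real
  assume fg: "continuous_on S01 f" "continuous_on S01 g" and t: "0 \<le> t" and adm: "admissible g v t"
    and le: "\<And>x. x \<in> S01 \<Longrightarrow> g x - v \<le> f x - u"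
  have adm': "admissible f u t" by (rule admissible_mono[OF adm t le])
  have "(\<integral>x. ln (1 + t * (g x - v)) \<partial>\<nu>) \<le> (\<integral>x. ln (1 + t * (f x - u)) \<partial>\<nu>)"
  proof (intro M1_integral_mono \<nu> continuous_on_admissible fg adm adm')
    fix x assume x: "x \<in> S01"
    have "1 + t * (g x - v) \<le> 1 + t * (f x - u)"
      using le[OF x] t by (intro add_left_mono mult_left_mono) auto
    then show "ln (1 + t * (g x - v)) \<le> ln (1 + t * (f x - u))"
      using admissible_pos[OF adm x] by simp
  qed
  then show "log_kernel \<nu> f u t \<le> log_kernel \<nu> g v t" by (simp add: log_kernel_def)
next
  fix f :: "real \<Rightarrow> real" and u t :: real
  assume f: "continuous_on S01 f" and adm: "admissible f u t" and le: "t * (integral\<^sup>L \<nu> f - u) \<le> 0"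
  have "(\<integral>x. ln (1 + t * (f x - u)) \<partial>\<nu>) \<le> (\<integral>x. 0 + t * (f x - u) \<partial>\<nu>)"
  proof (intro M1_integral_mono \<nu> continuous_on_admissible f adm)
    fix x assume "x \<in> S01"
    from ln_le_minus_one[OF admissible_pos[OF adm this]]
    show "ln (1 + t * (f x - u)) \<le> 0 + t * (f x - u)" by simp
  qed (intro continuous_intros f)
  also have "\<dots> \<le> 0" using le by (subst M1_integral_affine[OF \<nu> f]) simp
  finally show "0 \<le> log_kernel \<nu> f u t" by (simp add: log_kernel_def)
next
  fix f :: "real \<Rightarrow> real" and u t :: real
  assume f: "continuous_on S01 f" and adm: "admissible f u t"
    and crit: "(\<integral>x. (f x - u) / (1 + t * (f x - u)) ^ 1 \<partial>\<nu>) = 0"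
  define q where "q x = (f x - u) / (1 + t * (f x - u))" for x
  obtain B s where B: "0 < B" "0 < s" "\<And>x. x \<in> S01 \<Longrightarrow> \<bar>q x\<bar> \<le> B"
    "\<And>r x. \<bar>r\<bar> < s \<Longrightarrow> x \<in> S01 \<Longrightarrow> \<bar>r * q x\<bar> \<le> 1 / 2"
    and factor: "\<And>r x. x \<in> S01 \<Longrightarrow> 1 + (t + r) * (f x - u) = (1 + t * (f x - u)) * (1 + r * q x)"
    and adm': "\<And>r. \<bar>r\<bar> < s \<Longrightarrow> admissible f u (t + r)"
    using admissible_perturb[OF f adm] unfolding q_def by metis
  have q: "continuous_on S01 q" using continuous_on_admissible(3)[OF f adm, of 1] by (simp add: q_def)
  have q0: "integral\<^sup>L \<nu> q = 0" using crit by (simp add: q_def[abs_def])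
  have "log_kernel \<nu> f u (t + r) \<le> log_kernel \<nu> f u t + 2 * B\<^sup>2 * r\<^sup>2" if r: "\<bar>r\<bar> < s" for r
  proof -
    have "(\<integral>x. ln (1 + t * (f x - u)) + (- 2 * B\<^sup>2 * r\<^sup>2 + r * (q x - 0)) \<partial>\<nu>)
        \<le> (\<integral>x. ln (1 + (t + r) * (f x - u)) \<partial>\<nu>)"
    proof (intro M1_integral_mono \<nu> continuous_on_add continuous_on_diff continuous_on_mult
        continuous_on_const continuous_on_admissible(1) f q adm adm'[OF r])
      fix x assume x: "x \<in> S01"
      have y: "\<bar>r * q x\<bar> \<le> 1 / 2" by (rule B(4)[OF r x])
      then have "0 < 1 + r * q x" by auto
      then have "ln (1 + (t + r) * (f x - u)) = ln (1 + t * (f x - u)) + ln (1 + r * q x)"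
        using admissible_pos[OF adm x] by (simp add: factor[OF x] ln_mult)
      moreover have "(q x)\<^sup>2 \<le> B\<^sup>2" using power_mono[OF B(3)[OF x], of 2] by simp
      then have "(r * q x)\<^sup>2 \<le> B\<^sup>2 * r\<^sup>2"
        using mult_right_mono[of "(q x)\<^sup>2" "B\<^sup>2" "r\<^sup>2"] by (simp add: power_mult_distrib mult.commute)
      ultimately show "ln (1 + t * (f x - u)) + (- 2 * B\<^sup>2 * r\<^sup>2 + r * (q x - 0))
          \<le> ln (1 + (t + r) * (f x - u))"
        using ln_add_one_quadratic_bound[OF y] by simp
    qed
    also have "(\<integral>x. ln (1 + t * (f x - u)) + (- 2 * B\<^sup>2 * r\<^sup>2 + r * (q x - 0)) \<partial>\<nu>)
        = (\<integral>x. ln (1 + t * (f x - u)) \<partial>\<nu>) + (- 2 * B\<^sup>2 * r\<^sup>2 + r * (integral\<^sup>L \<nu> q - 0))"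
      unfolding M1_integral_affine[OF \<nu> q, symmetric]
      by (intro Bochner_Integration.integral_add M1_integrable \<nu> continuous_on_add continuous_on_diff
          continuous_on_mult continuous_on_const continuous_on_admissible(1) f q adm)
    finally show ?thesis by (simp add: log_kernel_def q0)
  qed
  then show "\<exists>C>0. \<exists>s>0. \<forall>r. \<bar>r\<bar> < s \<longrightarrow>
      admissible f u (t + r) \<and> log_kernel \<nu> f u (t + r) \<le> log_kernel \<nu> f u t + C * r\<^sup>2"
    using B(1,2) adm' by (intro exI[of _ "2 * B\<^sup>2"] conjI exI[of _ s]) auto
qed (use \<nu> in \<open>simp_all add: log_kernel_def algebra_simps\<close>)

text \<open>The sign condition is \<open>1 - y <= 1 / (1 + y)\<close>. In the expansion the weight
  \<open>w = 1 / (1 + t * (f - u))\<close> multiplies the linear term, which produces the square in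
  the critical equation.\<close>

lemma dual_kernel_inverse:
  assumes \<nu>: "\<nu> \<in> M1"
  shows "dual_kernel \<nu> (inverse_kernel \<nu>) 2"
proof
  show "\<nu> \<in> M1" by fact
next
  fix f g :: "real \<Rightarrow> real" and u v t :: real
  assume fg: "continuous_on S01 f" "continuous_on S01 g" and t: "0 \<le> t" and adm: "admissible g v t"
    and le: "\<And>x. x \<in> S01 \<Longrightarrow> g x - v \<le> f x - u"
  have adm': "admissible f u t" by (rule admissible_mono[OF adm t le])
  have "(\<integral>x. 1 / (1 + t * (f x - u)) \<partial>\<nu>) \<le> (\<integral>x. 1 / (1 + t * (g x - v)) \<partial>\<nu>)"
  proof (intro M1_integral_mono \<nu> continuous_on_admissible fg adm adm')
    fix x assume x: "x \<in> S01"
    have "1 + t * (g x - v) \<le> 1 + t * (f x - u)"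
      using le[OF x] t by (intro add_left_mono mult_left_mono) auto
    then show "1 / (1 + t * (f x - u)) \<le> 1 / (1 + t * (g x - v))"
      using admissible_pos[OF adm x] by (intro divide_left_mono) auto
  qed
  moreover have "0 < (\<integral>x. 1 / (1 + t * (f x - u)) \<partial>\<nu>)"
    using admissible_pos[OF adm'] by (intro M1_integral_pos \<nu> continuous_on_admissible fg adm') simp
  ultimately show "inverse_kernel \<nu> f u t \<le> inverse_kernel \<nu> g v t" by (simp add: inverse_kernel_def)
next
  fix f :: "real \<Rightarrow> real" and u t :: real
  assume f: "continuous_on S01 f" and adm: "admissible f u t" and le: "t * (integral\<^sup>L \<nu> f - u) \<le> 0"
  have "1 \<le> (\<integral>x. 1 + - t * (f x - u) \<partial>\<nu>)" using le by (subst M1_integral_affine[OF \<nu> f]) simp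
  also have "\<dots> \<le> (\<integral>x. 1 / (1 + t * (f x - u)) \<partial>\<nu>)"
  proof (intro M1_integral_mono \<nu> continuous_on_admissible f adm)
    fix x assume x: "x \<in> S01"
    have "(1 + - t * (f x - u)) * (1 + t * (f x - u)) = 1 - (t * (f x - u))\<^sup>2"
      by (simp add: algebra_simps power2_eq_square)
    then have "(1 + - t * (f x - u)) * (1 + t * (f x - u)) \<le> 1" by simp
    then show "1 + - t * (f x - u) \<le> 1 / (1 + t * (f x - u))"
      using admissible_pos[OF adm x] by (simp add: pos_le_divide_eq)
  qed (intro continuous_intros f)
  finally show "0 \<le> inverse_kernel \<nu> f u t" by (simp add: inverse_kernel_def)
next
  fix f :: "real \<Rightarrow> real" and u t :: real
  assume f: "continuous_on S01 f" and adm: "admissible f u t"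
    and crit: "(\<integral>x. (f x - u) / (1 + t * (f x - u)) ^ 2 \<partial>\<nu>) = 0"
  define q where "q x = (f x - u) / (1 + t * (f x - u))" for x
  obtain B s where B: "0 < B" "0 < s" "\<And>x. x \<in> S01 \<Longrightarrow> \<bar>q x\<bar> \<le> B"
    "\<And>r x. \<bar>r\<bar> < s \<Longrightarrow> x \<in> S01 \<Longrightarrow> \<bar>r * q x\<bar> \<le> 1 / 2"
    and factor: "\<And>r x. x \<in> S01 \<Longrightarrow> 1 + (t + r) * (f x - u) = (1 + t * (f x - u)) * (1 + r * q x)"
    and adm': "\<And>r. \<bar>r\<bar> < s \<Longrightarrow> admissible f u (t + r)"
    using admissible_perturb[OF f adm] unfolding q_def by metis
  define w where "w x = 1 / (1 + t * (f x - u))" for x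
  define h where "h x = (f x - u) / (1 + t * (f x - u)) ^ 2" for x
  have w: "continuous_on S01 w" and h: "continuous_on S01 h"
    using continuous_on_admissible[OF f adm] by (simp_all add: w_def h_def)
  have wpos: "0 < w x" if "x \<in> S01" for x using admissible_pos[OF adm that] by (simp add: w_def)
  have h0: "integral\<^sup>L \<nu> h = 0" using crit by (simp add: h_def[abs_def])
  have Zpos: "0 < integral\<^sup>L \<nu> w" by (intro M1_integral_pos \<nu> w wpos)
  have "inverse_kernel \<nu> f u (t + r) \<le> inverse_kernel \<nu> f u t + 2 * B\<^sup>2 * r\<^sup>2" if r: "\<bar>r\<bar> < s" for r
  proof -
    have "(\<integral>x. 1 / (1 + (t + r) * (f x - u)) \<partial>\<nu>) \<le> (\<integral>x. (1 + 2 * B\<^sup>2 * r\<^sup>2) * w x + - r * h x \<partial>\<nu>)"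
    proof (intro M1_integral_mono \<nu> continuous_on_add continuous_on_mult continuous_on_const
        continuous_on_admissible(2) f w h adm adm'[OF r])
      fix x assume x: "x \<in> S01"
      have y: "\<bar>r * q x\<bar> \<le> 1 / 2" by (rule B(4)[OF r x])
      have "1 / (1 + (t + r) * (f x - u)) = w x * (1 / (1 + r * q x))"
        by (simp add: factor[OF x] w_def)
      also have "\<dots> \<le> w x * (1 - r * q x + 2 * (r * q x)\<^sup>2)"
        using wpos[OF x] inverse_quadratic_bound[OF y] by (intro mult_left_mono) auto
      also have "(q x)\<^sup>2 \<le> B\<^sup>2" using power_mono[OF B(3)[OF x], of 2] by simp
      then have "(r * q x)\<^sup>2 \<le> B\<^sup>2 * r\<^sup>2"
        using mult_right_mono[of "(q x)\<^sup>2" "B\<^sup>2" "r\<^sup>2"] by (simp add: power_mult_distrib mult.commute)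
      then have "w x * (1 - r * q x + 2 * (r * q x)\<^sup>2) \<le> w x * (1 - r * q x + 2 * (B\<^sup>2 * r\<^sup>2))"
        using wpos[OF x] by (intro mult_left_mono) auto
      also have "\<dots> = (1 + 2 * B\<^sup>2 * r\<^sup>2) * w x + - r * (w x * q x)" by (simp add: algebra_simps)
      also have "w x * q x = h x" by (simp add: w_def q_def h_def power2_eq_square)
      finally show "1 / (1 + (t + r) * (f x - u)) \<le> (1 + 2 * B\<^sup>2 * r\<^sup>2) * w x + - r * h x" .
    qed
    also have "\<dots> = (1 + 2 * B\<^sup>2 * r\<^sup>2) * integral\<^sup>L \<nu> w"
      using M1_integrable[OF \<nu> w] M1_integrable[OF \<nu> h] h0 by simp
    \<comment> \<open>\<open>1 + y <= exp y\<close> converts the relative error into an additive one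
      after taking logarithms.\<close>
    also have "\<dots> \<le> exp (2 * B\<^sup>2 * r\<^sup>2) * integral\<^sup>L \<nu> w"
      using Zpos exp_ge_add_one_self[of "2 * B\<^sup>2 * r\<^sup>2"] by (intro mult_right_mono) auto
    finally have "(\<integral>x. 1 / (1 + (t + r) * (f x - u)) \<partial>\<nu>) \<le> exp (2 * B\<^sup>2 * r\<^sup>2) * integral\<^sup>L \<nu> w" .
    moreover have "0 < (\<integral>x. 1 / (1 + (t + r) * (f x - u)) \<partial>\<nu>)"
      using admissible_pos[OF adm'[OF r]]
      by (intro M1_integral_pos \<nu> continuous_on_admissible f adm'[OF r]) simp
    ultimately have "ln (\<integral>x. 1 / (1 + (t + r) * (f x - u)) \<partial>\<nu>) \<le> ln (exp (2 * B\<^sup>2 * r\<^sup>2) * integral\<^sup>L \<nu> w)"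
      by simp
    then show ?thesis
      using Zpos by (simp add: inverse_kernel_def ln_mult w_def[abs_def])
  qed
  then show "\<exists>C>0. \<exists>s>0. \<forall>r. \<bar>r\<bar> < s \<longrightarrow>
      admissible f u (t + r) \<and> inverse_kernel \<nu> f u (t + r) \<le> inverse_kernel \<nu> f u t + C * r\<^sup>2"
    using B(1,2) adm' by (intro exI[of _ "2 * B\<^sup>2"] conjI exI[of _ s]) auto
qed (use \<nu> in \<open>simp_all add: inverse_kernel_def algebra_simps ln_div\<close>)

section \<open>Large deviations from inverse moments\<close>

text \<open>The factor 2, the price of treating the two sides of the mean separately, disappears
  after division by \<open>n\<close>.\<close>

lemma limsup_log_prob_le:
  fixes p :: "nat \<Rightarrow> real"
  assumes "\<And>n. 0 \<le> p n" "\<And>n. 1 \<le> n \<Longrightarrow> p n \<le> 2 * exp (- (real n * d))"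
  shows "limsup (\<lambda>n. ereal (1 / real n) * log_prob (p n)) \<le> ereal (- d)"
proof -
  have "ereal (1 / real n) * log_prob (p n) \<le> ereal (ln 2 / real n - d)" if n: "1 \<le> n" for n
  proof (cases "p n = 0")
    case True
    then show ?thesis using n by (simp add: log_prob_def)
  next
    case False
    then have "0 < p n" using assms(1)[of n] by simp
    then have "ln (p n) \<le> ln (2 * exp (- (real n * d)))"
      using assms(2)[OF n] by simp
    also have "\<dots> = ln 2 - real n * d" by (simp add: ln_mult)
    finally have "ln (p n) / real n \<le> (ln 2 - real n * d) / real n"
      using n by (intro divide_right_mono) auto
    also have "\<dots> = ln 2 / real n - d" using n by (simp add: field_simps)
    finally show ?thesis using False by (simp add: log_prob_def)
  qed
  then have "limsup (\<lambda>n. ereal (1 / real n) * log_prob (p n)) \<le> limsup (\<lambda>n. ereal (ln 2 / real n - d))"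
    by (intro Limsup_mono eventually_sequentiallyI[of 1])
  also have "(\<lambda>n. ln 2 / real n - d) \<longlonglongrightarrow> 0 - d"
    by (intro tendsto_intros lim_const_over_n)
  then have "limsup (\<lambda>n. ereal (ln 2 / real n - d)) = ereal (- d)"
    by (intro lim_imp_Limsup) auto
  finally show ?thesis .
qed

lemma liminf_log_prob_ge:
  fixes p :: "nat \<Rightarrow> real"
  assumes "\<forall>\<^sub>F n in sequentially. exp (real n * L) \<le> p n"
  shows "ereal L \<le> liminf (\<lambda>n. ereal (1 / real n) * log_prob (p n))"
proof (rule Liminf_bounded)
  show "\<forall>\<^sub>F n in sequentially. ereal L \<le> ereal (1 / real n) * log_prob (p n)"
    using assms eventually_ge_at_top[of 1]
  proof eventually_elim
    case (elim n)
    have "0 < p n" using elim(1) by (rule less_le_trans[OF exp_gt_zero])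
    then have "real n * L \<le> ln (p n)" using elim(1) by (simp add: ln_ge_iff)
    then have "L \<le> ln (p n) / real n" using elim(2) by (simp add: field_simps)
    then show ?case using \<open>0 < p n\<close> by (simp add: log_prob_def)
  qed
qed

text \<open>The moment identity is exact for every \<open>n >= 1\<close>, with a kernel independent
  of \<open>n\<close>. Membership in \<open>M1\<close> is almost sure only, because the random
  weights sum to one outside a null set.\<close>

locale random_means = dual_kernel \<nu> \<kappa> j for \<nu> \<kappa> j +
  fixes N :: "nat \<Rightarrow> 'a measure" and V :: "nat \<Rightarrow> 'a \<Rightarrow> real measure"
  assumes N: "\<And>n. 1 \<le> n \<Longrightarrow> prob_space (N n)"
    and V: "\<And>n. 1 \<le> n \<Longrightarrow> AE \<omega> in N n. V n \<omega> \<in> M1"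
    and mean_measurable: "\<And>n (g :: real \<Rightarrow> real). 1 \<le> n \<Longrightarrow> continuous_on S01 g \<Longrightarrow>
      (\<lambda>\<omega>. integral\<^sup>L (V n \<omega>) g) \<in> borel_measurable (N n)"
    and inverse_moment: "\<And>n g u t. 1 \<le> n \<Longrightarrow> continuous_on S01 g \<Longrightarrow> admissible g u t \<Longrightarrow>
      (\<integral>\<omega>. 1 / (1 + t * (integral\<^sup>L (V n \<omega>) g - u)) ^ n \<partial>N n) = exp (real n * \<kappa> g u t)"
begin

abbreviation mean :: "nat \<Rightarrow> (real \<Rightarrow> real) \<Rightarrow> 'a \<Rightarrow> real" where
  "mean n g \<omega> \<equiv> integral\<^sup>L (V n \<omega>) g"

lemma AE_weight_pos:
  assumes "1 \<le> n" "continuous_on S01 g" "admissible g u t"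
  shows "AE \<omega> in N n. 0 < 1 + t * (mean n g \<omega> - u)"
  using V[OF assms(1)]
proof eventually_elim
  case (elim \<omega>)
  have "0 < (\<integral>x. 1 + t * (g x - u) \<partial>V n \<omega>)"
    using assms by (intro M1_integral_pos elim admissible_pos) (auto intro!: continuous_intros)
  then show ?case by (simp only: M1_integral_affine[OF elim assms(2)])
qed

lemma integrable_weight:
  assumes n: "1 \<le> n" and g: "continuous_on S01 g" and adm: "admissible g u t"
  shows "integrable (N n) (\<lambda>\<omega>. 1 / (1 + t * (mean n g \<omega> - u)) ^ n)"
proof -
  interpret prob_space "N n" by (rule N[OF n])
  have [measurable]: "mean n g \<in> borel_measurable (N n)" by (rule mean_measurable[OF n g])
  have cont: "continuous_on S01 (\<lambda>x. 1 + t * (g x - u))" by (intro continuous_intros g)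
  obtain c where c: "0 < c" "\<And>x. x \<in> S01 \<Longrightarrow> c \<le> 1 + t * (g x - u)"
    using continuous_on_S01_pos_bound[OF cont admissible_pos[OF adm]] by blast
  have "AE \<omega> in N n. norm (1 / (1 + t * (mean n g \<omega> - u)) ^ n) \<le> 1 / c ^ n"
    using V[OF n]
  proof eventually_elim
    case (elim \<omega>)
    have "c \<le> 1 + t * (mean n g \<omega> - u)"
      using M1_integral_ge[OF elim cont c(2)] by (simp only: M1_integral_affine[OF elim g])
    then have "c ^ n \<le> (1 + t * (mean n g \<omega> - u)) ^ n" "0 < (1 + t * (mean n g \<omega> - u)) ^ n"
      using c(1) by (auto intro: power_mono)
    then show ?case using c(1) by (simp add: frac_le)
  qed
  then show ?thesis by (rule integrable_const_bound) measurable
qed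

text \<open>On the event the base \<open>1 + t * (X - u)\<close> lies in (0, 1], so its inverse
  power is at least 1.\<close>

lemma chernoff_bound:
  assumes n: "1 \<le> n" and g: "continuous_on S01 g" and adm: "admissible g u t"
  shows "measure (N n) {\<omega>\<in>space (N n). t * (mean n g \<omega> - u) \<le> 0} \<le> exp (real n * \<kappa> g u t)"
proof -
  interpret prob_space "N n" by (rule N[OF n])
  have [measurable]: "mean n g \<in> borel_measurable (N n)" by (rule mean_measurable[OF n g])
  let ?A = "{\<omega>\<in>space (N n). t * (mean n g \<omega> - u) \<le> 0}"
  have "measure (N n) ?A = (\<integral>\<omega>. indicator ?A \<omega> \<partial>N n)" by simp
  also have "\<dots> \<le> (\<integral>\<omega>. 1 / (1 + t * (mean n g \<omega> - u)) ^ n \<partial>N n)"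
  proof (rule integral_mono_AE)
    show "AE \<omega> in N n. indicator ?A \<omega> \<le> 1 / (1 + t * (mean n g \<omega> - u)) ^ n"
      using AE_weight_pos[OF assms]
      by eventually_elim (auto simp: indicator_def power_le_one)
  qed (auto intro!: integrable_weight assms simp: emeasure_eq_measure)
  also have "\<dots> = exp (real n * \<kappa> g u t)" by (rule inverse_moment[OF assms])
  finally show ?thesis .
qed

text \<open>The tilt by \<open>t\<close> is the tilt by \<open>t + r\<close> times
  \<open>(1 + y) ^ n\<close> with \<open>y = r * x / (1 + t * x)\<close>, and on the event
  \<open>1 + y\<close> is at most 1 - |r| c. The sign of \<open>r\<close> selects the tail; the
  absolute value on the right keeps the bound nonnegative off the event.\<close>

lemma tilted_tail_bound:
  assumes n: "1 \<le> n" and g: "continuous_on S01 g" and adm: "admissible g u t" "admissible g u (t + r)"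
    and \<epsilon>: "0 < \<epsilon>" and r: "r \<noteq> 0" and c: "c = \<epsilon> / (1 + \<bar>t\<bar> * \<epsilon>)"
  shows "(\<integral>\<omega>. 1 / (1 + t * (mean n g \<omega> - u)) ^ n * indicator {\<omega>\<in>space (N n). r * (mean n g \<omega> - u) \<le> - (\<bar>r\<bar> * \<epsilon>)} \<omega> \<partial>N n)
    \<le> \<bar>1 - \<bar>r\<bar> * c\<bar> ^ n * exp (real n * \<kappa> g u (t + r))"
proof -
  have [measurable]: "mean n g \<in> borel_measurable (N n)" by (rule mean_measurable[OF n g])
  let ?A = "{\<omega>\<in>space (N n). r * (mean n g \<omega> - u) \<le> - (\<bar>r\<bar> * \<epsilon>)}"
  have "(\<integral>\<omega>. 1 / (1 + t * (mean n g \<omega> - u)) ^ n * indicator ?A \<omega> \<partial>N n)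
      \<le> (\<integral>\<omega>. \<bar>1 - \<bar>r\<bar> * c\<bar> ^ n * (1 / (1 + (t + r) * (mean n g \<omega> - u)) ^ n) \<partial>N n)"
  proof (rule integral_mono_AE)
    show "integrable (N n) (\<lambda>\<omega>. 1 / (1 + t * (mean n g \<omega> - u)) ^ n * indicator ?A \<omega>)"
      using integrable_mult_indicator[OF _ integrable_weight[OF n g adm(1)], of ?A]
      by (simp add: mult.commute)
    show "integrable (N n) (\<lambda>\<omega>. \<bar>1 - \<bar>r\<bar> * c\<bar> ^ n * (1 / (1 + (t + r) * (mean n g \<omega> - u)) ^ n))"
      by (intro integrable_mult_right integrable_weight n g adm)
    show "AE \<omega> in N n. 1 / (1 + t * (mean n g \<omega> - u)) ^ n * indicator ?A \<omega>
        \<le> \<bar>1 - \<bar>r\<bar> * c\<bar> ^ n * (1 / (1 + (t + r) * (mean n g \<omega> - u)) ^ n)"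
      using AE_weight_pos[OF n g adm(1)] AE_weight_pos[OF n g adm(2)]
    proof eventually_elim
      case (elim \<omega>)
      define x where "x = mean n g \<omega> - u"
      have pos: "0 < 1 + t * x" "0 < 1 + (t + r) * x" using elim by (simp_all add: x_def)
      show ?case
      proof (cases "\<omega> \<in> ?A")
        case True
        then have rx: "r * x \<le> - (\<bar>r\<bar> * \<epsilon>)" by (simp add: x_def)
        define y where "y = r * x / (1 + t * x)"
        have factor: "1 + (t + r) * x = (1 + t * x) * (1 + y)"
          using pos by (simp add: y_def field_simps)
        have "0 < 1 + y" using pos factor by (simp add: zero_less_mult_iff)
        have "r * x < 0" using rx \<epsilon> r by (smt (verit) mult_pos_pos zero_less_abs_iff)
        then have "\<bar>r\<bar> * \<bar>x\<bar> = - (r * x)" by (simp add: abs_mult[symmetric])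
        \<comment> \<open>From |x| >= \<epsilon> follows |x| / (1 + t x) >= |x| / (1 + |t| |x|) >=
          \<epsilon> / (1 + |t| \<epsilon>), which is \<open>c\<close>; the next lines are this
          chain with denominators cleared.\<close>
        then have "\<bar>r\<bar> * \<epsilon> \<le> \<bar>r\<bar> * \<bar>x\<bar>" using rx by simp
        moreover have "\<bar>r\<bar> * \<epsilon> * (t * x) \<le> \<bar>r\<bar> * \<epsilon> * (\<bar>t\<bar> * \<bar>x\<bar>)"
          using \<epsilon> by (intro mult_left_mono) (auto simp: abs_mult[symmetric])
        ultimately have "\<bar>r\<bar> * \<epsilon> * (1 + t * x) \<le> \<bar>r\<bar> * \<bar>x\<bar> * (1 + \<bar>t\<bar> * \<epsilon>)"
          by (simp add: algebra_simps)
        then have "r * x * (1 + \<bar>t\<bar> * \<epsilon>) \<le> - (\<bar>r\<bar> * \<epsilon>) * (1 + t * x)"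
          using \<open>\<bar>r\<bar> * \<bar>x\<bar> = - (r * x)\<close> by simp
        moreover have "0 < 1 + \<bar>t\<bar> * \<epsilon>" using \<epsilon> by (simp add: add_pos_nonneg)
        ultimately have "y \<le> - (\<bar>r\<bar> * c)"
          using pos(1) by (simp add: y_def c divide_simps mult.commute)
        then have "(1 + y) ^ n \<le> \<bar>1 - \<bar>r\<bar> * c\<bar> ^ n"
          using \<open>0 < 1 + y\<close> by (intro power_mono) auto
        then have "(1 + y) ^ n / (1 + (t + r) * x) ^ n \<le> \<bar>1 - \<bar>r\<bar> * c\<bar> ^ n / (1 + (t + r) * x) ^ n"
          using pos by (intro divide_right_mono) auto
        also have "(1 + y) ^ n / (1 + (t + r) * x) ^ n = 1 / (1 + t * x) ^ n"
          using \<open>0 < 1 + y\<close> by (simp add: factor power_mult_distrib)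
        finally show ?thesis using True by (simp add: x_def)
      next
        case False
        then show ?thesis using pos by (simp add: x_def)
      qed
    qed
  qed
  also have "\<dots> = \<bar>1 - \<bar>r\<bar> * c\<bar> ^ n * exp (real n * \<kappa> g u (t + r))"
    by (simp only: Bochner_Integration.integral_mult_right_zero inverse_moment[OF n g adm(2)])
  finally show ?thesis .
qed

text \<open>Under the law tilted by \<open>(1 + t (X - u))\<^sup>-\<^sup>n\<close> at a critical point \<open>t\<close>, the mean
  concentrates at \<open>u\<close>.\<close>

lemma tilted_lower_bound:
  assumes g: "continuous_on S01 g" and adm: "admissible g u t"
    and crit: "(\<integral>x. (g x - u) / (1 + t * (g x - u)) ^ j \<partial>\<nu>) = 0"
    and \<epsilon>: "0 < \<epsilon>" and L: "L < \<kappa> g u t"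
  shows "\<forall>\<^sub>F n in sequentially. exp (real n * L) \<le>
    measure (N n) {\<omega>\<in>space (N n). \<bar>mean n g \<omega> - u\<bar> < \<epsilon>}"
proof -
  \<comment> \<open>Half the slack: one half pays for the weights on the window around
    \<open>u\<close>, the other absorbs the factor
    \<open>1 - 2 * exp (- (real n * d))\<close>.\<close>
  define \<eta> where "\<eta> = (\<kappa> g u t - L) / 2"
  have \<eta>: "0 < \<eta>" using L by (simp add: \<eta>_def)
  \<comment> \<open>A window so narrow that \<open>1 + t * x >= exp (- \<eta>)\<close> on it; adding
    1 to |t| covers \<open>t = 0\<close>.\<close>
  define e where "e = min \<epsilon> ((1 - exp (- \<eta>)) / (\<bar>t\<bar> + 1))"
  have e: "0 < e" "e \<le> \<epsilon>" using \<epsilon> \<eta> by (auto simp: e_def)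
  have "\<bar>t\<bar> * e \<le> (\<bar>t\<bar> + 1) * ((1 - exp (- \<eta>)) / (\<bar>t\<bar> + 1))"
    using e(1) by (intro mult_mono) (auto simp: e_def)
  then have te: "exp (- \<eta>) \<le> 1 - \<bar>t\<bar> * e" by simp
  define c where "c = e / (1 + \<bar>t\<bar> * e)"
  have c: "0 < c" using e by (simp add: c_def add_pos_nonneg)
  obtain C s0 where C: "0 < C" "0 < s0"
    and quad: "\<And>r. \<bar>r\<bar> < s0 \<Longrightarrow> admissible g u (t + r) \<and> \<kappa> g u (t + r) \<le> \<kappa> g u t + C * r\<^sup>2"
    using kernel_critical[OF g adm crit] by blast
  \<comment> \<open>Moving the parameter by \<open>s\<close> gains \<open>s * c\<close> in the
    exponent per unit of \<open>n\<close> and costs at most \<open>C * s\<^sup>2\<close>; the bound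
    \<open>c / (2 * C)\<close> leaves half the gain. With \<open>s <= 1 / c\<close> the base
    \<open>1 - s * c\<close> is nonnegative, and \<open>s0 / 2\<close> keeps the expansion
    valid.\<close>
  define s where "s = min (s0 / 2) (min (c / (2 * C)) (1 / c))"
  have s: "0 < s" "s < s0" "s \<le> c / (2 * C)" "s \<le> 1 / c"
    using C c by (auto simp: s_def)
  have sC: "C * s \<le> c / 2" and sc: "s * c \<le> 1"
    using s(3,4) C c by (simp_all add: field_simps)
  define d where "d = s * c / 2"
  have d: "0 < d" using s c by (simp add: d_def)
  have tail: "(\<integral>\<omega>. 1 / (1 + t * (mean n g \<omega> - u)) ^ n * indicator {\<omega>\<in>space (N n). r * (mean n g \<omega> - u) \<le> - (\<bar>r\<bar> * e)} \<omega> \<partial>N n)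
      \<le> exp (real n * \<kappa> g u t) * exp (- (real n * d))" if n: "1 \<le> n" and r: "\<bar>r\<bar> = s" for n r
  proof -
    have r0: "r \<noteq> 0" "\<bar>r\<bar> < s0" using r s by auto
    have "\<bar>1 - s * c\<bar> ^ n \<le> exp (- (s * c)) ^ n"
      using sc exp_ge_add_one_self[of "- (s * c)"] by (intro power_mono) auto
    also have "\<dots> = exp (- (real n * (s * c)))" by (simp add: exp_of_nat_mult[symmetric])
    finally have 1: "\<bar>1 - s * c\<bar> ^ n \<le> exp (- (real n * (s * c)))" .
    have "C * s\<^sup>2 \<le> d"
      using mult_right_mono[OF sC, of s] s(1) by (simp add: d_def power2_eq_square mult.assoc mult.commute)
    then have "\<kappa> g u (t + r) \<le> \<kappa> g u t + d" using quad[OF r0(2)] r by (metis add_left_mono order_trans power2_abs)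
    then have 2: "exp (real n * \<kappa> g u (t + r)) \<le> exp (real n * (\<kappa> g u t + d))"
      by (simp add: mult_left_mono)
    have "\<bar>1 - s * c\<bar> ^ n * exp (real n * \<kappa> g u (t + r))
        \<le> exp (- (real n * (s * c))) * exp (real n * (\<kappa> g u t + d))"
      using 1 2 by (intro mult_mono) auto
    also have "\<dots> = exp (real n * \<kappa> g u t) * exp (- (real n * d))"
      by (simp add: exp_add[symmetric] d_def field_simps)
    finally show ?thesis
      using tilted_tail_bound[OF n g adm conjunct1[OF quad[OF r0(2)]] e(1) r0(1) c_def] r by simp
  qed
  have main: "exp (- (real n * \<eta>)) * exp (real n * \<kappa> g u t) * (1 - 2 * exp (- (real n * d)))
      \<le> measure (N n) {\<omega>\<in>space (N n). \<bar>mean n g \<omega> - u\<bar> < \<epsilon>}" if n: "1 \<le> n" for n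
  proof -
    interpret prob_space "N n" by (rule N[OF n])
    have [measurable]: "mean n g \<in> borel_measurable (N n)" by (rule mean_measurable[OF n g])
    define w where "w \<omega> = 1 / (1 + t * (mean n g \<omega> - u)) ^ n" for \<omega>
    define A where "A r = {\<omega>\<in>space (N n). r * (mean n g \<omega> - u) \<le> - (\<bar>r\<bar> * e)}" for r
    let ?B = "{\<omega>\<in>space (N n). \<bar>mean n g \<omega> - u\<bar> < \<epsilon>}"
    have w: "integrable (N n) w" unfolding w_def by (rule integrable_weight[OF n g adm])
    have wA: "integrable (N n) (\<lambda>\<omega>. w \<omega> * indicator (A r) \<omega>)" for r
      using integrable_mult_indicator[OF _ w, of "A r"] by (simp add: mult.commute A_def)
    have B: "integrable (N n) (\<lambda>\<omega>. exp (real n * \<eta>) * indicator ?B \<omega>)"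
      by (intro integrable_mult_right) (auto simp: emeasure_eq_measure)
    \<comment> \<open>The total tilted mass is split over the window and the two tails,
      \<open>A s\<close> on the left and \<open>A (- s)\<close> on the right.\<close>
    have "exp (real n * \<kappa> g u t) = (\<integral>\<omega>. w \<omega> \<partial>N n)" by (simp only: w_def inverse_moment[OF n g adm])
    also have "\<dots> \<le> (\<integral>\<omega>. exp (real n * \<eta>) * indicator ?B \<omega> + (w \<omega> * indicator (A s) \<omega> + w \<omega> * indicator (A (- s)) \<omega>) \<partial>N n)"
    proof (intro integral_mono_AE w Bochner_Integration.integrable_add B wA)
      show "AE \<omega> in N n. w \<omega> \<le> exp (real n * \<eta>) * indicator ?B \<omega> + (w \<omega> * indicator (A s) \<omega> + w \<omega> * indicator (A (- s)) \<omega>)"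
        using AE_weight_pos[OF n g adm] AE_space
      proof eventually_elim
        case (elim \<omega>)
        define x where "x = mean n g \<omega> - u"
        have pos: "0 < 1 + t * x" using elim by (simp add: x_def)
        consider "\<bar>x\<bar> < e" | "x \<le> - e" | "e \<le> x" by linarith
        then show ?case
        proof cases
          case 1
          have "\<bar>t * x\<bar> \<le> \<bar>t\<bar> * e" using 1 by (simp add: abs_mult mult_left_mono)
          then have "exp (- \<eta>) \<le> 1 + t * x" using te by linarith
          then have "exp (- \<eta>) ^ n \<le> (1 + t * x) ^ n" by (intro power_mono) auto
          then have "1 / (1 + t * x) ^ n \<le> 1 / exp (- \<eta>) ^ n"
            using pos by (intro divide_left_mono) auto
          also have "\<dots> = exp (real n * \<eta>)" by (simp add: exp_minus exp_of_nat_mult power_inverse divide_inverse)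
          finally have "w \<omega> \<le> exp (real n * \<eta>) * indicator ?B \<omega>"
            using 1 e elim by (simp add: w_def x_def)
          then show ?thesis using pos by (simp add: w_def x_def add_increasing2)
        next
          case 2
          then have "\<omega> \<in> A s" using s(1) elim mult_left_mono[of x "- e" s] by (simp add: A_def x_def)
          then show ?thesis using pos by (simp add: w_def x_def add_increasing add_increasing2)
        next
          case 3
          then have "\<omega> \<in> A (- s)" using s(1) elim mult_left_mono[of e x s] by (simp add: A_def x_def)
          then show ?thesis using pos by (simp add: w_def x_def add_increasing add_increasing2)
        qed
      qed
    qed
    also have "\<dots> = exp (real n * \<eta>) * prob ?B +
        ((\<integral>\<omega>. w \<omega> * indicator (A s) \<omega> \<partial>N n) + (\<integral>\<omega>. w \<omega> * indicator (A (- s)) \<omega> \<partial>N n))"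
      using B wA by simp
    also have "\<dots> \<le> exp (real n * \<eta>) * prob ?B +
        (exp (real n * \<kappa> g u t) * exp (- (real n * d)) + exp (real n * \<kappa> g u t) * exp (- (real n * d)))"
      unfolding w_def A_def using s(1) by (intro add_left_mono add_mono tail n) auto
    finally have "exp (real n * \<kappa> g u t) * (1 - 2 * exp (- (real n * d))) \<le> exp (real n * \<eta>) * prob ?B"
      by (simp add: algebra_simps)
    then have "exp (- (real n * \<eta>)) * (exp (real n * \<kappa> g u t) * (1 - 2 * exp (- (real n * d))))
        \<le> exp (- (real n * \<eta>)) * (exp (real n * \<eta>) * prob ?B)"
      by (intro mult_left_mono) auto
    also have "\<dots> = prob ?B" by (simp add: mult.assoc[symmetric] exp_add[symmetric])
    finally show ?thesis by (simp add: mult.assoc)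
  qed
  have small: "\<forall>\<^sub>F n in sequentially. exp (- (real n * a)) < b" if "0 < a" "0 < b" for a b :: real
  proof -
    have "(\<lambda>n. exp (- a) ^ n) \<longlonglongrightarrow> 0" using that by (intro LIMSEQ_power_zero) auto
    then have "(\<lambda>n. exp (- (real n * a))) \<longlonglongrightarrow> 0" by (simp add: exp_of_nat_mult[symmetric])
    then show ?thesis using that(2) by (rule order_tendstoD)
  qed
  have "\<forall>\<^sub>F n in sequentially. exp (- (real n * d)) < 1 / 4"
    "\<forall>\<^sub>F n in sequentially. exp (- (real n * \<eta>)) < 1 / 2"
    by (intro small d \<eta>; simp)+
  then show ?thesis using eventually_ge_at_top[of 1]
  proof eventually_elim
    case (elim n)
    have "exp (real n * L) = exp (- (real n * \<eta>)) * exp (real n * \<kappa> g u t) * exp (- (real n * \<eta>))"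
      by (simp add: exp_add[symmetric] \<eta>_def field_simps)
    also have "\<dots> \<le> exp (- (real n * \<eta>)) * exp (real n * \<kappa> g u t) * (1 - 2 * exp (- (real n * d)))"
      using elim by (intro mult_left_mono) auto
    also have "\<dots> \<le> measure (N n) {\<omega>\<in>space (N n). \<bar>mean n g \<omega> - u\<bar> < \<epsilon>}"
      using elim by (intro main) auto
    finally show ?case .
  qed
qed

section \<open>Upper and lower bounds of the large deviation principle\<close>

text \<open>A positive value of \<open>- \<kappa> f u t\<close> contradicts
  \<open>kernel_nonneg\<close> unless \<open>t\<close> has the sign of the mean minus
  \<open>u\<close>; the event of the Chernoff bound is then the half-line pointing away from the
  mean.\<close>

lemma half_line_bound:
  assumes f: "continuous_on S01 f" and n: "1 \<le> n" and d: "0 \<le> d" "ereal d < dual_rate \<kappa> f u"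
  shows "u \<noteq> integral\<^sup>L \<nu> f"
    and "u < integral\<^sup>L \<nu> f \<Longrightarrow> measure (N n) {\<omega>\<in>space (N n). mean n f \<omega> \<le> u} \<le> exp (- (real n * d))"
    and "integral\<^sup>L \<nu> f < u \<Longrightarrow> measure (N n) {\<omega>\<in>space (N n). u \<le> mean n f \<omega>} \<le> exp (- (real n * d))"
proof -
  obtain t where adm: "admissible f u t" and t: "d < - \<kappa> f u t"
    using d(2) unfolding dual_rate_def less_SUP_iff by auto
  have sign: "0 < t * (integral\<^sup>L \<nu> f - u)"
    using kernel_nonneg[OF f adm] d t by force
  then show "u \<noteq> integral\<^sup>L \<nu> f" by auto
  have "exp (real n * \<kappa> f u t) \<le> exp (- (real n * d))"
    using mult_left_mono[of "\<kappa> f u t" "- d" "real n"] t by simp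
  then have le: "measure (N n) {\<omega>\<in>space (N n). t * (mean n f \<omega> - u) \<le> 0} \<le> exp (- (real n * d))"
    using chernoff_bound[OF n f adm] by linarith
  show "measure (N n) {\<omega>\<in>space (N n). mean n f \<omega> \<le> u} \<le> exp (- (real n * d))" if "u < integral\<^sup>L \<nu> f"
  proof -
    have "0 < t" using sign that by (simp add: zero_less_mult_iff)
    then show ?thesis using le by (simp add: mult_le_0_iff)
  qed
  show "measure (N n) {\<omega>\<in>space (N n). u \<le> mean n f \<omega>} \<le> exp (- (real n * d))" if "integral\<^sup>L \<nu> f < u"
  proof -
    have "t < 0" using sign that by (simp add: zero_less_mult_iff)
    then show ?thesis using le by (simp add: mult_le_0_iff)
  qed
qed

lemma measure_mean_law:
  assumes "1 \<le> n" "continuous_on S01 f" "A \<in> sets borel"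
  shows "measure (mean_law (N n) (V n) f) A = measure (N n) {\<omega>\<in>space (N n). mean n f \<omega> \<in> A}"
  unfolding mean_law_def using assms
  by (subst measure_distr[OF mean_measurable]) (auto intro!: arg_cong[where f = "measure _"])

text \<open>On each side of the mean a closed set lies in the half-line that starts at its own point
  nearest to the mean, so two half-line bounds suffice.\<close>

lemma upper_bound_closed:
  assumes f: "continuous_on S01 f" and n: "1 \<le> n" and C: "closed C"
    and d: "ereal d < (INF u\<in>C. dual_rate \<kappa> f u)"
  shows "measure (mean_law (N n) (V n) f) C \<le> 2 * exp (- (real n * d))"
proof (cases "0 \<le> d")
  case False
  interpret prob_space "N n" by (rule N[OF n])
  have "measure (mean_law (N n) (V n) f) C \<le> 1"
    using C by (subst measure_mean_law[OF n f]) auto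
  also have "1 \<le> exp (- (real n * d))"
    using False by (simp add: mult_nonneg_nonpos)
  then have "1 \<le> 2 * exp (- (real n * d))" by linarith
  finally show ?thesis .
next
  case d0: True
  interpret prob_space "N n" by (rule N[OF n])
  have [measurable]: "mean n f \<in> borel_measurable (N n)" by (rule mean_measurable[OF n f])
  have rate: "ereal d < dual_rate \<kappa> f u" if "u \<in> C" for u
    using d INF_lower[OF that] by (rule less_le_trans)
  note hl = half_line_bound[OF f n d0 rate]
  have [measurable]: "C \<in> sets borel" using C by simp
  define m where "m = integral\<^sup>L \<nu> f"
  have "measure (N n) {\<omega>\<in>space (N n). mean n f \<omega> \<in> C \<inter> {..m}} \<le> exp (- (real n * d))"
  proof (cases "C \<inter> {..m} = {}")
    case False
    define u where "u = Sup (C \<inter> {..m})"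
    have "u \<in> C \<inter> {..m}" unfolding u_def
      using C False by (intro closed_contains_Sup) auto
    then have u: "u \<in> C" "u < m" using hl(1)[of u] by (auto simp: m_def)
    have "v \<le> u" if "v \<in> C \<inter> {..m}" for v
      unfolding u_def using that by (intro cSup_upper) auto
    then have "measure (N n) {\<omega>\<in>space (N n). mean n f \<omega> \<in> C \<inter> {..m}}
        \<le> measure (N n) {\<omega>\<in>space (N n). mean n f \<omega> \<le> u}"
      by (intro finite_measure_mono) auto
    then show ?thesis using hl(2)[OF u(1)] u(2) by (simp add: m_def)
  qed simp
  moreover have "measure (N n) {\<omega>\<in>space (N n). mean n f \<omega> \<in> C \<inter> {m..}} \<le> exp (- (real n * d))"
  proof (cases "C \<inter> {m..} = {}")
    case False
    define u where "u = Inf (C \<inter> {m..})"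
    have "u \<in> C \<inter> {m..}" unfolding u_def
      using C False by (intro closed_contains_Inf) auto
    then have u: "u \<in> C" "m < u" using hl(1)[of u] by (auto simp: m_def)
    have "u \<le> v" if "v \<in> C \<inter> {m..}" for v
      unfolding u_def using that by (intro cInf_lower) auto
    then have "measure (N n) {\<omega>\<in>space (N n). mean n f \<omega> \<in> C \<inter> {m..}}
        \<le> measure (N n) {\<omega>\<in>space (N n). u \<le> mean n f \<omega>}"
      by (intro finite_measure_mono) auto
    then show ?thesis using hl(3)[OF u(1)] u(2) by (simp add: m_def)
  qed simp
  moreover have "measure (N n) {\<omega>\<in>space (N n). mean n f \<omega> \<in> C}
      \<le> measure (N n) ({\<omega>\<in>space (N n). mean n f \<omega> \<in> C \<inter> {..m}} \<union> {\<omega>\<in>space (N n). mean n f \<omega> \<in> C \<inter> {m..}})"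
    by (intro finite_measure_mono) auto
  moreover have "\<dots> \<le> measure (N n) {\<omega>\<in>space (N n). mean n f \<omega> \<in> C \<inter> {..m}}
      + measure (N n) {\<omega>\<in>space (N n). mean n f \<omega> \<in> C \<inter> {m..}}"
    by (intro measure_Un_le) auto
  ultimately show ?thesis
    by (subst measure_mean_law[OF n f]) auto
qed

text \<open>The tilting is done at a critical point of a nearby pair \<open>g\<close>,
  \<open>v\<close>. Three errors of size \<open>\<delta> / 3\<close> add up to the radius:
  \<open>f\<close> against \<open>g\<close>, \<open>u\<close> against \<open>v\<close>, and the
  distance of the mean of \<open>g\<close> from \<open>v\<close>.\<close>

lemma lower_bound_open:
  assumes f: "continuous_on S01 f" and low: "charges_below \<nu> f" "charges_below \<nu> (\<lambda>x. - f x)"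
    and G: "open G" "u \<in> G" and L: "ereal L < - dual_rate \<kappa> f u"
  shows "\<forall>\<^sub>F n in sequentially. exp (real n * L) \<le> measure (mean_law (N n) (V n) f) G"
proof -
  obtain \<delta> where \<delta>: "0 < \<delta>" "ball u \<delta> \<subseteq> G" using G openE by blast
  have fin: "dual_rate \<kappa> f u < \<infinity>" using L by (cases "dual_rate \<kappa> f u") auto
  obtain g v t where g: "continuous_on S01 g" "\<forall>x\<in>S01. \<bar>g x - f x\<bar> \<le> \<delta> / 3" "\<bar>v - u\<bar> \<le> \<delta> / 3" "admissible g v t"
    "(\<integral>x. (g x - v) / (1 + t * (g x - v)) ^ j \<partial>\<nu>) = 0" "ereal (- \<kappa> g v t) \<le> dual_rate \<kappa> f u"
    using approx_critical[OF f low fin, of "\<delta> / 3"] \<delta>(1) by auto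
  have "ereal L < - ereal (- \<kappa> g v t)"
    using L g(6) by (meson ereal_minus_le_minus less_le_trans)
  then have "L < \<kappa> g v t" by simp
  from tilted_lower_bound[OF g(1,4,5) _ this, of "\<delta> / 3"] \<delta>(1)
  have "\<forall>\<^sub>F n in sequentially. exp (real n * L) \<le> measure (N n) {\<omega>\<in>space (N n). \<bar>mean n g \<omega> - v\<bar> < \<delta> / 3}"
    by simp
  then show ?thesis using eventually_ge_at_top[of 1]
  proof eventually_elim
    case (elim n)
    note n = elim(2)
    interpret prob_space "N n" by (rule N[OF n])
    have [measurable]: "mean n f \<in> borel_measurable (N n)" "mean n g \<in> borel_measurable (N n)"
      by (rule mean_measurable[OF n f], rule mean_measurable[OF n g(1)])
    have [measurable]: "G \<in> sets borel" using G by simp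
    have "measure (N n) {\<omega>\<in>space (N n). \<bar>mean n g \<omega> - v\<bar> < \<delta> / 3}
        \<le> measure (N n) {\<omega>\<in>space (N n). mean n f \<omega> \<in> G}"
    proof (rule finite_measure_mono_AE)
      show "AE \<omega> in N n. \<omega> \<in> {\<omega>\<in>space (N n). \<bar>mean n g \<omega> - v\<bar> < \<delta> / 3} \<longrightarrow>
          \<omega> \<in> {\<omega>\<in>space (N n). mean n f \<omega> \<in> G}"
        using V[OF n]
      proof eventually_elim
        case (elim \<omega>)
        have "mean n g \<omega> - mean n f \<omega> = (\<integral>x. g x - f x \<partial>V n \<omega>)"
          by (intro Bochner_Integration.integral_diff[symmetric] M1_integrable elim f g(1))
        moreover have "(\<integral>x. g x - f x \<partial>V n \<omega>) \<le> \<delta> / 3"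
          using abs_le_D1[OF g(2)[rule_format]] by (intro M1_integral_le elim continuous_on_diff f g(1))
        moreover have "- (\<delta> / 3) \<le> (\<integral>x. g x - f x \<partial>V n \<omega>)"
          using abs_le_D2[OF g(2)[rule_format]] by (intro M1_integral_ge elim continuous_on_diff f g(1)) force
        ultimately have "\<bar>mean n g \<omega> - v\<bar> < \<delta> / 3 \<Longrightarrow> mean n f \<omega> \<in> ball u \<delta>"
          using g(3) unfolding mem_ball dist_real_def by linarith
        then show ?case using \<delta>(2) by auto
      qed
    qed measurable
    then show ?case
      using elim(1) by (subst measure_mean_law[OF n f]) auto
  qed
qed

theorem LDP_dual_rate:
  assumes f: "continuous_on S01 f" and low: "charges_below \<nu> f" "charges_below \<nu> (\<lambda>x. - f x)"
  shows "LDP (\<lambda>n. mean_law (N n) (V n) f) (dual_rate \<kappa> f)"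
  unfolding LDP_def
proof (intro conjI allI impI)
  fix C :: "real set" assume C: "closed C"
  let ?I = "INF u\<in>C. dual_rate \<kappa> f u"
  let ?a = "\<lambda>n. ereal (1 / real n) * log_prob (measure (mean_law (N n) (V n) f) C)"
  show "limsup ?a \<le> - ?I"
  \<comment> \<open>Comparison with all levels above \<open>- ?I\<close> covers an infinite infimum
    without a separate argument.\<close>
  proof (rule dense_ge)
    fix y assume y: "- ?I < y"
    show "limsup ?a \<le> y"
    proof (cases y)
      case (real d)
      have "- y < ?I" using y by (rule ereal_uminus_less_reorder[THEN iffD1])
      then have "ereal (- d) < ?I" using real by simp
      from upper_bound_closed[OF f _ C this]
      show ?thesis
        using limsup_log_prob_le[of "\<lambda>n. measure (mean_law (N n) (V n) f) C" "- d"] real by simp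
    qed (use y in auto)
  qed
next
  fix G :: "real set" assume G: "open G"
  let ?b = "liminf (\<lambda>n. ereal (1 / real n) * log_prob (measure (mean_law (N n) (V n) f) G))"
  have "- dual_rate \<kappa> f u \<le> ?b" if u: "u \<in> G" for u
  proof (rule dense_le)
    fix y assume y: "y < - dual_rate \<kappa> f u"
    show "y \<le> ?b"
    proof (cases y)
      case (real L)
      then show ?thesis
        using lower_bound_open[OF f low G u, of L] y by (auto intro: liminf_log_prob_ge)
    qed (use y in auto)
  qed
  then have "- ?b \<le> dual_rate \<kappa> f u" if "u \<in> G" for u
    using ereal_uminus_le_reorder[THEN iffD1] that by blast
  then show "- (INF u\<in>G. dual_rate \<kappa> f u) \<le> ?b"
    by (subst ereal_uminus_le_reorder) (rule INF_greatest)
qed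

end

section \<open>Duality for the rate functions\<close>

text \<open>Compactness of \<open>M1\<close>, continuity of the mean and lower semicontinuity of
  \<open>K\<close>, packed into the form used twice: for goodness of the rate and for removing the
  cut-off. The slack \<open>1 / real (Suc k)\<close> admits measures that are only nearly
  optimal.\<close>

definition closed_cost :: "(real \<Rightarrow> real) \<Rightarrow> (real measure \<Rightarrow> ereal) \<Rightarrow> bool" where
  "closed_cost f K \<longleftrightarrow> (\<forall>\<mu> u r. (\<forall>k. \<mu> k \<in> M1 \<and> K (\<mu> k) < ereal (r + 1 / real (Suc k))) \<longrightarrow>
     (\<lambda>k. integral\<^sup>L (\<mu> k) f) \<longlonglongrightarrow> u \<longrightarrow> (\<exists>\<mu>'\<in>M1. integral\<^sup>L \<mu>' f = u \<and> K \<mu>' \<le> ereal r))"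

lemma closed_costD:
  assumes "closed_cost f K" "\<And>k. \<mu> k \<in> M1" "\<And>k. K (\<mu> k) < ereal (r + 1 / real (Suc k))"
    and "(\<lambda>k. integral\<^sup>L (\<mu> k) f) \<longlonglongrightarrow> u"
  obtains \<mu>' where "\<mu>' \<in> M1" "integral\<^sup>L \<mu>' f = u" "K \<mu>' \<le> ereal r"
  using assms unfolding closed_cost_def by meson

lemma tendsto_ereal_add_inverse_Suc:
  assumes "strict_mono (\<phi> :: nat \<Rightarrow> nat)"
  shows "(\<lambda>k. ereal (r + 1 / real (Suc (\<phi> k)))) \<longlonglongrightarrow> ereal r"
proof -
  have "(\<lambda>k. r + 1 / real (Suc k)) \<longlonglongrightarrow> r + 0"
    by (intro tendsto_add tendsto_const LIMSEQ_Suc[OF lim_1_over_n])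
  from LIMSEQ_subseq_LIMSEQ[OF this assms] show ?thesis by (simp add: comp_def)
qed

lemma closed_cost_relative_entropy:
  assumes \<nu>: "\<nu> \<in> M1" and f: "continuous_on S01 f"
  shows "closed_cost f (relative_entropy \<nu>)"
  unfolding closed_cost_def
proof (intro allI impI)
  fix \<mu> :: "nat \<Rightarrow> real measure" and u r
  assume *: "\<forall>k. \<mu> k \<in> M1 \<and> relative_entropy \<nu> (\<mu> k) < ereal (r + 1 / real (Suc k))"
    and u: "(\<lambda>k. integral\<^sup>L (\<mu> k) f) \<longlonglongrightarrow> u"
  obtain \<phi> \<mu>' where \<phi>: "strict_mono (\<phi> :: nat \<Rightarrow> nat)" and \<mu>': "\<mu>' \<in> M1"
    and lim: "\<And>g :: real \<Rightarrow> real. continuous_on S01 g \<Longrightarrow> (\<lambda>k. integral\<^sup>L (\<mu> (\<phi> k)) g) \<longlonglongrightarrow> integral\<^sup>L \<mu>' g"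
    by (rule M1_convergent_subsequence[of \<mu>]) (use * in blast)+
  have "(\<lambda>k. integral\<^sup>L (\<mu> (\<phi> k)) f) \<longlonglongrightarrow> u"
    using LIMSEQ_subseq_LIMSEQ[OF u \<phi>] by (simp add: comp_def)
  then have "integral\<^sup>L \<mu>' f = u" using lim[OF f] LIMSEQ_unique by blast
  moreover have "relative_entropy \<nu> \<mu>' \<le> ereal r"
    by (rule relative_entropy_lsc[OF _ \<mu>' \<nu> lim _ tendsto_ereal_add_inverse_Suc[OF \<phi>]])
      (use * less_imp_le in blast)+
  ultimately show "\<exists>\<mu>'\<in>M1. integral\<^sup>L \<mu>' f = u \<and> relative_entropy \<nu> \<mu>' \<le> ereal r"
    using \<mu>' by blast
qed

text \<open>The infimum in \<open>J_divergence\<close> is replaced by nearly optimal middle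
  measures, which converge along a further subsequence; joint lower semicontinuity then applies to
  the pair.\<close>

lemma closed_cost_J_divergence:
  assumes \<nu>: "\<nu> \<in> M1" and f: "continuous_on S01 f"
  shows "closed_cost f (\<lambda>\<mu>. J_divergence \<mu> \<nu>)"
  unfolding closed_cost_def
proof (intro allI impI)
  fix \<mu> :: "nat \<Rightarrow> real measure" and u r
  assume *: "\<forall>k. \<mu> k \<in> M1 \<and> J_divergence (\<mu> k) \<nu> < ereal (r + 1 / real (Suc k))"
    and u: "(\<lambda>k. integral\<^sup>L (\<mu> k) f) \<longlonglongrightarrow> u"
  have "\<forall>k. \<exists>\<upsilon>\<in>M1. relative_entropy \<upsilon> (\<mu> k) + relative_entropy \<upsilon> \<nu> < ereal (r + 1 / real (Suc k))"
    using * unfolding J_divergence_def INF_less_iff by blast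
  then obtain \<upsilon> where \<upsilon>: "\<And>k. \<upsilon> k \<in> M1"
    "\<And>k. relative_entropy (\<upsilon> k) (\<mu> k) + relative_entropy (\<upsilon> k) \<nu> < ereal (r + 1 / real (Suc k))"
    by metis
  obtain \<phi> \<mu>' where \<phi>: "strict_mono (\<phi> :: nat \<Rightarrow> nat)" and \<mu>': "\<mu>' \<in> M1"
    and lim: "\<And>g :: real \<Rightarrow> real. continuous_on S01 g \<Longrightarrow> (\<lambda>k. integral\<^sup>L (\<mu> (\<phi> k)) g) \<longlonglongrightarrow> integral\<^sup>L \<mu>' g"
    by (rule M1_convergent_subsequence[of \<mu>]) (use * in blast)+
  obtain \<psi> \<upsilon>' where \<psi>: "strict_mono (\<psi> :: nat \<Rightarrow> nat)" and \<upsilon>': "\<upsilon>' \<in> M1"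
    and lim': "\<And>g :: real \<Rightarrow> real. continuous_on S01 g \<Longrightarrow> (\<lambda>k. integral\<^sup>L (\<upsilon> (\<phi> (\<psi> k))) g) \<longlonglongrightarrow> integral\<^sup>L \<upsilon>' g"
    by (rule M1_convergent_subsequence[of "\<lambda>k. \<upsilon> (\<phi> k)"]) (use \<upsilon> in blast)+
  have \<phi>\<psi>: "strict_mono (\<lambda>k. \<phi> (\<psi> k))" using strict_mono_o[OF \<phi> \<psi>] by (simp add: comp_def)
  have lim'': "(\<lambda>k. integral\<^sup>L (\<mu> (\<phi> (\<psi> k))) g) \<longlonglongrightarrow> integral\<^sup>L \<mu>' g" if "continuous_on S01 g" for g :: "real \<Rightarrow> real"
    using LIMSEQ_subseq_LIMSEQ[OF lim[OF that] \<psi>] by (simp add: comp_def)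
  have "(\<lambda>k. integral\<^sup>L (\<mu> (\<phi> k)) f) \<longlonglongrightarrow> u"
    using LIMSEQ_subseq_LIMSEQ[OF u \<phi>] by (simp add: comp_def)
  then have "integral\<^sup>L \<mu>' f = u" using lim[OF f] LIMSEQ_unique by blast
  moreover have "relative_entropy \<upsilon>' \<mu>' + relative_entropy \<upsilon>' \<nu> \<le> ereal r"
    by (rule relative_entropy_sum_lsc[OF _ \<mu>' _ \<upsilon>' \<nu> lim'' lim' _ tendsto_ereal_add_inverse_Suc[OF \<phi>\<psi>]])
      (use * \<upsilon> less_imp_le in blast)+
  then have "J_divergence \<mu>' \<nu> \<le> ereal r"
    unfolding J_divergence_def using \<upsilon>' by (rule INF_lower2[rotated])
  ultimately show "\<exists>\<mu>'\<in>M1. integral\<^sup>L \<mu>' f = u \<and> J_divergence \<mu>' \<nu> \<le> ereal r"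
    using \<mu>' by blast
qed

text \<open>Finite rate forces \<open>u\<close> to be a mean of \<open>f\<close>, hence bounded by
  the maximum of |f|; closedness is the closed-cost property applied to near-minimizers.\<close>

lemma good_rate_function_INF_cost:
  assumes f: "continuous_on S01 f" and nonneg: "\<And>\<mu>. \<mu> \<in> M1 \<Longrightarrow> 0 \<le> K \<mu>" and closed: "closed_cost f K"
  shows "good_rate_function (\<lambda>u. INF \<mu>\<in>{\<mu> \<in> M1. integral\<^sup>L \<mu> f = u}. K \<mu>)"
proof -
  define I where "I u = (INF \<mu>\<in>{\<mu> \<in> M1. integral\<^sup>L \<mu> f = u}. K \<mu>)" for u
  have I_nonneg: "0 \<le> I u" for u unfolding I_def using nonneg by (intro INF_greatest) auto
  have witness: "\<exists>\<mu>\<in>M1. integral\<^sup>L \<mu> f = u \<and> K \<mu> < c" if "I u < c" for u c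
    using that unfolding I_def INF_less_iff by blast
  obtain B where B: "\<And>x. x \<in> S01 \<Longrightarrow> \<bar>f x\<bar> \<le> B" using continuous_on_S01_bound[OF f] by blast
  have "compact {u. I u \<le> c}" if c: "c < \<infinity>" for c
  proof (cases c)
    case (real r)
    have "norm u \<le> B" if "I u \<le> c" for u
    proof -
      have "I u < \<infinity>" using that c by (rule le_less_trans)
      then obtain \<mu> where \<mu>: "\<mu> \<in> M1" "integral\<^sup>L \<mu> f = u" using witness by blast
      have "u \<le> B" using M1_integral_le[OF \<mu>(1) f, of B] \<mu>(2) abs_le_D1[OF B] by blast
      moreover have "- B \<le> u"
        using M1_integral_ge[OF \<mu>(1) f, of "- B"] \<mu>(2) abs_le_D2[OF B] minus_le_iff by blast
      ultimately show ?thesis by (simp add: abs_le_iff)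
    qed
    then have "bounded {u. I u \<le> c}" by (intro boundedI[of _ B]) auto
    moreover have "closed {u. I u \<le> c}"
      unfolding closed_sequential_limits
    proof (intro allI impI, elim conjE)
      fix x l assume x: "\<forall>n. x n \<in> {u. I u \<le> c}" and lim: "x \<longlonglongrightarrow> l"
      have "\<exists>\<mu>\<in>M1. integral\<^sup>L \<mu> f = x k \<and> K \<mu> < ereal (r + 1 / real (Suc k))" for k
        using x real by (intro witness) (auto intro: le_less_trans)
      then obtain \<mu> where \<mu>: "\<And>k. \<mu> k \<in> M1" "\<And>k. integral\<^sup>L (\<mu> k) f = x k"
        "\<And>k. K (\<mu> k) < ereal (r + 1 / real (Suc k))" by metis
      have "(\<lambda>k. integral\<^sup>L (\<mu> k) f) \<longlonglongrightarrow> l" using lim by (simp add: \<mu>(2))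
      then obtain \<mu>' where "\<mu>' \<in> M1" "integral\<^sup>L \<mu>' f = l" "K \<mu>' \<le> ereal r"
        using closed_costD[OF closed \<mu>(1,3)] by blast
      then have "I l \<le> c" unfolding I_def real by (intro INF_lower2[of \<mu>']) auto
      then show "l \<in> {u. I u \<le> c}" by simp
    qed
    ultimately show ?thesis by (simp add: compact_eq_bounded_closed)
  next
    case MInf
    have "\<not> I u \<le> c" for u
      using I_nonneg[of u] MInf by auto
    then have "{u. I u \<le> c} = {}" by blast
    then show ?thesis by simp
  qed (use c in simp)
  then show ?thesis unfolding good_rate_function_def using I_nonneg by (simp add: I_def)
qed

text \<open>Weak duality gives one inequality. For the other, the nearby pairs that have critical
  points are solved by \<open>optimal\<close>, and closedness of the cost passes from the
  constraints \<open>integral\<^sup>L \<mu> g = v\<close> to the limit.\<close>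

lemma (in dual_kernel) INF_cost_eq_dual_rate:
  assumes f: "continuous_on S01 f" and low: "charges_below \<nu> f" "charges_below \<nu> (\<lambda>x. - f x)"
    and weak: "\<And>\<mu> t. \<lbrakk>\<mu> \<in> M1; admissible f (integral\<^sup>L \<mu> f) t\<rbrakk> \<Longrightarrow> ereal (- \<kappa> f (integral\<^sup>L \<mu> f) t) \<le> K \<mu>"
    and optimal: "\<And>g v t. \<lbrakk>continuous_on S01 g; admissible g v t;
        (\<integral>x. (g x - v) / (1 + t * (g x - v)) ^ j \<partial>\<nu>) = 0\<rbrakk>
      \<Longrightarrow> \<exists>\<mu>\<in>M1. integral\<^sup>L \<mu> g = v \<and> K \<mu> \<le> ereal (- \<kappa> g v t)"
    and closed: "closed_cost f K"
  shows "(INF \<mu>\<in>{\<mu> \<in> M1. integral\<^sup>L \<mu> f = u}. K \<mu>) = dual_rate \<kappa> f u"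
proof (rule antisym)
  show "dual_rate \<kappa> f u \<le> (INF \<mu>\<in>{\<mu> \<in> M1. integral\<^sup>L \<mu> f = u}. K \<mu>)"
    unfolding dual_rate_def using weak by (intro INF_greatest SUP_least) auto
  show "(INF \<mu>\<in>{\<mu> \<in> M1. integral\<^sup>L \<mu> f = u}. K \<mu>) \<le> dual_rate \<kappa> f u"
  proof (cases "dual_rate \<kappa> f u")
    case (real r)
    \<comment> \<open>One \<open>1 / real (Suc k)\<close> in the distance comes from
      \<open>g\<close> against \<open>f\<close>, the other from \<open>v\<close> against
      \<open>u\<close>.\<close>
    have "\<exists>\<mu>\<in>M1. \<bar>integral\<^sup>L \<mu> f - u\<bar> \<le> 2 / real (Suc k) \<and> K \<mu> < ereal (r + 1 / real (Suc k))" for k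
    proof -
      let ?e = "1 / real (Suc k)"
      obtain g v t where g: "continuous_on S01 g" "\<forall>x\<in>S01. \<bar>g x - f x\<bar> \<le> ?e" "\<bar>v - u\<bar> \<le> ?e" "admissible g v t"
        "(\<integral>x. (g x - v) / (1 + t * (g x - v)) ^ j \<partial>\<nu>) = 0" "ereal (- \<kappa> g v t) \<le> dual_rate \<kappa> f u"
        using approx_critical[OF f low, of u ?e] real by auto
      obtain \<mu> where \<mu>: "\<mu> \<in> M1" "integral\<^sup>L \<mu> g = v" "K \<mu> \<le> ereal (- \<kappa> g v t)"
        using optimal[OF g(1,4,5)] by blast
      have "v - integral\<^sup>L \<mu> f = (\<integral>x. g x - f x \<partial>\<mu>)"
        using \<mu>(2) by (subst Bochner_Integration.integral_diff) (auto intro!: M1_integrable \<mu> f g(1))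
      moreover have "(\<integral>x. g x - f x \<partial>\<mu>) \<le> ?e"
        using abs_le_D1[OF g(2)[rule_format]] by (intro M1_integral_le \<mu> continuous_on_diff f g(1))
      moreover have "- ?e \<le> (\<integral>x. g x - f x \<partial>\<mu>)"
        using abs_le_D2[OF g(2)[rule_format]] by (intro M1_integral_ge \<mu> continuous_on_diff f g(1)) force
      ultimately have "\<bar>integral\<^sup>L \<mu> f - u\<bar> \<le> ?e + ?e" using g(3) by linarith
      moreover have "K \<mu> \<le> ereal r" using \<mu>(3) g(6) real by (metis order_trans)
      then have "K \<mu> < ereal (r + ?e)" by (rule le_less_trans) simp
      ultimately show ?thesis using \<mu>(1) by (intro bexI[of _ \<mu>]) auto
    qed
    then obtain \<mu> where \<mu>: "\<And>k. \<mu> k \<in> M1" "\<And>k. \<bar>integral\<^sup>L (\<mu> k) f - u\<bar> \<le> 2 / real (Suc k)"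
      "\<And>k. K (\<mu> k) < ereal (r + 1 / real (Suc k))" by metis
    have "(\<lambda>k. integral\<^sup>L (\<mu> k) f) \<longlonglongrightarrow> u"
    proof (rule LIM_zero_cancel, rule Lim_null_comparison)
      show "(\<lambda>k. 2 / real (Suc k)) \<longlonglongrightarrow> 0" by (rule LIMSEQ_Suc[OF lim_const_over_n])
    qed (use \<mu>(2) in auto)
    then obtain \<mu>' where "\<mu>' \<in> M1" "integral\<^sup>L \<mu>' f = u" "K \<mu>' \<le> ereal r"
      using closed_costD[OF closed \<mu>(1,3)] by blast
    then show ?thesis unfolding real by (intro INF_lower2[of \<mu>']) auto
  qed (use dual_rate_nonneg[of f u] in auto)
qed

section \<open>Identification of the two rate functions\<close>

text \<open>When the constraint value is the mean under \<mu> itself, the logarithm of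
  \<open>1 + t * (f - u)\<close> is a test function whose normalizing term in the entropy formula
  vanishes.\<close>

lemma exp_ln_admissible_integral:
  assumes "\<mu> \<in> M1" "continuous_on S01 f" "admissible f (integral\<^sup>L \<mu> f) t"
  shows "(\<integral>x. exp (ln (1 + t * (f x - integral\<^sup>L \<mu> f))) \<partial>\<mu>) = 1"
proof -
  have "(\<integral>x. exp (ln (1 + t * (f x - integral\<^sup>L \<mu> f))) \<partial>\<mu>) = (\<integral>x. 1 + t * (f x - integral\<^sup>L \<mu> f) \<partial>\<mu>)"
    using admissible_pos[OF assms(3)] by (intro M1_integral_cong assms(1)) auto
  then show ?thesis using M1_integral_affine[OF assms(1,2)] by simp
qed

text \<open>The test function \<open>ln (1 + t * (f - u))\<close> gives weak duality; at a critical
  point the minimizer has density \<open>1 / (1 + t * (g - v))\<close> with respect to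
  \<nu>.\<close>

theorem rate1_eq_dual_rate:
  assumes \<nu>: "\<nu> \<in> M1" and f: "continuous_on S01 f"
    and low: "charges_below \<nu> f" "charges_below \<nu> (\<lambda>x. - f x)"
  shows "rate1 f \<nu> u = dual_rate (log_kernel \<nu>) f u"
proof -
  interpret dual_kernel \<nu> "log_kernel \<nu>" 1 by (rule dual_kernel_log[OF \<nu>])
  show ?thesis
    unfolding rate1_def
  proof (rule INF_cost_eq_dual_rate[OF f low _ _ closed_cost_relative_entropy[OF \<nu> f]])
    fix \<mu> t assume \<mu>: "\<mu> \<in> M1" and adm: "admissible f (integral\<^sup>L \<mu> f) t"
    show "ereal (- log_kernel \<nu> f (integral\<^sup>L \<mu> f) t) \<le> relative_entropy \<nu> \<mu>"
      using relative_entropy_ge[OF continuous_on_admissible(1)[OF f adm], of \<nu> \<mu>]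
        exp_ln_admissible_integral[OF \<mu> f adm] by (simp add: log_kernel_def)
  next
    fix g :: "real \<Rightarrow> real" and v t :: real
    assume g: "continuous_on S01 g" and adm: "admissible g v t"
      and crit: "(\<integral>x. (g x - v) / (1 + t * (g x - v)) ^ 1 \<partial>\<nu>) = 0"
    define w where "w x = 1 / (1 + t * (g x - v))" for x
    define h where "h x = (g x - v) / (1 + t * (g x - v)) ^ 1" for x
    have w: "continuous_on S01 w" and h: "continuous_on S01 h"
      using continuous_on_admissible(2)[OF g adm] continuous_on_admissible(3)[OF g adm, of 1]
      by (simp_all add: w_def[abs_def] h_def[abs_def])
    have h0: "integral\<^sup>L \<nu> h = 0" using crit by (simp add: h_def[abs_def])
    note den = admissible_pos[OF adm]
    have wpos: "0 < w x" if "x \<in> S01" for x using den[OF that] by (simp add: w_def)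
    \<comment> \<open>\<open>w = 1 - t * h\<close>, so the critical equation is exactly what
      normalizes \<open>w\<close>.\<close>
    have "integral\<^sup>L \<nu> w = (\<integral>x. 1 + - t * (h x - 0) \<partial>\<nu>)"
    proof (rule M1_integral_cong[OF \<nu>])
      fix x assume "x \<in> S01"
      from den[OF this] show "w x = 1 + - t * (h x - 0)" by (simp add: w_def h_def field_simps)
    qed
    then have int_w: "integral\<^sup>L \<nu> w = 1" using M1_integral_affine[OF \<nu> h, of 1 "- t" 0] h0 by simp
    have M1: "density \<nu> (\<lambda>x. ennreal (w x)) \<in> M1" by (rule density_in_M1[OF \<nu> w wpos int_w])
    moreover have "integral\<^sup>L (density \<nu> (\<lambda>x. ennreal (w x))) g = v"
    proof -
      have "integral\<^sup>L (density \<nu> (\<lambda>x. ennreal (w x))) g = (\<integral>x. w x * g x \<partial>\<nu>)"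
        by (rule integral_density_M1[OF \<nu> w wpos g])
      \<comment> \<open>\<open>w * g = v * w + h\<close>: the same equation fixes the mean at
        \<open>v\<close>.\<close>
      also have "\<dots> = (\<integral>x. v * w x + h x \<partial>\<nu>)"
        by (intro M1_integral_cong \<nu>) (simp add: w_def h_def add_divide_distrib[symmetric])
      also have "\<dots> = v" using M1_integrable[OF \<nu> w] M1_integrable[OF \<nu> h] h0 int_w by simp
      finally show ?thesis .
    qed
    moreover have "relative_entropy \<nu> (density \<nu> (\<lambda>x. ennreal (w x))) \<le> ereal (- log_kernel \<nu> g v t)"
    proof -
      have "(\<integral>x. ln (w x) \<partial>\<nu>) = (\<integral>x. - ln (1 + t * (g x - v)) \<partial>\<nu>)"
        using den by (intro M1_integral_cong \<nu>) (simp add: w_def ln_div)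
      then show ?thesis
        using relative_entropy_density_le[OF \<nu> w wpos] by (simp add: log_kernel_def)
    qed
    ultimately show "\<exists>\<mu>\<in>M1. integral\<^sup>L \<mu> g = v \<and> relative_entropy \<nu> \<mu> \<le> ereal (- log_kernel \<nu> g v t)"
      by blast
  qed
qed

text \<open>Weak duality tests the two entropies with opposite functions, so the unknown middle
  measure cancels. The minimizing \<mu> has \<nu>-density proportional to the square of
  \<open>w\<close>, and \<upsilon>, with density proportional to \<open>w\<close>, is the normalized
  geometric mean of \<mu> and \<nu>.\<close>

theorem rate2_eq_dual_rate:
  assumes \<nu>: "\<nu> \<in> M1" and f: "continuous_on S01 f"
    and low: "charges_below \<nu> f" "charges_below \<nu> (\<lambda>x. - f x)"
  shows "rate2 f \<nu> u = dual_rate (inverse_kernel \<nu>) f u"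
proof -
  interpret dual_kernel \<nu> "inverse_kernel \<nu>" 2 by (rule dual_kernel_inverse[OF \<nu>])
  show ?thesis
    unfolding rate2_def
  proof (rule INF_cost_eq_dual_rate[OF f low _ _ closed_cost_J_divergence[OF \<nu> f]])
    fix \<mu> t assume \<mu>: "\<mu> \<in> M1" and adm: "admissible f (integral\<^sup>L \<mu> f) t"
    let ?g = "\<lambda>x. ln (1 + t * (f x - integral\<^sup>L \<mu> f))"
    note g = continuous_on_admissible(1)[OF f adm]
    have "(\<integral>x. exp (- ?g x) \<partial>\<nu>) = (\<integral>x. 1 / (1 + t * (f x - integral\<^sup>L \<mu> f)) \<partial>\<nu>)"
      using admissible_pos[OF adm] by (intro M1_integral_cong \<nu>) (simp add: exp_minus divide_inverse)
    then have "ereal (- integral\<^sup>L \<upsilon> ?g - inverse_kernel \<nu> f (integral\<^sup>L \<mu> f) t) \<le> relative_entropy \<upsilon> \<nu>" for \<upsilon>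
      using relative_entropy_ge[OF continuous_on_minus[OF g], of \<upsilon> \<nu>] by (simp add: inverse_kernel_def)
    moreover have "ereal (integral\<^sup>L \<upsilon> ?g) \<le> relative_entropy \<upsilon> \<mu>" for \<upsilon>
      using relative_entropy_ge[OF g, of \<upsilon> \<mu>] exp_ln_admissible_integral[OF \<mu> f adm] by simp
    ultimately have "ereal (integral\<^sup>L \<upsilon> ?g) + ereal (- integral\<^sup>L \<upsilon> ?g - inverse_kernel \<nu> f (integral\<^sup>L \<mu> f) t)
        \<le> relative_entropy \<upsilon> \<mu> + relative_entropy \<upsilon> \<nu>" for \<upsilon>
      by (intro add_mono)
    then show "ereal (- inverse_kernel \<nu> f (integral\<^sup>L \<mu> f) t) \<le> J_divergence \<mu> \<nu>"
      unfolding J_divergence_def by (intro INF_greatest) simp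
  next
    fix g :: "real \<Rightarrow> real" and v t :: real
    assume g: "continuous_on S01 g" and adm: "admissible g v t"
      and crit: "(\<integral>x. (g x - v) / (1 + t * (g x - v)) ^ 2 \<partial>\<nu>) = 0"
    define w where "w x = 1 / (1 + t * (g x - v))" for x
    define h where "h x = (g x - v) / (1 + t * (g x - v)) ^ 2" for x
    have w: "continuous_on S01 w" and h: "continuous_on S01 h"
      using continuous_on_admissible[OF g adm] by (simp_all add: w_def[abs_def] h_def[abs_def])
    have h0: "integral\<^sup>L \<nu> h = 0" using crit by (simp add: h_def[abs_def])
    note den = admissible_pos[OF adm]
    have wpos: "0 < w x" if "x \<in> S01" for x using den[OF that] by (simp add: w_def)
    define Z where "Z = integral\<^sup>L \<nu> w"
    have Z: "0 < Z" unfolding Z_def by (intro M1_integral_pos \<nu> w wpos)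
    \<comment> \<open>\<open>w * w = w - t * h\<close>: the critical equation with exponent 2 makes
      the integrals of \<open>w\<close> and of its square agree, so one constant \<open>Z\<close>
      normalizes both densities.\<close>
    have "(\<integral>x. w x * w x \<partial>\<nu>) = (\<integral>x. w x - t * h x \<partial>\<nu>)"
    proof (rule M1_integral_cong[OF \<nu>])
      fix x assume "x \<in> S01"
      define d where "d = 1 + t * (g x - v)"
      have d: "d \<noteq> 0" "1 = d - t * (g x - v)" using den[OF \<open>x \<in> S01\<close>] by (auto simp: d_def)
      have "w x * w x = 1 / d\<^sup>2" by (simp add: w_def d_def power2_eq_square)
      also have "\<dots> = (d - t * (g x - v)) / d\<^sup>2" using d(2) by simp
      also have "\<dots> = d / d\<^sup>2 - t * (g x - v) / d\<^sup>2" by (rule diff_divide_distrib)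
      also have "\<dots> = w x - t * h x"
        using d(1) by (simp add: w_def h_def d_def[symmetric] power2_eq_square)
      finally show "w x * w x = w x - t * h x" .
    qed
    also have "\<dots> = Z" using M1_integrable[OF \<nu> w] M1_integrable[OF \<nu> h] h0 by (simp add: Z_def)
    finally have int_w2: "(\<integral>x. w x * w x \<partial>\<nu>) = Z" .
    have wZ: "continuous_on S01 (\<lambda>x. w x / Z)" "\<And>x. x \<in> S01 \<Longrightarrow> 0 < w x / Z"
      using w Z wpos by (auto intro!: continuous_intros)
    have wwZ: "continuous_on S01 (\<lambda>x. w x / Z * w x)" "\<And>x. x \<in> S01 \<Longrightarrow> 0 < w x / Z * w x"
      using w wZ wpos Z by (auto intro!: continuous_intros)
    have Zw: "continuous_on S01 (\<lambda>x. Z / w x)" "\<And>x. x \<in> S01 \<Longrightarrow> 0 < Z / w x"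
      using w Z wpos by (auto intro!: continuous_intros simp: less_imp_neq[THEN not_sym])
    define \<upsilon> where "\<upsilon> = density \<nu> (\<lambda>x. ennreal (w x / Z))"
    define \<mu> where "\<mu> = density \<nu> (\<lambda>x. ennreal (w x / Z * w x))"
    have "(\<integral>x. w x / Z \<partial>\<nu>) = 1" using Z by (simp add: Z_def)
    then have \<upsilon>: "\<upsilon> \<in> M1" unfolding \<upsilon>_def by (intro density_in_M1 \<nu> wZ)
    have "(\<integral>x. w x / Z * w x \<partial>\<nu>) = 1" using Z int_w2 by simp
    then have \<mu>: "\<mu> \<in> M1" unfolding \<mu>_def by (intro density_in_M1 \<nu> wwZ)
    have mean: "integral\<^sup>L \<mu> g = v"
    proof -
      have "integral\<^sup>L \<mu> g = (\<integral>x. w x / Z * w x * g x \<partial>\<nu>)"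
        unfolding \<mu>_def by (rule integral_density_M1[OF \<nu> wwZ g])
      also have "\<dots> = (\<integral>x. v / Z * (w x * w x) + 1 / Z * h x \<partial>\<nu>)"
      proof (rule M1_integral_cong[OF \<nu>])
        fix x assume "x \<in> S01"
        have "h x = (g x - v) * (w x * w x)" by (simp add: w_def h_def power2_eq_square)
        then show "w x / Z * w x * g x = v / Z * (w x * w x) + 1 / Z * h x"
          using Z by (simp add: field_simps)
      qed
      also have "\<dots> = v / Z * (\<integral>x. w x * w x \<partial>\<nu>) + 1 / Z * integral\<^sup>L \<nu> h"
        using M1_integrable[OF \<nu> continuous_on_mult[OF w w]] M1_integrable[OF \<nu> h] by simp
      also have "\<dots> = v" using Z by (simp add: h0 int_w2)
      finally show ?thesis .
    qed
    \<comment> \<open>Both entropies are taken from \<upsilon>, so \<mu> and \<nu> are rewritten as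
      densities \<open>w\<close> and \<open>Z / w\<close> over \<upsilon>; the integrals of
      \<open>ln (w x)\<close> then cancel and leave \<open>- ln Z\<close>.\<close>
    have "density \<upsilon> (\<lambda>x. ennreal (w x)) = \<mu>"
      unfolding \<upsilon>_def \<mu>_def using M1_borel_measurable[OF \<nu>] w wZ wpos M1_space[OF \<nu>] Z
      by (subst density_density_eq) (auto intro!: density_cong AE_I2 simp: ennreal_mult''[symmetric] less_imp_le)
    then have 1: "relative_entropy \<upsilon> \<mu> \<le> ereal (- (\<integral>x. ln (w x) \<partial>\<upsilon>))"
      using relative_entropy_density_le[OF \<upsilon> w wpos] by simp
    have "density \<upsilon> (\<lambda>x. ennreal (Z / w x)) = density \<nu> (\<lambda>_. 1)"
      unfolding \<upsilon>_def
    proof (subst density_density_eq)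
      show "density \<nu> (\<lambda>x. ennreal (w x / Z) * ennreal (Z / w x)) = density \<nu> (\<lambda>_. 1)"
      proof (intro density_cong AE_I2)
        fix x assume "x \<in> space \<nu>"
        then have "0 < w x" using wpos M1_space[OF \<nu>] by simp
        then show "ennreal (w x / Z) * ennreal (Z / w x) = 1"
          using Z by (simp add: ennreal_mult'[symmetric])
      qed (use M1_borel_measurable[OF \<nu>] wZ Zw in auto)
    qed (use M1_borel_measurable[OF \<nu>] wZ Zw in auto)
    then have "relative_entropy \<upsilon> \<nu> \<le> ereal (- (\<integral>x. ln (Z / w x) \<partial>\<upsilon>))"
      using relative_entropy_density_le[OF \<upsilon> Zw] by (simp add: density_1)
    also have "(\<integral>x. ln (Z / w x) \<partial>\<upsilon>) = (\<integral>x. ln Z + - 1 * (ln (w x) - 0) \<partial>\<upsilon>)"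
    proof (rule M1_integral_cong[OF \<upsilon>])
      fix x assume "x \<in> S01"
      from wpos[OF this] Z show "ln (Z / w x) = ln Z + - 1 * (ln (w x) - 0)" by (simp add: ln_div)
    qed
    also have "\<dots> = ln Z + - 1 * ((\<integral>x. ln (w x) \<partial>\<upsilon>) - 0)"
      using wpos by (intro M1_integral_affine \<upsilon> continuous_on_ln w) (auto simp: less_imp_neq[THEN not_sym])
    finally have "relative_entropy \<upsilon> \<nu> \<le> ereal ((\<integral>x. ln (w x) \<partial>\<upsilon>) - ln Z)" by simp
    from add_mono[OF 1 this]
    have "relative_entropy \<upsilon> \<mu> + relative_entropy \<upsilon> \<nu> \<le> ereal (- inverse_kernel \<nu> g v t)"
      by (simp add: inverse_kernel_def Z_def w_def[abs_def])
    then have "J_divergence \<mu> \<nu> \<le> ereal (- inverse_kernel \<nu> g v t)"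
      unfolding J_divergence_def by (rule INF_lower2[OF \<upsilon>])
    then show "\<exists>\<mu>\<in>M1. integral\<^sup>L \<mu> g = v \<and> J_divergence \<mu> \<nu> \<le> ereal (- inverse_kernel \<nu> g v t)"
      using \<mu> mean by blast
  qed
qed

lemma good_rate_function_rate1:
  assumes "\<nu> \<in> M1" "continuous_on S01 f"
  shows "good_rate_function (rate1 f \<nu>)"
  using good_rate_function_INF_cost[OF assms(2) _ closed_cost_relative_entropy[OF assms]]
    relative_entropy_nonneg[OF assms(1)]
  by (simp add: rate1_def[abs_def])

lemma good_rate_function_rate2:
  assumes "\<nu> \<in> M1" "continuous_on S01 f"
  shows "good_rate_function (rate2 f \<nu>)"
proof -
  have "0 \<le> J_divergence \<mu> \<nu>" if "\<mu> \<in> M1" for \<mu>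
    unfolding J_divergence_def using that assms(1)
    by (intro INF_greatest add_nonneg_nonneg relative_entropy_nonneg)
  then show ?thesis
    using good_rate_function_INF_cost[OF assms(2) _ closed_cost_J_divergence[OF assms]]
    by (simp add: rate2_def[abs_def])
qed

section \<open>Inverse moments from a recursion\<close>

text \<open>The mean value theorem bounds the difference quotients by \<open>C\<close>, which
  permits dominated convergence once the sequence is shifted into the ball.\<close>

lemma has_real_derivative_integral:
  fixes F F' :: "real \<Rightarrow> 'a \<Rightarrow> real"
  assumes M: "finite_measure M" and r: "0 < r"
    and int: "\<And>x. x \<in> ball a r \<Longrightarrow> integrable M (F x)"
    and F': "F' a \<in> borel_measurable M"
    and deriv: "AE \<omega> in M. \<forall>x\<in>ball a r. ((\<lambda>x. F x \<omega>) has_real_derivative F' x \<omega>) (at x) \<and> \<bar>F' x \<omega>\<bar> \<le> C"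
  shows "((\<lambda>x. \<integral>\<omega>. F x \<omega> \<partial>M) has_real_derivative (\<integral>\<omega>. F' a \<omega> \<partial>M)) (at a)"
  unfolding has_field_derivative_iff tendsto_at_iff_sequentially comp_def
proof (intro allI impI)
  interpret finite_measure M by (rule M)
  fix X :: "nat \<Rightarrow> real" assume X: "\<forall>i. X i \<in> UNIV - {a}" and lim: "X \<longlonglongrightarrow> a"
  obtain k where k: "\<And>i. k \<le> i \<Longrightarrow> X i \<in> ball a r"
    using tendstoD[OF lim r] by (auto simp: eventually_sequentially dist_commute)
  define Y where "Y i = X (i + k)" for i
  have Y: "Y i \<in> ball a r" "Y i \<noteq> a" for i using k X by (auto simp: Y_def)
  have Y_lim: "Y \<longlonglongrightarrow> a" unfolding Y_def by (rule LIMSEQ_ignore_initial_segment[OF lim])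
  have a: "a \<in> ball a r" using r by simp
  have "(\<lambda>i. \<integral>\<omega>. (F (Y i) \<omega> - F a \<omega>) / (Y i - a) \<partial>M) \<longlonglongrightarrow> (\<integral>\<omega>. F' a \<omega> \<partial>M)"
  proof (rule integral_dominated_convergence[where w = "\<lambda>_. C"])
    show "AE \<omega> in M. (\<lambda>i. (F (Y i) \<omega> - F a \<omega>) / (Y i - a)) \<longlonglongrightarrow> F' a \<omega>"
      using deriv
    proof eventually_elim
      case (elim \<omega>)
      then have "((\<lambda>x. F x \<omega>) has_real_derivative F' a \<omega>) (at a)" using a by blast
      then show ?case
        unfolding has_field_derivative_iff tendsto_at_iff_sequentially comp_def using Y(2) Y_lim by simp
    qed
    show "AE \<omega> in M. norm ((F (Y i) \<omega> - F a \<omega>) / (Y i - a)) \<le> C" for i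
      using deriv
    proof eventually_elim
      case (elim \<omega>)
      have "norm (F (Y i) \<omega> - F a \<omega>) \<le> C * norm (Y i - a)"
        by (rule field_differentiable_bound[where f = "\<lambda>x. F x \<omega>", OF convex_ball[of a r]])
          (use elim Y a in \<open>auto intro: has_field_derivative_at_within\<close>)
      then show ?case using Y(2)[of i] by (simp add: abs_divide pos_divide_le_eq)
    qed
  qed (use F' int[OF Y(1)] int[OF a] in auto)
  moreover have "(\<integral>\<omega>. (F (Y i) \<omega> - F a \<omega>) / (Y i - a) \<partial>M)
      = ((\<integral>\<omega>. F (Y i) \<omega> \<partial>M) - (\<integral>\<omega>. F a \<omega> \<partial>M)) / (Y i - a)" for i
    using int[OF Y(1)] int[OF a] by simp
  ultimately have "(\<lambda>i. ((\<integral>\<omega>. F (Y i) \<omega> \<partial>M) - (\<integral>\<omega>. F a \<omega> \<partial>M)) / (Y i - a)) \<longlonglongrightarrow> (\<integral>\<omega>. F' a \<omega> \<partial>M)"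
    by (simp only:)
  then show "(\<lambda>i. ((\<integral>\<omega>. F (X i) \<omega> \<partial>M) - (\<integral>\<omega>. F a \<omega> \<partial>M)) / (X i - a)) \<longlonglongrightarrow> (\<integral>\<omega>. F' a \<omega> \<partial>M)"
    unfolding Y_def by (rule LIMSEQ_offset)
qed

text \<open>The recursion is a linear differential equation for the inverse moment as a function of a
  constant added to \<open>h\<close>; its boundary value is read off at infinity.\<close>

lemma inverse_moment_of_recursion:
  fixes V :: "'a \<Rightarrow> real measure"
  assumes N: "prob_space N" and \<nu>: "\<nu> \<in> M1" and V: "AE \<omega> in N. V \<omega> \<in> M1"
    and meas: "\<And>h :: real \<Rightarrow> real. continuous_on S01 h \<Longrightarrow> (\<lambda>\<omega>. integral\<^sup>L (V \<omega>) h) \<in> borel_measurable N"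
    and rec: "\<And>h :: real \<Rightarrow> real. \<lbrakk>continuous_on S01 h; \<And>x. x \<in> S01 \<Longrightarrow> 0 < h x\<rbrakk> \<Longrightarrow>
      (\<integral>\<omega>. 1 / integral\<^sup>L (V \<omega>) h ^ Suc n \<partial>N) = (\<integral>x. 1 / h x \<partial>\<nu>) * (\<integral>\<omega>. 1 / integral\<^sup>L (V \<omega>) h ^ n \<partial>N)"
    and h: "continuous_on S01 h" "\<And>x. x \<in> S01 \<Longrightarrow> 0 < h x"
  shows "(\<integral>\<omega>. 1 / integral\<^sup>L (V \<omega>) h ^ n \<partial>N) = exp (- real n * (\<integral>x. ln (h x) \<partial>\<nu>))"
proof -
  interpret prob_space N by (rule N)
  obtain c where c: "0 < c" "\<And>x. x \<in> S01 \<Longrightarrow> c \<le> h x" using continuous_on_S01_pos_bound[OF h] by blast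
  obtain B where B: "\<And>x. x \<in> S01 \<Longrightarrow> \<bar>h x\<bar> \<le> B" using continuous_on_S01_bound[OF h(1)] by blast
  have cB: "c \<le> B" using c(2)[of 0] B[of 0] by simp
  define H where "H \<omega> = integral\<^sup>L (V \<omega>) h" for \<omega>
  have [measurable]: "H \<in> borel_measurable N" unfolding H_def by (rule meas[OF h(1)])
  have H: "AE \<omega> in N. c \<le> H \<omega> \<and> H \<omega> \<le> B"
    using V
  proof eventually_elim
    case (elim \<omega>)
    show ?case unfolding H_def
      using M1_integral_ge[OF elim h(1) c(2)] M1_integral_le[OF elim h(1) abs_le_D1[OF B]] by simp
  qed
  \<comment> \<open>Moments of \<open>s + h\<close> as functions of the added constant
    \<open>s\<close>; \<open>L\<close> is the candidate exponent up to the factor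
    \<open>- real n\<close>.\<close>
  define \<phi> where "\<phi> k s = (\<integral>\<omega>. 1 / (s + H \<omega>) ^ k \<partial>N)" for k s
  define L where "L s = (\<integral>x. ln (s + h x) \<partial>\<nu>)" for s
  have sh: "continuous_on S01 (\<lambda>x. s + h x)" for s by (intro continuous_intros h)
  have sh_pos: "0 < s + h x" if "- c < s" "x \<in> S01" for s x using c(2)[OF that(2)] that(1) by simp
  have cont_ln: "continuous_on S01 (\<lambda>x. ln (s + h x))" if "- c < s" for s
    by (intro continuous_on_ln sh ballI) (use sh_pos[OF that] in fastforce)
  have cont_inv: "continuous_on S01 (\<lambda>x. 1 / (s + h x))" if "- c < s" for s
    by (intro continuous_on_divide continuous_on_const sh ballI) (use sh_pos[OF that] in fastforce)
  \<comment> \<open>Integrability for all \<open>s > - c\<close> leaves room for a two-sided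
    derivative at \<open>s = 0\<close>.\<close>
  have int_\<phi>: "integrable N (\<lambda>\<omega>. 1 / (s + H \<omega>) ^ k)" if s: "- c < s" for s k
  proof (rule integrable_const_bound[where B = "1 / (s + c) ^ k"])
    show "AE \<omega> in N. norm (1 / (s + H \<omega>) ^ k) \<le> 1 / (s + c) ^ k"
      using H
    proof eventually_elim
      case (elim \<omega>)
      then have "(s + c) ^ k \<le> (s + H \<omega>) ^ k" "0 < (s + H \<omega>) ^ k" "0 < (s + c) ^ k"
        using s by (auto intro!: power_mono)
      then show ?case by (simp add: frac_le)
    qed
  qed measurable
  have rec': "\<phi> (Suc n) s = (\<integral>x. 1 / (s + h x) \<partial>\<nu>) * \<phi> n s" if s: "- c < s" for s
  proof -
    have "AE \<omega> in N. integral\<^sup>L (V \<omega>) (\<lambda>x. s + h x) = s + H \<omega>"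
      using V
    proof eventually_elim
      case (elim \<omega>)
      then show ?case using M1_integral_affine[OF elim h(1), of s 1 0] by (simp add: H_def)
    qed
    then have "\<phi> k s = (\<integral>\<omega>. 1 / integral\<^sup>L (V \<omega>) (\<lambda>x. s + h x) ^ k \<partial>N)" for k
      unfolding \<phi>_def using meas[OF sh, of s] by (intro integral_cong_AE) auto
    then show ?thesis using rec[OF sh sh_pos[OF s]] by simp
  qed
  have deriv_\<phi>: "(\<phi> n has_real_derivative - real n * \<phi> (Suc n) s) (at s)" if s: "0 \<le> s" for s
  proof -
    have "((\<lambda>x. \<integral>\<omega>. 1 / (x + H \<omega>) ^ n \<partial>N) has_real_derivative (\<integral>\<omega>. - real n * (1 / (s + H \<omega>) ^ Suc n) \<partial>N)) (at s)"
    proof (rule has_real_derivative_integral[where r = "c / 2" and C = "real n / (c / 2) ^ Suc n"])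
      show "AE \<omega> in N. \<forall>x\<in>ball s (c / 2).
          ((\<lambda>x. 1 / (x + H \<omega>) ^ n) has_real_derivative - real n * (1 / (x + H \<omega>) ^ Suc n)) (at x) \<and>
          \<bar>- real n * (1 / (x + H \<omega>) ^ Suc n)\<bar> \<le> real n / (c / 2) ^ Suc n"
        using H
      proof eventually_elim
        case (elim \<omega>)
        show ?case
        proof
          fix x assume "x \<in> ball s (c / 2)"
          then have "\<bar>s - x\<bar> < c / 2" by (simp add: dist_real_def)
          then have x: "c / 2 \<le> x + H \<omega>" "0 < x + H \<omega>" using elim s c(1) by linarith+
          define q where "q x = 1 / (x + H \<omega>)" for x
          have "(q has_real_derivative - 1 / ((x + H \<omega>) * (x + H \<omega>))) (at x)"
            unfolding q_def using x(2) by (auto intro!: derivative_eq_intros)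
          then have "((\<lambda>x. q x ^ n) has_real_derivative
              real n * (- 1 / ((x + H \<omega>) * (x + H \<omega>)) * q x ^ (n - Suc 0))) (at x)"
            by (rule DERIV_power)
          also have "real n * (- 1 / ((x + H \<omega>) * (x + H \<omega>)) * q x ^ (n - Suc 0)) = - real n * (1 / (x + H \<omega>) ^ Suc n)"
            by (cases n) (simp_all add: q_def power_divide mult.assoc del: of_nat_Suc)
          finally have "((\<lambda>x. 1 / (x + H \<omega>) ^ n) has_real_derivative - real n * (1 / (x + H \<omega>) ^ Suc n)) (at x)"
            by (simp add: q_def power_divide)
          moreover have "(c / 2) ^ Suc n \<le> (x + H \<omega>) ^ Suc n"
            using x c(1) by (intro power_mono) auto
          then have "real n / (x + H \<omega>) ^ Suc n \<le> real n / (c / 2) ^ Suc n"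
            using c(1) by (intro divide_left_mono mult_pos_pos zero_less_power x) (auto simp del: power_Suc)
          then have "\<bar>- real n * (1 / (x + H \<omega>) ^ Suc n)\<bar> \<le> real n / (c / 2) ^ Suc n"
            using x(2) by (simp add: abs_mult del: power_Suc)
          ultimately show "((\<lambda>x. 1 / (x + H \<omega>) ^ n) has_real_derivative - real n * (1 / (x + H \<omega>) ^ Suc n)) (at x) \<and>
              \<bar>- real n * (1 / (x + H \<omega>) ^ Suc n)\<bar> \<le> real n / (c / 2) ^ Suc n" ..
        qed
      qed
      show "(\<lambda>\<omega>. - real n * (1 / (s + H \<omega>) ^ Suc n)) \<in> borel_measurable N" by measurable
      show "integrable N (\<lambda>\<omega>. 1 / (x + H \<omega>) ^ n)" if "x \<in> ball s (c / 2)" for x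
      proof (rule int_\<phi>)
        have "\<bar>s - x\<bar> < c / 2" using that by (simp add: dist_real_def)
        then show "- c < x" using s c(1) by linarith
      qed
    qed (use c(1) finite_measure_axioms in simp_all)
    then show ?thesis
      unfolding \<phi>_def[abs_def] by (simp only: Bochner_Integration.integral_mult_right_zero)
  qed
  have deriv_L: "(L has_real_derivative (\<integral>x. 1 / (s + h x) \<partial>\<nu>)) (at s)" if s: "0 \<le> s" for s
    unfolding L_def
  proof (rule has_real_derivative_integral[where r = "c / 2" and C = "1 / (c / 2)"])
    show "AE y in \<nu>. \<forall>x\<in>ball s (c / 2). ((\<lambda>x. ln (x + h y)) has_real_derivative 1 / (x + h y)) (at x) \<and>
        \<bar>1 / (x + h y)\<bar> \<le> 1 / (c / 2)"
    proof (intro AE_I2 ballI)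
      fix y x assume "y \<in> space \<nu>" and "x \<in> ball s (c / 2)"
      then have "c \<le> h y" "\<bar>s - x\<bar> < c / 2" using c(2) M1_space[OF \<nu>] by (auto simp: dist_real_def)
      then have x: "c / 2 \<le> x + h y" "0 < x + h y" using c(1) s by linarith+
      then have "((\<lambda>x. ln (x + h y)) has_real_derivative 1 / (x + h y)) (at x)"
        by (auto intro!: derivative_eq_intros)
      moreover have "1 / (x + h y) \<le> 1 / (c / 2)" using x c(1) by (intro divide_left_mono) auto
      ultimately show "((\<lambda>x. ln (x + h y)) has_real_derivative 1 / (x + h y)) (at x) \<and> \<bar>1 / (x + h y)\<bar> \<le> 1 / (c / 2)"
        using x by simp
    qed
    show "finite_measure \<nu>" using M1_prob_space[OF \<nu>] by (simp add: prob_space_def)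
    show "(\<lambda>x. 1 / (s + h x)) \<in> borel_measurable \<nu>"
      using s c(1) by (intro M1_borel_measurable \<nu> cont_inv) simp
    show "integrable \<nu> (\<lambda>y. ln (x + h y))" if "x \<in> ball s (c / 2)" for x
    proof (intro M1_integrable \<nu> cont_ln)
      have "\<bar>s - x\<bar> < c / 2" using that by (simp add: dist_real_def)
      then show "- c < x" using s c(1) by linarith
    qed
  qed (use c(1) in simp)
  \<comment> \<open>The quotient of the moment and its claimed value. Differentiating produces the
    moment of order \<open>Suc n\<close>, which the recursion rewrites as the derivative of
    \<open>L\<close> times the moment of order \<open>n\<close>; the two contributions
    cancel.\<close>
  define g where "g s = \<phi> n s * exp (real n * L s)" for s
  have "(g has_real_derivative 0) (at s)" if s: "0 \<le> s" for s
    unfolding g_def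
    by (rule derivative_eq_intros deriv_\<phi> deriv_L s refl)+
      (use rec'[of s] s c(1) in \<open>simp add: algebra_simps\<close>)
  then have const: "g s = g 0" if "0 \<le> s" for s
    using has_field_derivative_zero_constant[of "{0..}" g] that
    by (force intro: has_field_derivative_at_within)
  \<comment> \<open>Since \<open>h\<close> and its means lie between \<open>c\<close> and
    \<open>B\<close>, both factors of \<open>g\<close> are pinned by powers of \<open>s + c\<close>
    and \<open>s + B\<close>, whose ratio tends to 1.\<close>
  have bounds: "((s + c) / (s + B)) ^ n \<le> g 0 \<and> g 0 \<le> ((s + B) / (s + c)) ^ n" if s: "0 \<le> s" for s
  proof -
    have pos: "0 < s + c" "0 < s + B" using s c(1) cB by auto
    have "1 / (s + B) ^ n = (\<integral>\<omega>. 1 / (s + B) ^ n \<partial>N)" by (simp add: prob_space)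
    also have "\<dots> \<le> \<phi> n s" unfolding \<phi>_def
    proof (rule integral_mono_AE)
      show "AE \<omega> in N. 1 / (s + B) ^ n \<le> 1 / (s + H \<omega>) ^ n"
        using H
      proof eventually_elim
        case (elim \<omega>)
        then show ?case using s c(1) by (intro divide_left_mono power_mono mult_pos_pos) auto
      qed
    qed (use s c(1) in \<open>auto intro!: int_\<phi>\<close>)
    finally have 1: "1 / (s + B) ^ n \<le> \<phi> n s" .
    have "\<phi> n s \<le> (\<integral>\<omega>. 1 / (s + c) ^ n \<partial>N)" unfolding \<phi>_def
    proof (rule integral_mono_AE)
      show "AE \<omega> in N. 1 / (s + H \<omega>) ^ n \<le> 1 / (s + c) ^ n"
        using H
      proof eventually_elim
        case (elim \<omega>)
        then show ?case using s c(1) by (intro divide_left_mono power_mono mult_pos_pos) auto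
      qed
    qed (use s c(1) in \<open>auto intro!: int_\<phi>\<close>)
    then have 2: "\<phi> n s \<le> 1 / (s + c) ^ n" by (simp add: prob_space)
    have sc: "- c < s" using s c(1) by simp
    have "ln (s + c) \<le> L s" unfolding L_def using c(2) pos
      by (intro M1_integral_ge \<nu> cont_ln sc) (auto intro!: ln_mono)
    moreover have "L s \<le> ln (s + B)" unfolding L_def using sh_pos[OF sc] pos abs_le_D1[OF B]
      by (intro M1_integral_le \<nu> cont_ln sc) (auto intro!: ln_mono)
    ultimately have "exp (real n * ln (s + c)) \<le> exp (real n * L s)" "exp (real n * L s) \<le> exp (real n * ln (s + B))"
      by (simp_all add: mult_left_mono)
    then have 3: "(s + c) ^ n \<le> exp (real n * L s)" "exp (real n * L s) \<le> (s + B) ^ n"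
      using pos by (simp_all add: exp_of_nat_mult)
    have 4: "0 \<le> \<phi> n s" using pos by (intro order_trans[OF _ 1]) simp
    have "1 / (s + B) ^ n * (s + c) ^ n \<le> g s" "g s \<le> 1 / (s + c) ^ n * (s + B) ^ n"
      unfolding g_def using pos by (intro mult_mono 1 2 3 4; simp)+
    then show ?thesis using const[OF s] by (simp add: power_divide)
  qed
  have lim: "((\<lambda>s. ((s + c) / (s + B)) ^ n) \<longlongrightarrow> 1 ^ n) at_top" "((\<lambda>s. ((s + B) / (s + c)) ^ n) \<longlongrightarrow> 1 ^ n) at_top"
    by (intro tendsto_power; real_asymp)+
  have ev: "\<forall>\<^sub>F s in at_top. ((s + c) / (s + B)) ^ n \<le> g 0" "\<forall>\<^sub>F s in at_top. g 0 \<le> ((s + B) / (s + c)) ^ n"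
    using bounds by (auto intro: eventually_mono[OF eventually_ge_at_top[of 0]])
  have "1 ^ n \<le> g 0" by (rule tendsto_upperbound[OF lim(1) ev(1)]) simp
  moreover have "g 0 \<le> 1 ^ n" by (rule tendsto_lowerbound[OF lim(2) ev(2)]) simp
  ultimately have "g 0 = 1" by simp
  then have "\<phi> n 0 * exp (real n * L 0) * exp (- real n * L 0) = exp (- real n * L 0)" by (simp add: g_def)
  then show ?thesis by (simp add: \<phi>_def L_def H_def mult.assoc exp_add[symmetric])
qed

section \<open>Integrals against the law Beta(1,n)\<close>

lemma beta_law_1:
  assumes n: "1 \<le> n"
  shows "beta_law 1 (real n) = density lborel (\<lambda>x. ennreal (real n * (1 - x) ^ (n - 1)) * indicator {0<..<1} x)"
proof -
  have "Beta 1 (real n) = 1 / real n"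
    using n Gamma_plus1[of "real n"] by (simp add: Beta_def Gamma_eq_zero_iff add.commute nonpos_Ints_def)
  then have "x powr (1 - 1) * (1 - x) powr (real n - 1) / Beta 1 (real n) * indicator {0<..<1} x
      = real n * (1 - x) ^ (n - 1) * indicator {0<..<1} x" for x :: real
    using n by (auto simp: indicator_def powr_realpow[symmetric] of_nat_diff)
  then show ?thesis
    unfolding beta_law_def
    by (intro arg_cong[where f = "density lborel"] ext) (simp add: ennreal_mult'' ennreal_indicator[symmetric])
qed

lemma sets_beta_law [simp, measurable_cong]: "sets (beta_law a b) = sets borel"
  by (simp add: beta_law_def)

lemma nn_integral_beta_law_1:
  fixes f :: "real \<Rightarrow> real"
  assumes n: "1 \<le> n" and f: "f \<in> borel_measurable borel" "\<And>y. 0 \<le> y \<Longrightarrow> y \<le> 1 \<Longrightarrow> 0 \<le> f y"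
    and F: "\<And>y. 0 \<le> y \<Longrightarrow> y \<le> 1 \<Longrightarrow> (F has_real_derivative real n * (1 - y) ^ (n - 1) * f y) (at y)"
  shows "(\<integral>\<^sup>+y. ennreal (f y) \<partial>beta_law 1 (real n)) = ennreal (F 1 - F 0)"
proof -
  have [measurable]: "f \<in> borel_measurable borel" by fact
  define g where "g y = real n * (1 - y) ^ (n - 1) * f y * indicator {0..1} y" for y
  have "(\<integral>\<^sup>+y. ennreal (f y) \<partial>beta_law 1 (real n))
      = (\<integral>\<^sup>+y. ennreal (real n * (1 - y) ^ (n - 1)) * indicator {0<..<1} y * ennreal (f y) \<partial>lborel)"
    unfolding beta_law_1[OF n] by (subst nn_integral_density) auto
  also have "\<dots> = (\<integral>\<^sup>+y. ennreal (g y) * indicator {0..1} y \<partial>lborel)"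
  proof (rule nn_integral_cong_AE)
    show "AE y in lborel. ennreal (real n * (1 - y) ^ (n - 1)) * indicator {0<..<1} y * ennreal (f y)
        = ennreal (g y) * indicator {0..1} y"
      using AE_lborel_singleton[of 0] AE_lborel_singleton[of 1]
      by eventually_elim (use f(2) in \<open>auto simp: g_def indicator_def ennreal_mult[symmetric]\<close>)
  qed
  also have "\<dots> = ennreal (F 1 - F 0)"
    by (rule nn_integral_FTC_Icc) (use f F in \<open>auto simp: g_def\<close>)
  finally show ?thesis .
qed

text \<open>The integrand times the Beta density has the antiderivative
  \<open>- (((1 - y) / (y * c + (1 - y) * m)) ^ n / c)\<close>, since the inner quotient has
  derivative \<open>- c\<close> over the square of its denominator. The order \<open>Suc n\<close>
  is matched to the Beta parameter \<open>n\<close>, and this match makes the result factor into a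
  term in \<open>c\<close> and a term in \<open>m\<close>.\<close>

lemma nn_integral_beta_law_inverse_power:
  assumes n: "1 \<le> n" and c: "0 < c" and m: "0 < m"
  shows "(\<integral>\<^sup>+y. ennreal (1 / (y * c + (1 - y) * m) ^ Suc n) \<partial>beta_law 1 (real n)) = ennreal (1 / c * (1 / m ^ n))"
proof -
  have pos: "0 < y * c + (1 - y) * m" if "0 \<le> y" "y \<le> 1" for y
  proof (cases "y = 0")
    case False
    then show ?thesis using that c m by (intro add_pos_nonneg) auto
  qed (use m in simp)
  have "(\<integral>\<^sup>+y. ennreal (1 / (y * c + (1 - y) * m) ^ Suc n) \<partial>beta_law 1 (real n))
      = ennreal ((\<lambda>y. - (((1 - y) / (y * c + (1 - y) * m)) ^ n / c)) 1 - (\<lambda>y. - (((1 - y) / (y * c + (1 - y) * m)) ^ n / c)) 0)"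
  proof (rule nn_integral_beta_law_1[OF n])
    fix y :: real assume y: "0 \<le> y" "y \<le> 1"
    define d where "d = y * c + (1 - y) * m"
    have d: "0 < d" using pos[OF y] by (simp add: d_def)
    show "0 \<le> 1 / (y * c + (1 - y) * m) ^ Suc n" using d by (simp add: d_def)
    obtain k where k: "n = Suc k" using n by (cases n) auto
    define q where "q y = (1 - y) / (y * c + (1 - y) * m)" for y
    have "(q has_real_derivative - c / (d * d)) (at y)"
      unfolding q_def using d by (auto intro!: derivative_eq_intros simp: d_def algebra_simps)
    then have "((\<lambda>y. - (q y ^ n / c)) has_real_derivative - (real n * (- c / (d * d) * q y ^ (n - Suc 0)) / c)) (at y)"
      by (intro DERIV_minus DERIV_cdivide DERIV_power)
    also have "- (real n * (- c / (d * d) * q y ^ (n - Suc 0)) / c) = real n * (1 - y) ^ (n - 1) * (1 / d ^ Suc n)"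
      using c d by (simp add: k power_divide q_def d_def[symmetric])
    finally show "((\<lambda>y. - (((1 - y) / (y * c + (1 - y) * m)) ^ n / c)) has_real_derivative
        real n * (1 - y) ^ (n - 1) * (1 / (y * c + (1 - y) * m) ^ Suc n)) (at y)"
      by (simp add: d_def q_def[abs_def])
  qed measurable
  also have "\<dots> = ennreal (1 / c * (1 / m ^ n))" using n by (cases n) (simp_all add: power_divide mult.commute)
  finally show ?thesis .
qed

lemma prob_space_beta_law_1:
  assumes n: "1 \<le> n"
  shows "prob_space (beta_law 1 (real n))"
proof
  \<comment> \<open>At \<open>c = m = 1\<close> the integrand is constant, so the same formula gives
    the total mass.\<close>
  have "(\<integral>\<^sup>+y. ennreal 1 \<partial>beta_law 1 (real n)) = ennreal 1"
    using nn_integral_beta_law_inverse_power[OF n, of 1 1] by simp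
  then show "emeasure (beta_law 1 (real n)) (space (beta_law 1 (real n))) = 1" by simp
qed

lemma AE_beta_law_1: "AE y in beta_law 1 (real n). 0 < y \<and> y < 1"
  unfolding beta_law_def by (subst AE_density) (auto simp: indicator_def)

text \<open>The value is \<open>n / (n + 1)\<close>; being below 1, it makes the expected unbroken
  length decay geometrically.\<close>

lemma beta_law_1_mean_complement:
  assumes n: "1 \<le> n"
  shows "(\<integral>\<^sup>+y. ennreal (1 - y) \<partial>beta_law 1 (real n)) < 1"
proof -
  have "(\<integral>\<^sup>+y. ennreal (1 - y) \<partial>beta_law 1 (real n))
      = ennreal ((\<lambda>y. - (real n / real (Suc n) * (1 - y) ^ Suc n)) 1 - (\<lambda>y. - (real n / real (Suc n) * (1 - y) ^ Suc n)) 0)"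
  proof (rule nn_integral_beta_law_1[OF n])
    fix y :: real
    obtain k where k: "n = Suc k" using n by (cases n) auto
    show "((\<lambda>y. - (real n / real (Suc n) * (1 - y) ^ Suc n)) has_real_derivative real n * (1 - y) ^ (n - 1) * (1 - y)) (at y)"
      by (rule derivative_eq_intros refl)+ (simp add: k field_simps)
  qed auto
  also have "\<dots> < 1" by (simp add: ennreal_less_one_iff)
  finally show ?thesis .
qed

section \<open>Stick breaking\<close>

lemma integral_atomic_measure:
  fixes h :: "real \<Rightarrow> real"
  assumes x: "\<And>i. i \<in> I \<Longrightarrow> x i \<in> S01" and h: "continuous_on S01 h"
  shows "integral\<^sup>L (atomic_measure I w x) h = (\<integral>i. max 0 (w i) * h (x i) \<partial>count_space I)"
proof -
  have x': "x \<in> measurable (density (count_space I) (\<lambda>i. ennreal (w i))) borel_S01"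
    using x by (simp add: space_restrict_space measurable_count_space_eq1 Pi_iff)
  have "integral\<^sup>L (atomic_measure I w x) h = (\<integral>i. h (x i) \<partial>density (count_space I) (\<lambda>i. ennreal (w i)))"
    unfolding atomic_measure_def
    by (rule integral_distr[OF x' borel_measurable_continuous_on_restrict[OF h]])
  also have "(\<lambda>i. ennreal (w i)) = (\<lambda>i. ennreal (max 0 (w i)))"
    by (auto simp: max_def ennreal_neg)
  also have "(\<integral>i. h (x i) \<partial>density (count_space I) \<dots>) = (\<integral>i. max 0 (w i) * h (x i) \<partial>count_space I)"
    by (subst integral_density) auto
  finally show ?thesis .
qed

lemma atomic_measure_in_M1:
  assumes x: "\<And>i. i \<in> I \<Longrightarrow> x i \<in> S01" and w: "(\<integral>\<^sup>+i. ennreal (w i) \<partial>count_space I) = 1"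
  shows "atomic_measure I w x \<in> M1"
proof -
  have x': "x \<in> measurable (density (count_space I) (\<lambda>i. ennreal (w i))) borel_S01"
    using x by (simp add: space_restrict_space measurable_count_space_eq1 Pi_iff)
  have "(\<integral>\<^sup>+i. ennreal (w i) * indicator I i \<partial>count_space I) = 1"
    unfolding w[symmetric] by (intro nn_integral_cong) simp
  then have "prob_space (density (count_space I) (\<lambda>i. ennreal (w i)))"
    by (intro prob_spaceI) (simp add: emeasure_density)
  then have "prob_space (atomic_measure I w x)"
    unfolding atomic_measure_def using x' by (rule prob_space.prob_space_distr)
  then show ?thesis by (simp add: M1_iff atomic_measure_def)
qed

text \<open>Joint measurability on the product with the counting measure. No summability is assumed,
  so random means are measurable even where the series fails to converge.\<close>

lemma borel_measurable_integral_count_space: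
  fixes F :: "'a \<Rightarrow> nat \<Rightarrow> real"
  assumes "\<And>i. (\<lambda>\<omega>. F \<omega> i) \<in> borel_measurable N"
  shows "(\<lambda>\<omega>. \<integral>i. F \<omega> i \<partial>count_space UNIV) \<in> borel_measurable N"
proof -
  interpret sigma_finite_measure "count_space (UNIV :: nat set)"
    by (rule sigma_finite_measure_count_space)
  have "(\<lambda>p. F (fst p) (snd p)) \<in> borel_measurable (N \<Otimes>\<^sub>M count_space UNIV)"
    by (rule measurable_compose_countable[where f = "\<lambda>i p. F (fst p) i" and g = snd])
      (use assms in \<open>auto intro: measurable_compose[OF measurable_fst]\<close>)
  then show ?thesis
    by (intro borel_measurable_lebesgue_integral) (simp add: case_prod_unfold)
qed

text \<open>The almost sure event on which stick breaking gives a probability vector: the product is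
  the length still unbroken after \<open>k\<close> breaks.\<close>

definition proper_sticks :: "(nat \<Rightarrow> real) \<Rightarrow> bool" where
  "proper_sticks U \<longleftrightarrow> (\<forall>i. 0 < U i \<and> U i < 1) \<and> (\<lambda>k. \<Prod>j<k. 1 - U j) \<longlonglongrightarrow> 0"

lemma stick_breaking_sums:
  assumes "proper_sticks U"
  shows "stick_breaking U sums 1" and "0 \<le> stick_breaking U i"
proof -
  have partial: "(\<Sum>i<k. stick_breaking U i) = 1 - (\<Prod>j<k. 1 - U j)" for k
    by (induction k) (simp_all add: stick_breaking_def algebra_simps)
  have "(\<lambda>k. 1 - (\<Prod>j<k. 1 - U j)) \<longlonglongrightarrow> 1 - 0"
    using assms by (intro tendsto_diff tendsto_const) (simp add: proper_sticks_def)
  then show "stick_breaking U sums 1" by (simp add: sums_def partial)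
  show "0 \<le> stick_breaking U i"
    using assms unfolding stick_breaking_def proper_sticks_def
    by (intro mult_nonneg_nonneg prod_nonneg) (auto simp: less_imp_le)
qed

lemma stick_breaking_case_nat:
  "stick_breaking (case_nat y U) 0 = y"
  "stick_breaking (case_nat y U) (Suc i) = (1 - y) * stick_breaking U i"
  by (simp_all add: stick_breaking_def prod.lessThan_Suc_shift del: prod.lessThan_Suc)

lemma proper_sticks_case_nat:
  assumes "proper_sticks U" "0 < y" "y < 1"
  shows "proper_sticks (case_nat y U)"
proof -
  have "(\<lambda>k. (1 - y) * (\<Prod>j<k. 1 - U j)) \<longlonglongrightarrow> (1 - y) * 0"
    using assms(1) by (intro tendsto_mult tendsto_const) (simp add: proper_sticks_def)
  then have "(\<lambda>k. \<Prod>j<Suc k. 1 - case_nat y U j) \<longlonglongrightarrow> 0"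
    by (simp add: prod.lessThan_Suc_shift del: prod.lessThan_Suc)
  then have "(\<lambda>k. \<Prod>j<k. 1 - case_nat y U j) \<longlonglongrightarrow> 0" by (rule LIMSEQ_imp_Suc)
  then show ?thesis using assms by (simp add: proper_sticks_def split: nat.split)
qed

abbreviation stick_measure :: "(nat \<Rightarrow> real) \<Rightarrow> (nat \<Rightarrow> real) \<Rightarrow> real measure" where
  "stick_measure U \<xi> \<equiv> atomic_measure UNIV (stick_breaking U) \<xi>"

lemma stick_measure_in_M1:
  assumes "proper_sticks U" "\<And>i. \<xi> i \<in> S01"
  shows "stick_measure U \<xi> \<in> M1"
proof (rule atomic_measure_in_M1[OF assms(2)])
  note sums = stick_breaking_sums[OF assms(1)]
  show "(\<integral>\<^sup>+i. ennreal (stick_breaking U i) \<partial>count_space UNIV) = 1"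
    using suminf_ennreal_eq[OF sums(2,1)] by (simp add: nn_integral_count_space_nat)
qed

lemma stick_measure_mean_sums:
  fixes h :: "real \<Rightarrow> real"
  assumes U: "proper_sticks U" and \<xi>: "\<And>i. \<xi> i \<in> S01" and h: "continuous_on S01 h"
  shows "(\<lambda>i. stick_breaking U i * h (\<xi> i)) sums integral\<^sup>L (stick_measure U \<xi>) h"
proof -
  note sums = stick_breaking_sums[OF U]
  obtain B where B: "0 < B" "\<And>x. x \<in> S01 \<Longrightarrow> \<bar>h x\<bar> \<le> B" using continuous_on_S01_bound[OF h] by blast
  have "summable (\<lambda>i. norm (stick_breaking U i * h (\<xi> i)))"
  proof (rule summable_comparison_test')
    show "summable (\<lambda>i. stick_breaking U i * B)"
      using sums(1) by (intro summable_mult2) (auto simp: sums_iff)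
    show "norm (norm (stick_breaking U i * h (\<xi> i))) \<le> stick_breaking U i * B" if "0 \<le> i" for i
      using sums(2) B(2)[OF \<xi>] by (auto simp: abs_mult intro: mult_left_mono)
  qed
  then have "integrable (count_space UNIV) (\<lambda>i. stick_breaking U i * h (\<xi> i))"
    by (simp add: integrable_count_space_nat_iff)
  from sums_integral_count_space_nat[OF this] show ?thesis
    using sums(2) by (simp add: integral_atomic_measure[OF \<xi> h])
qed

text \<open>Self-similarity as a pointwise identity: after the first atom the weights are those of
  the shifted sequence scaled by \<open>1 - y\<close>.\<close>

lemma stick_measure_mean_case_nat:
  fixes h :: "real \<Rightarrow> real"
  assumes U: "proper_sticks U" and \<xi>: "\<And>i. \<xi> i \<in> S01" and h: "continuous_on S01 h"
    and y: "0 < y" "y < 1" and x: "x \<in> S01"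
  shows "integral\<^sup>L (stick_measure (case_nat y U) (case_nat x \<xi>)) h
    = y * h x + (1 - y) * integral\<^sup>L (stick_measure U \<xi>) h"
proof -
  let ?a = "\<lambda>i. stick_breaking (case_nat y U) i * h (case_nat x \<xi> i)"
  have "(\<lambda>i. (1 - y) * (stick_breaking U i * h (\<xi> i))) sums ((1 - y) * integral\<^sup>L (stick_measure U \<xi>) h)"
    by (intro sums_mult stick_measure_mean_sums U \<xi> h)
  then have "(\<lambda>i. ?a (Suc i)) sums ((1 - y) * integral\<^sup>L (stick_measure U \<xi>) h)"
    by (simp add: stick_breaking_case_nat mult.assoc)
  then have "?a sums ((1 - y) * integral\<^sup>L (stick_measure U \<xi>) h + ?a 0)"
    by (rule sums_Suc)
  moreover have "case_nat x \<xi> i \<in> S01" for i using x \<xi> by (cases i) auto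
  then have "?a sums integral\<^sup>L (stick_measure (case_nat y U) (case_nat x \<xi>)) h"
    by (intro stick_measure_mean_sums proper_sticks_case_nat U y h)
  ultimately show ?thesis by (auto simp: stick_breaking_case_nat dest: sums_unique2)
qed

lemma borel_measurable_stick_breaking [measurable]:
  assumes [measurable]: "\<And>i. (\<lambda>\<omega>. U \<omega> i) \<in> borel_measurable N"
  shows "(\<lambda>\<omega>. stick_breaking (U \<omega>) i) \<in> borel_measurable N"
  unfolding stick_breaking_def by measurable

lemma borel_measurable_stick_measure_mean:
  fixes h :: "real \<Rightarrow> real"
  assumes U: "\<And>i. (\<lambda>\<omega>. U \<omega> i) \<in> borel_measurable N"
    and \<xi>: "\<And>i. (\<lambda>\<omega>. \<xi> \<omega> i) \<in> N \<rightarrow>\<^sub>M borel_S01" and h: "continuous_on S01 h"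
  shows "(\<lambda>\<omega>. integral\<^sup>L (stick_measure (U \<omega>) (\<xi> \<omega>)) h) \<in> borel_measurable N"
proof -
  have "(\<lambda>\<omega>. h (\<xi> \<omega> i)) \<in> borel_measurable N" for i
    by (rule measurable_compose[OF \<xi> borel_measurable_continuous_on_restrict[OF h]])
  then have "(\<lambda>\<omega>. \<integral>i. max 0 (stick_breaking (U \<omega>) i) * h (\<xi> \<omega> i) \<partial>count_space UNIV) \<in> borel_measurable N"
    by (intro borel_measurable_integral_count_space borel_measurable_times borel_measurable_max
        borel_measurable_const borel_measurable_stick_breaking U)
  moreover have "\<xi> \<omega> i \<in> S01" if "\<omega> \<in> space N" for \<omega> i
    using measurable_space[OF \<xi> that] by (simp add: space_restrict_space)
  then have "integral\<^sup>L (stick_measure (U \<omega>) (\<xi> \<omega>)) h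
      = (\<integral>i. max 0 (stick_breaking (U \<omega>) i) * h (\<xi> \<omega> i) \<partial>count_space UNIV)" if "\<omega> \<in> space N" for \<omega>
    using that by (intro integral_atomic_measure h)
  ultimately show ?thesis by (subst measurable_cong)
qed

section \<open>Infinite product laws and the recursion for the Dirichlet process\<close>

text \<open>An i.i.d. sequence is an independent first term followed by a copy of the whole
  sequence.\<close>

lemma nn_integral_PiM_case_nat:
  assumes M: "prob_space M" and f: "f \<in> borel_measurable (PiM (UNIV :: nat set) (\<lambda>_. M))"
  shows "(\<integral>\<^sup>+\<omega>. f \<omega> \<partial>PiM UNIV (\<lambda>_. M)) = (\<integral>\<^sup>+x. \<integral>\<^sup>+\<omega>. f (case_nat x \<omega>) \<partial>PiM UNIV (\<lambda>_. M) \<partial>M)"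
proof -
  interpret sequence_space M
    unfolding sequence_space_def using M by (intro product_prob_spaceI)
  have case_nat: "(\<lambda>(x, \<omega>). case_nat x \<omega>) \<in> M \<Otimes>\<^sub>M S \<rightarrow>\<^sub>M S" by measurable
  have "(\<integral>\<^sup>+\<omega>. f \<omega> \<partial>S) = (\<integral>\<^sup>+\<omega>. f \<omega> \<partial>distr (M \<Otimes>\<^sub>M S) S (\<lambda>(x, \<omega>). case_nat x \<omega>))"
    by (simp only: PiM_iter)
  also have "\<dots> = (\<integral>\<^sup>+p. f ((\<lambda>(x, \<omega>). case_nat x \<omega>) p) \<partial>(M \<Otimes>\<^sub>M S))"
    by (rule nn_integral_distr[OF case_nat]) (simp add: f)
  also have "\<dots> = (\<integral>\<^sup>+x. \<integral>\<^sup>+\<omega>. f (case_nat x \<omega>) \<partial>S \<partial>M)"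
    using measurable_compose[OF case_nat f] by (subst P.nn_integral_fst[symmetric]) auto
  finally show ?thesis .
qed

text \<open>Serves both the unbroken length of a stick and the product over sampled atoms; peeling
  off one coordinate at a time stays on the infinite product space.\<close>

lemma nn_integral_PiM_prod_lessThan:
  assumes M: "prob_space M" and g: "g \<in> borel_measurable M"
  shows "(\<integral>\<^sup>+\<omega>. (\<Prod>j<k. g (\<omega> j)) \<partial>PiM (UNIV :: nat set) (\<lambda>_. M)) = (\<integral>\<^sup>+x. g x \<partial>M) ^ k"
proof (induction k)
  case 0
  show ?case by (simp add: prob_space.emeasure_space_1[OF prob_space_PiM[OF M]])
next
  case (Suc k)
  have meas: "(\<lambda>\<omega>. \<Prod>j<k. g (\<omega> j)) \<in> borel_measurable (PiM (UNIV :: nat set) (\<lambda>_. M))" for k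
    using g by measurable
  have "(\<integral>\<^sup>+\<omega>. (\<Prod>j<Suc k. g (\<omega> j)) \<partial>PiM UNIV (\<lambda>_. M))
      = (\<integral>\<^sup>+x. \<integral>\<^sup>+\<omega>. g x * (\<Prod>j<k. g (\<omega> j)) \<partial>PiM UNIV (\<lambda>_. M) \<partial>M)"
    by (subst nn_integral_PiM_case_nat[OF M meas])
      (simp add: prod.lessThan_Suc_shift del: prod.lessThan_Suc)
  also have "\<dots> = (\<integral>\<^sup>+x. g x \<partial>M) * (\<integral>\<^sup>+x. g x \<partial>M) ^ k"
    using g meas by (simp add: nn_integral_cmult nn_integral_multc Suc.IH)
  finally show ?case by simp
qed

text \<open>The unbroken length after \<open>k\<close> breaks has expectation \<open>r ^ k\<close>
  with \<open>r < 1\<close>. The sum over \<open>k\<close> has finite expectation, hence is finite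
  almost surely, and its terms tend to 0.\<close>

lemma AE_proper_sticks:
  assumes n: "1 \<le> n"
  shows "AE U in PiM UNIV (\<lambda>_. beta_law 1 (real n)). proper_sticks U"
proof -
  let ?\<beta> = "beta_law 1 (real n)"
  let ?P = "PiM (UNIV :: nat set) (\<lambda>_. ?\<beta>)"
  have \<beta>: "prob_space ?\<beta>" by (rule prob_space_beta_law_1[OF n])
  interpret P: prob_space ?P by (rule prob_space_PiM[OF \<beta>])
  have "AE U in ?P. 0 < U i \<and> U i < 1" for i
    by (rule AE_PiM_component[where P = "\<lambda>y. 0 < y \<and> y < 1"]) (use \<beta> AE_beta_law_1 in auto)
  then have range: "AE U in ?P. \<forall>i. 0 < U i \<and> U i < 1" by (simp add: AE_all_countable)
  define r where "r = (\<integral>\<^sup>+y. ennreal (1 - y) \<partial>?\<beta>)"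
  have r: "r < 1" unfolding r_def by (rule beta_law_1_mean_complement[OF n])
  have meas [measurable]: "(\<lambda>U. \<Prod>j<k. ennreal (1 - U j)) \<in> borel_measurable ?P" for k by measurable
  have moment: "(\<integral>\<^sup>+U. (\<Prod>j<k. ennreal (1 - U j)) \<partial>?P) = r ^ k" for k
    unfolding r_def by (rule nn_integral_PiM_prod_lessThan[OF \<beta>]) simp
  have "(\<integral>\<^sup>+U. (\<Sum>k. \<Prod>j<k. ennreal (1 - U j)) \<partial>?P) = (\<Sum>k. r ^ k)"
    by (subst nn_integral_suminf) (auto simp: moment)
  also have "\<dots> \<noteq> \<infinity>"
  proof -
    obtain q where q: "r = ennreal q" "0 \<le> q" "q < 1"
      using r by (cases r) (auto simp: ennreal_less_one_iff)
    have "(\<Sum>k. r ^ k) = (\<Sum>k. ennreal (q ^ k))" using q by (simp add: ennreal_power)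
    also have "\<dots> \<noteq> \<infinity>"
      unfolding infinity_ennreal_def using q by (intro ennreal_suminf_neq_top summable_geometric) auto
    finally show ?thesis .
  qed
  finally have "AE U in ?P. (\<Sum>k. \<Prod>j<k. ennreal (1 - U j)) \<noteq> \<infinity>"
    by (intro nn_integral_noteq_infinite) auto
  with range show ?thesis
  proof eventually_elim
    case (elim U)
    have "(\<Prod>j<k. ennreal (1 - U j)) = ennreal (\<Prod>j<k. 1 - U j)" for k
      using elim(1) by (intro prod_ennreal) (auto simp: less_imp_le)
    then have "(\<Sum>k. ennreal (\<Prod>j<k. 1 - U j)) \<noteq> top" using elim(2) by simp
    moreover have "0 \<le> (\<Prod>j<k. 1 - U j)" for k using elim(1) by (intro prod_nonneg) (auto simp: less_imp_le)
    ultimately have "summable (\<lambda>k. \<Prod>j<k. 1 - U j)" by (intro summable_suminf_not_top)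
    then show ?case using elim(1) summable_LIMSEQ_zero by (auto simp: proper_sticks_def)
  qed
qed

text \<open>Independence of the two sequences is stated over the bare sigma-algebras, while the law
  of each is a product of the marginal laws; admitting any \<open>N\<close> with the same sets
  reconciles the two.\<close>

lemma iid_with_law_distr:
  assumes P: "prob_space P" and iid: "iid_with_law P \<mu> X" and N: "sets N = sets \<mu>"
  shows "(\<lambda>\<omega> i. X i \<omega>) \<in> P \<rightarrow>\<^sub>M PiM UNIV (\<lambda>_. N)"
    and "distr P (PiM UNIV (\<lambda>_. N)) (\<lambda>\<omega> i. X i \<omega>) = PiM UNIV (\<lambda>_. \<mu>)"
proof -
  interpret prob_space P by (rule P)
  have indep: "indep_vars (\<lambda>_. \<mu>) X UNIV" and law: "\<And>i. distr P \<mu> (X i) = \<mu>"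
    using iid by (auto simp: iid_with_law_def)
  have rv: "X i \<in> P \<rightarrow>\<^sub>M \<mu>" for i using indep by (simp add: indep_vars_def2)
  have sets: "sets (PiM (UNIV :: nat set) (\<lambda>_. N)) = sets (PiM UNIV (\<lambda>_. \<mu>))"
    by (intro sets_PiM_cong N refl)
  have "(\<lambda>\<omega> i. X i \<omega>) \<in> P \<rightarrow>\<^sub>M PiM UNIV (\<lambda>_. \<mu>)"
    using rv by (intro measurable_PiM_single') (auto simp: PiE_iff dest: measurable_space)
  then show "(\<lambda>\<omega> i. X i \<omega>) \<in> P \<rightarrow>\<^sub>M PiM UNIV (\<lambda>_. N)"
    using measurable_cong_sets[OF refl sets] by blast
  have "distr P (PiM UNIV (\<lambda>_. N)) (\<lambda>\<omega> i. X i \<omega>) = distr P (PiM UNIV (\<lambda>_. \<mu>)) (\<lambda>\<omega> i. X i \<omega>)"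
    by (intro distr_cong sets refl)
  also have "\<dots> = distr P (PiM UNIV (\<lambda>_. \<mu>)) (\<lambda>\<omega>. \<lambda>i\<in>UNIV. X i \<omega>)" by (simp add: restrict_def)
  also have "\<dots> = PiM UNIV (\<lambda>i. distr P \<mu> (X i))"
    by (rule indep_vars_iff_distr_eq_PiM[THEN iffD1]) (use indep rv in auto)
  finally show "distr P (PiM UNIV (\<lambda>_. N)) (\<lambda>\<omega> i. X i \<omega>) = PiM UNIV (\<lambda>_. \<mu>)"
    by (simp add: law)
qed

text \<open>Peeling off the first atom and the first stick, and integrating the stick first, splits
  off \<open>1 / h x\<close>; what is left is the moment of order \<open>n\<close> of a copy of the
  whole process.\<close>

lemma stick_measure_inverse_moment_recursion:
  fixes h :: "real \<Rightarrow> real"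
  assumes \<nu>: "\<nu> \<in> M1" and n: "1 \<le> n" and h: "continuous_on S01 h" "\<And>x. x \<in> S01 \<Longrightarrow> 0 < h x"
  defines "A \<equiv> PiM (UNIV :: nat set) (\<lambda>_. \<nu>)" and "B \<equiv> PiM (UNIV :: nat set) (\<lambda>_. beta_law 1 (real n))"
  defines "G \<equiv> \<lambda>k p. ennreal (1 / integral\<^sup>L (stick_measure (snd p) (fst p)) h ^ k)"
  shows "(\<integral>\<^sup>+p. G (Suc n) p \<partial>(A \<Otimes>\<^sub>M B)) = (\<integral>\<^sup>+x. ennreal (1 / h x) \<partial>\<nu>) * (\<integral>\<^sup>+p. G n p \<partial>(A \<Otimes>\<^sub>M B))"
proof -
  let ?\<beta> = "beta_law 1 (real n)"
  have \<beta>: "prob_space ?\<beta>" by (rule prob_space_beta_law_1[OF n])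
  have \<nu>': "prob_space \<nu>" by (rule M1_prob_space[OF \<nu>])
  interpret \<beta>: prob_space ?\<beta> by (rule \<beta>)
  interpret A: prob_space A unfolding A_def by (rule prob_space_PiM[OF \<nu>'])
  interpret B: prob_space B unfolding B_def by (rule prob_space_PiM[OF \<beta>])
  interpret \<beta>B: pair_sigma_finite ?\<beta> B ..
  have sets_\<nu>: "sets \<nu> = sets borel_S01" using \<nu> by (simp add: M1_iff)
  have A_S01: "\<xi> i \<in> S01" if "\<xi> \<in> space A" for \<xi> i
    using that M1_space[OF \<nu>] by (auto simp: A_def space_PiM PiE_iff)
  have proper: "AE U in B. proper_sticks U" unfolding B_def by (rule AE_proper_sticks[OF n])
  have mean_meas: "(\<lambda>p. integral\<^sup>L (stick_measure (snd p) (fst p)) h) \<in> borel_measurable (A \<Otimes>\<^sub>M B)"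
  proof (rule borel_measurable_stick_measure_mean[OF _ _ h(1)])
    show "(\<lambda>p. snd p i) \<in> borel_measurable (A \<Otimes>\<^sub>M B)" for i unfolding B_def by measurable
    have "(\<lambda>p. fst p i) \<in> A \<Otimes>\<^sub>M B \<rightarrow>\<^sub>M \<nu>" for i unfolding A_def by measurable
    then show "(\<lambda>p. fst p i) \<in> A \<Otimes>\<^sub>M B \<rightarrow>\<^sub>M borel_S01" for i
      using measurable_cong_sets[OF refl sets_\<nu>] by blast
  qed
  then have G_meas: "G k \<in> borel_measurable (A \<Otimes>\<^sub>M B)" for k unfolding G_def by measurable
  \<comment> \<open>Here the atoms are fixed, with \<open>x\<close> in front, and only the stick
    sequence is averaged; the average over the atoms follows at the end.\<close>
  have step: "(\<integral>\<^sup>+U. G (Suc n) (case_nat x \<xi>, U) \<partial>B) = ennreal (1 / h x) * (\<integral>\<^sup>+U. G n (\<xi>, U) \<partial>B)"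
    if x: "x \<in> S01" and \<xi>: "\<xi> \<in> space A" for x \<xi>
  proof -
    let ?m = "\<lambda>U. integral\<^sup>L (stick_measure U \<xi>) h"
    have x\<xi>: "case_nat x \<xi> \<in> space A"
      using x \<xi> M1_space[OF \<nu>] by (auto simp: A_def space_PiM PiE_iff split: nat.split)
    have [measurable]: "?m \<in> borel_measurable B"
      using measurable_compose[OF measurable_Pair1'[OF \<xi>] mean_meas] by simp
    have m_pos: "AE U in B. 0 < ?m U"
      using proper
    proof eventually_elim
      case (elim U)
      show ?case by (intro M1_integral_pos[OF stick_measure_in_M1[OF elim]] h A_S01[OF \<xi>])
    qed
    have "(\<integral>\<^sup>+U. G (Suc n) (case_nat x \<xi>, U) \<partial>B)
        = (\<integral>\<^sup>+y. \<integral>\<^sup>+U. G (Suc n) (case_nat x \<xi>, case_nat y U) \<partial>B \<partial>?\<beta>)"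
      unfolding B_def
      by (rule nn_integral_PiM_case_nat[OF \<beta>])
        (rule measurable_compose[OF measurable_Pair1'[OF x\<xi>] G_meas, unfolded B_def])
    also have "\<dots> = (\<integral>\<^sup>+y. \<integral>\<^sup>+U. ennreal (1 / (y * h x + (1 - y) * ?m U) ^ Suc n) \<partial>B \<partial>?\<beta>)"
    proof (rule nn_integral_cong_AE)
      show "AE y in ?\<beta>. (\<integral>\<^sup>+U. G (Suc n) (case_nat x \<xi>, case_nat y U) \<partial>B)
          = (\<integral>\<^sup>+U. ennreal (1 / (y * h x + (1 - y) * ?m U) ^ Suc n) \<partial>B)"
        using AE_beta_law_1
      proof eventually_elim
        case y: (elim y)
        show ?case
        proof (rule nn_integral_cong_AE)
          show "AE U in B. G (Suc n) (case_nat x \<xi>, case_nat y U)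
              = ennreal (1 / (y * h x + (1 - y) * ?m U) ^ Suc n)"
            using proper
          proof eventually_elim
            case (elim U)
            show ?case unfolding G_def
              using stick_measure_mean_case_nat[OF elim A_S01[OF \<xi>] h(1) _ _ x] y by simp
          qed
        qed
      qed
    qed
    \<comment> \<open>Fubini brings the first stick \<open>y\<close> innermost, where the Beta
      integral applies with \<open>c = h x\<close> and \<open>m\<close> the mean of the remaining
      process.\<close>
    also have "\<dots> = (\<integral>\<^sup>+U. \<integral>\<^sup>+y. ennreal (1 / (y * h x + (1 - y) * ?m U) ^ Suc n) \<partial>?\<beta> \<partial>B)"
      by (rule \<beta>B.Fubini'[symmetric]) measurable
    also have "\<dots> = (\<integral>\<^sup>+U. ennreal (1 / h x) * G n (\<xi>, U) \<partial>B)"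
    proof (rule nn_integral_cong_AE)
      show "AE U in B. (\<integral>\<^sup>+y. ennreal (1 / (y * h x + (1 - y) * ?m U) ^ Suc n) \<partial>?\<beta>) = ennreal (1 / h x) * G n (\<xi>, U)"
        using m_pos
      proof eventually_elim
        case (elim U)
        have "(\<integral>\<^sup>+y. ennreal (1 / (y * h x + (1 - y) * ?m U) ^ Suc n) \<partial>?\<beta>) = ennreal (1 / h x * (1 / ?m U ^ n))"
          by (rule nn_integral_beta_law_inverse_power[OF n h(2)[OF x] elim])
        then show ?case
          using h(2)[OF x] elim by (simp only: G_def fst_conv snd_conv) (subst ennreal_mult[symmetric]; simp)
      qed
    qed
    also have "\<dots> = ennreal (1 / h x) * (\<integral>\<^sup>+U. G n (\<xi>, U) \<partial>B)"
      by (rule nn_integral_cmult) (rule measurable_compose[OF measurable_Pair1'[OF \<xi>] G_meas])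
    finally show ?thesis .
  qed
  have inner_meas: "(\<lambda>\<xi>. \<integral>\<^sup>+U. G k (\<xi>, U) \<partial>B) \<in> borel_measurable A" for k
    by (rule B.borel_measurable_nn_integral_fst[OF G_meas])
  have "(\<integral>\<^sup>+p. G (Suc n) p \<partial>(A \<Otimes>\<^sub>M B)) = (\<integral>\<^sup>+\<xi>. \<integral>\<^sup>+U. G (Suc n) (\<xi>, U) \<partial>B \<partial>A)"
    by (rule B.nn_integral_fst[OF G_meas, symmetric])
  also have "\<dots> = (\<integral>\<^sup>+x. \<integral>\<^sup>+\<xi>. \<integral>\<^sup>+U. G (Suc n) (case_nat x \<xi>, U) \<partial>B \<partial>A \<partial>\<nu>)"
    unfolding A_def by (rule nn_integral_PiM_case_nat[OF \<nu>' inner_meas[unfolded A_def]])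
  also have "\<dots> = (\<integral>\<^sup>+x. \<integral>\<^sup>+\<xi>. ennreal (1 / h x) * (\<integral>\<^sup>+U. G n (\<xi>, U) \<partial>B) \<partial>A \<partial>\<nu>)"
    using M1_space[OF \<nu>] by (intro nn_integral_cong step) auto
  also have "\<dots> = (\<integral>\<^sup>+x. ennreal (1 / h x) * (\<integral>\<^sup>+\<xi>. \<integral>\<^sup>+U. G n (\<xi>, U) \<partial>B \<partial>A) \<partial>\<nu>)"
    by (intro nn_integral_cong nn_integral_cmult inner_meas)
  also have "\<dots> = (\<integral>\<^sup>+x. ennreal (1 / h x) \<partial>\<nu>) * (\<integral>\<^sup>+\<xi>. \<integral>\<^sup>+U. G n (\<xi>, U) \<partial>B \<partial>A)"
    using M1_borel_measurable[OF \<nu> h(1)] by (intro nn_integral_multc) measurable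
  also have "(\<integral>\<^sup>+\<xi>. \<integral>\<^sup>+U. G n (\<xi>, U) \<partial>B \<partial>A) = (\<integral>\<^sup>+p. G n p \<partial>(A \<Otimes>\<^sub>M B))"
    by (rule B.nn_integral_fst[OF G_meas])
  finally show ?thesis .
qed

lemma dirichlet_processE:
  assumes \<nu>: "\<nu> \<in> M1" and n: "1 \<le> n" and V: "dirichlet_process P (real n) \<nu> V"
  obtains \<xi> U where "prob_space P" "iid_with_law P \<nu> \<xi>" "iid_with_law P (beta_law 1 (real n)) U"
    "prob_space.indep_var P (PiM UNIV (\<lambda>_. borel_S01)) (\<lambda>\<omega> i. \<xi> i \<omega>) (PiM UNIV (\<lambda>_. borel)) (\<lambda>\<omega> i. U i \<omega>)"
    "\<And>\<omega>. \<omega> \<in> space P \<Longrightarrow> V \<omega> = stick_measure (\<lambda>i. U i \<omega>) (\<lambda>i. \<xi> i \<omega>)"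
    "\<And>i. \<xi> i \<in> P \<rightarrow>\<^sub>M borel_S01" "\<And>i. U i \<in> borel_measurable P"
    "\<And>i \<omega>. \<omega> \<in> space P \<Longrightarrow> \<xi> i \<omega> \<in> S01" "AE \<omega> in P. proper_sticks (\<lambda>i. U i \<omega>)"
proof -
  have P: "prob_space P" using V by (simp add: dirichlet_process_def)
  obtain \<xi> U where \<xi>: "iid_with_law P \<nu> \<xi>" and U: "iid_with_law P (beta_law 1 (real n)) U"
    and indep: "prob_space.indep_var P (PiM UNIV (\<lambda>_. borel_S01)) (\<lambda>\<omega> i. \<xi> i \<omega>) (PiM UNIV (\<lambda>_. borel)) (\<lambda>\<omega> i. U i \<omega>)"
    and V_eq: "\<And>\<omega>. \<omega> \<in> space P \<Longrightarrow> V \<omega> = stick_measure (\<lambda>i. U i \<omega>) (\<lambda>i. \<xi> i \<omega>)"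
    using V unfolding dirichlet_process_def by blast
  have sets_\<nu>: "sets borel_S01 = sets \<nu>" using \<nu> by (simp add: M1_iff)
  note law_\<xi> = iid_with_law_distr[OF P \<xi> sets_\<nu>]
  note law_U = iid_with_law_distr[OF P U sets_beta_law[symmetric]]
  have comp: "\<xi> i \<in> P \<rightarrow>\<^sub>M borel_S01" "U i \<in> borel_measurable P" for i
    using measurable_compose[OF law_\<xi>(1) measurable_component_singleton[of i]]
      measurable_compose[OF law_U(1) measurable_component_singleton[of i]] by simp_all
  have \<xi>_S01: "\<xi> i \<omega> \<in> S01" if "\<omega> \<in> space P" for i \<omega>
    using measurable_space[OF comp(1) that] by (simp add: space_restrict_space)
  have "AE u in distr P (PiM UNIV (\<lambda>_. borel)) (\<lambda>\<omega> i. U i \<omega>). proper_sticks u"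
    unfolding law_U(2) by (rule AE_proper_sticks[OF n])
  then have "AE \<omega> in P. proper_sticks (\<lambda>i. U i \<omega>)"
    by (rule AE_distrD[OF law_U(1)])
  with P \<xi> U indep V_eq comp \<xi>_S01 show ?thesis using that by blast
qed

text \<open>Independence makes the joint law of atoms and sticks a product measure, so the recursion
  proved there carries over to \<open>P\<close> and yields the moment formula.\<close>

lemma dirichlet_process_mean:
  assumes \<nu>: "\<nu> \<in> M1" and n: "1 \<le> n" and V: "dirichlet_process P (real n) \<nu> V"
  shows "prob_space P" and "AE \<omega> in P. V \<omega> \<in> M1"
    and "\<And>h :: real \<Rightarrow> real. continuous_on S01 h \<Longrightarrow> (\<lambda>\<omega>. integral\<^sup>L (V \<omega>) h) \<in> borel_measurable P"
    and "\<And>h :: real \<Rightarrow> real. \<lbrakk>continuous_on S01 h; \<And>x. x \<in> S01 \<Longrightarrow> 0 < h x\<rbrakk> \<Longrightarrow>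
      (\<integral>\<omega>. 1 / integral\<^sup>L (V \<omega>) h ^ n \<partial>P) = exp (- real n * (\<integral>x. ln (h x) \<partial>\<nu>))"
proof -
  obtain \<xi> U where P: "prob_space P" and \<xi>: "iid_with_law P \<nu> \<xi>" and U: "iid_with_law P (beta_law 1 (real n)) U"
    and indep: "prob_space.indep_var P (PiM UNIV (\<lambda>_. borel_S01)) (\<lambda>\<omega> i. \<xi> i \<omega>) (PiM UNIV (\<lambda>_. borel)) (\<lambda>\<omega> i. U i \<omega>)"
    and V_eq: "\<And>\<omega>. \<omega> \<in> space P \<Longrightarrow> V \<omega> = stick_measure (\<lambda>i. U i \<omega>) (\<lambda>i. \<xi> i \<omega>)"
    and comp: "\<And>i. \<xi> i \<in> P \<rightarrow>\<^sub>M borel_S01" "\<And>i. U i \<in> borel_measurable P"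
    and \<xi>_S01: "\<And>i \<omega>. \<omega> \<in> space P \<Longrightarrow> \<xi> i \<omega> \<in> S01" and proper: "AE \<omega> in P. proper_sticks (\<lambda>i. U i \<omega>)"
    by (rule dirichlet_processE[OF \<nu> n V]) blast
  show "prob_space P" by (rule P)
  interpret prob_space P by (rule P)
  have sets_\<nu>: "sets borel_S01 = sets \<nu>" using \<nu> by (simp add: M1_iff)
  note law_\<xi> = iid_with_law_distr[OF P \<xi> sets_\<nu>]
  note law_U = iid_with_law_distr[OF P U sets_beta_law[symmetric]]
  define A where "A = PiM (UNIV :: nat set) (\<lambda>_. \<nu>)"
  define B where "B = PiM (UNIV :: nat set) (\<lambda>_. beta_law 1 (real n))"
  let ?pair = "\<lambda>\<omega>. (\<lambda>i. \<xi> i \<omega>, \<lambda>i. U i \<omega>)"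
  have joint: "distr P (PiM UNIV (\<lambda>_. borel_S01) \<Otimes>\<^sub>M PiM UNIV (\<lambda>_. borel)) ?pair = A \<Otimes>\<^sub>M B"
    using indep law_\<xi>(2) law_U(2) unfolding indep_var_distribution_eq A_def B_def by simp
  from proper show V_M1: "AE \<omega> in P. V \<omega> \<in> M1"
    using AE_space
  proof eventually_elim
    case (elim \<omega>)
    then show ?case unfolding V_eq[OF elim(2)] by (intro stick_measure_in_M1 \<xi>_S01)
  qed
  show meas: "(\<lambda>\<omega>. integral\<^sup>L (V \<omega>) h) \<in> borel_measurable P" if "continuous_on S01 h" for h :: "real \<Rightarrow> real"
    using borel_measurable_stick_measure_mean[of "\<lambda>\<omega> i. U i \<omega>" P "\<lambda>\<omega> i. \<xi> i \<omega>", OF comp(2,1) that]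
    by (subst measurable_cong[where g = "\<lambda>\<omega>. integral\<^sup>L (stick_measure (\<lambda>i. U i \<omega>) (\<lambda>i. \<xi> i \<omega>)) h"])
      (simp_all add: V_eq)
  show "(\<integral>\<omega>. 1 / integral\<^sup>L (V \<omega>) h ^ n \<partial>P) = exp (- real n * (\<integral>x. ln (h x) \<partial>\<nu>))"
    if "continuous_on S01 h" "\<And>x. x \<in> S01 \<Longrightarrow> 0 < h x" for h :: "real \<Rightarrow> real"
  proof (rule inverse_moment_of_recursion[OF P \<nu> V_M1 meas _ that])
    fix h :: "real \<Rightarrow> real" assume h: "continuous_on S01 h" "\<And>x. x \<in> S01 \<Longrightarrow> 0 < h x"
    define G where "G k p = ennreal (1 / integral\<^sup>L (stick_measure (snd p) (fst p)) h ^ k)" for k p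
    have [measurable]: "(\<lambda>\<omega>. integral\<^sup>L (V \<omega>) h) \<in> borel_measurable P" by (rule meas[OF h(1)])
    have G_meas: "G k \<in> borel_measurable (PiM UNIV (\<lambda>_. borel_S01) \<Otimes>\<^sub>M PiM UNIV (\<lambda>_. borel))" for k
    proof -
      have "(\<lambda>p. integral\<^sup>L (stick_measure (snd p) (fst p)) h)
          \<in> borel_measurable (PiM UNIV (\<lambda>_. borel_S01) \<Otimes>\<^sub>M PiM UNIV (\<lambda>_. borel))"
        by (rule borel_measurable_stick_measure_mean[OF _ _ h(1)]) measurable
      then show ?thesis unfolding G_def by measurable
    qed
    have moment: "(\<integral>\<omega>. 1 / integral\<^sup>L (V \<omega>) h ^ k \<partial>P) = enn2real (\<integral>\<^sup>+p. G k p \<partial>(A \<Otimes>\<^sub>M B))" for k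
    proof -
      have "AE \<omega> in P. 0 \<le> 1 / integral\<^sup>L (V \<omega>) h ^ k"
        using V_M1
      proof eventually_elim
        case (elim \<omega>)
        have "0 < integral\<^sup>L (V \<omega>) h" by (rule M1_integral_pos[OF elim h])
        then show ?case by simp
      qed
      then have "(\<integral>\<omega>. 1 / integral\<^sup>L (V \<omega>) h ^ k \<partial>P) = enn2real (\<integral>\<^sup>+\<omega>. ennreal (1 / integral\<^sup>L (V \<omega>) h ^ k) \<partial>P)"
        by (intro integral_eq_nn_integral) measurable
      also have "(\<integral>\<^sup>+\<omega>. ennreal (1 / integral\<^sup>L (V \<omega>) h ^ k) \<partial>P) = (\<integral>\<^sup>+\<omega>. G k (?pair \<omega>) \<partial>P)"
        by (intro nn_integral_cong) (simp add: G_def V_eq)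
      also have "\<dots> = (\<integral>\<^sup>+p. G k p \<partial>(A \<Otimes>\<^sub>M B))"
        unfolding joint[symmetric]
        by (rule nn_integral_distr[OF measurable_Pair[OF law_\<xi>(1) law_U(1)], symmetric]) (simp add: G_meas)
      finally show ?thesis .
    qed
    have inv: "continuous_on S01 (\<lambda>x. 1 / h x)" using h by (intro continuous_intros) force+
    have "(\<integral>x. 1 / h x \<partial>\<nu>) = enn2real (\<integral>\<^sup>+x. ennreal (1 / h x) \<partial>\<nu>)"
      using h(2) M1_space[OF \<nu>] by (intro integral_eq_nn_integral M1_borel_measurable \<nu> inv AE_I2) (auto simp: less_imp_le)
    moreover have "(\<integral>\<^sup>+p. G (Suc n) p \<partial>(A \<Otimes>\<^sub>M B)) = (\<integral>\<^sup>+x. ennreal (1 / h x) \<partial>\<nu>) * (\<integral>\<^sup>+p. G n p \<partial>(A \<Otimes>\<^sub>M B))"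
      unfolding A_def B_def G_def by (rule stick_measure_inverse_moment_recursion[OF \<nu> n h])
    \<comment> \<open>\<open>enn2real\<close> is multiplicative even at infinity, so the recursion
      passes to real integrals directly.\<close>
    ultimately show "(\<integral>\<omega>. 1 / integral\<^sup>L (V \<omega>) h ^ Suc n \<partial>P) = (\<integral>x. 1 / h x \<partial>\<nu>) * (\<integral>\<omega>. 1 / integral\<^sup>L (V \<omega>) h ^ n \<partial>P)"
      unfolding moment by (simp add: enn2real_mult)
  qed
qed

section \<open>Dirichlet weights\<close>

abbreviation expo :: "real measure" where
  "expo \<equiv> density lborel (\<lambda>x. ennreal (exponential_density 1 x))"

interpretation expo: prob_space expo
  by (rule prob_space_exponential_density) simp

interpretation expo_prod: product_prob_space "\<lambda>_ :: nat. expo" I for I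
  by (rule product_prob_spaceI) (rule expo.prob_space_axioms)

lemma AE_expo_pos: "AE x in expo. 0 < x"
proof (subst AE_density)
  show "AE x in lborel. 0 < ennreal (exponential_density 1 x) \<longrightarrow> 0 < x"
    using AE_lborel_singleton[of 0] by eventually_elim (auto simp: exponential_density_def)
qed simp

lemma AE_PiM_expo_pos:
  assumes "finite I"
  shows "AE e in PiM I (\<lambda>_ :: nat. expo). \<forall>i\<in>I. 0 < e i"
  by (intro AE_finite_allI assms AE_PiM_component AE_expo_pos expo.prob_space_axioms)

text \<open>Against the exponential density the integrand is a multiple of an Erlang density, whose
  total mass is one.\<close>

lemma nn_integral_expo_gamma:
  assumes a: "0 < a"
  shows "(\<integral>\<^sup>+x. ennreal (x ^ k * exp ((1 - a) * x)) \<partial>expo) = ennreal (fact k / a ^ Suc k)"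
proof -
  interpret erlang: prob_space "density lborel (erlang_density k a)" by (rule prob_space_erlang_density[OF a])
  have "(\<integral>\<^sup>+x. ennreal (x ^ k * exp ((1 - a) * x)) \<partial>expo)
      = (\<integral>\<^sup>+x. ennreal (exponential_density 1 x) * ennreal (x ^ k * exp ((1 - a) * x)) \<partial>lborel)"
    by (subst nn_integral_density) auto
  also have "\<dots> = (\<integral>\<^sup>+x. ennreal (fact k / a ^ Suc k) * ennreal (erlang_density k a x) \<partial>lborel)"
  proof (intro nn_integral_cong)
    fix x :: real
    have "exp (- x) * exp ((1 - a) * x) = exp (- a * x)"
      by (simp add: exp_add[symmetric] algebra_simps)
    then show "ennreal (exponential_density 1 x) * ennreal (x ^ k * exp ((1 - a) * x))
        = ennreal (fact k / a ^ Suc k) * ennreal (erlang_density k a x)"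
      using a by (simp add: exponential_density_def erlang_density_def ennreal_mult'[symmetric] ac_simps del: power_Suc)
  qed
  also have "\<dots> = ennreal (fact k / a ^ Suc k)"
    using erlang.emeasure_space_1 by (simp add: nn_integral_cmult emeasure_density)
  finally show ?thesis .
qed

lemma nn_integral_expo_gamma_cmult:
  assumes "0 < a"
  shows "(\<integral>\<^sup>+x. C * ennreal (x ^ k * exp ((1 - a) * x)) \<partial>expo) = C * ennreal (fact k / a ^ Suc k)"
proof -
  have "(\<lambda>x. ennreal (x ^ k * exp ((1 - a) * x))) \<in> borel_measurable expo" by measurable
  then show ?thesis by (simp only: nn_integral_cmult nn_integral_expo_gamma[OF assms])
qed

text \<open>Substitution by the factor \<open>r\<close>: the Jacobian is \<open>r\<close>, and the
  ratio of \<open>exp (- (r * x))\<close> to \<open>exp (- x)\<close> is the exponential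
  factor.\<close>

lemma nn_integral_expo_scale:
  fixes f :: "real \<Rightarrow> ennreal"
  assumes [measurable]: "f \<in> borel_measurable borel" and r: "0 < r"
  shows "(\<integral>\<^sup>+x. f x \<partial>expo) = ennreal r * (\<integral>\<^sup>+x. f (r * x) * ennreal (exp ((1 - r) * x)) \<partial>expo)"
proof -
  have "(\<integral>\<^sup>+x. f x \<partial>expo) = (\<integral>\<^sup>+x. ennreal (exponential_density 1 x) * f x \<partial>lborel)"
    by (subst nn_integral_density) auto
  also have "\<dots> = ennreal r * (\<integral>\<^sup>+x. ennreal (exponential_density 1 (r * x)) * f (r * x) \<partial>lborel)"
    using r by (subst nn_integral_real_affine[where t = 0 and c = r]) auto
  also have "(\<integral>\<^sup>+x. ennreal (exponential_density 1 (r * x)) * f (r * x) \<partial>lborel)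
      = (\<integral>\<^sup>+x. ennreal (exponential_density 1 x) * (f (r * x) * ennreal (exp ((1 - r) * x))) \<partial>lborel)"
  proof (intro nn_integral_cong)
    fix x :: real
    have "exp (- (r * x)) = exp (- x) * exp ((1 - r) * x)"
      by (simp add: exp_add[symmetric] algebra_simps)
    then have "exponential_density 1 (r * x) = exponential_density 1 x * exp ((1 - r) * x)"
      using r by (simp add: exponential_density_def mult_less_0_iff)
    then show "ennreal (exponential_density 1 (r * x)) * f (r * x)
        = ennreal (exponential_density 1 x) * (f (r * x) * ennreal (exp ((1 - r) * x)))"
      by (simp add: ennreal_mult' mult_ac)
  qed
  also have "\<dots> = (\<integral>\<^sup>+x. f (r * x) * ennreal (exp ((1 - r) * x)) \<partial>expo)"
    by (subst nn_integral_density) auto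
  finally show ?thesis .
qed

lemma nn_integral_PiM_expo_scale:
  fixes f :: "(nat \<Rightarrow> real) \<Rightarrow> ennreal"
  assumes "finite I" and r: "0 < r" and "f \<in> borel_measurable (PiM I (\<lambda>_. expo))"
  shows "(\<integral>\<^sup>+e. f e \<partial>PiM I (\<lambda>_. expo))
    = ennreal (r ^ card I) * (\<integral>\<^sup>+e. f (\<lambda>i\<in>I. r * e i) * ennreal (exp ((1 - r) * (\<Sum>i\<in>I. e i))) \<partial>PiM I (\<lambda>_. expo))"
  using assms(1,3)
proof (induction I arbitrary: f)
  case empty
  show ?case by (simp add: PiM_empty nn_integral_count_space_finite)
next
  case (insert i I)
  have f [measurable]: "f \<in> borel_measurable (PiM (insert i I) (\<lambda>_. expo))" by (rule insert.prems)
  note [simp] = insert.hyps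
  let ?E = "PiM I (\<lambda>_ :: nat. expo)"
  have f_upd: "(\<lambda>y. f (x(i := y))) \<in> borel_measurable borel" if "x \<in> space ?E" for x
  proof -
    have "(\<lambda>y. x(i := y)) \<in> expo \<rightarrow>\<^sub>M PiM (insert i I) (\<lambda>_. expo)"
      using measurable_compose[OF measurable_Pair1'[OF that] measurable_add_dim] by simp
    from measurable_compose[OF this f] show ?thesis by simp
  qed
  define g where "g x = (\<integral>\<^sup>+y. f (x(i := r * y)) * ennreal (exp ((1 - r) * y)) \<partial>expo)" for x
  have upd_scale: "(\<lambda>(x, y). x(i := r * y)) \<in> ?E \<Otimes>\<^sub>M expo \<rightarrow>\<^sub>M PiM (insert i I) (\<lambda>_. expo)"
  proof -
    have "(\<lambda>p. (fst p, r * snd p)) \<in> ?E \<Otimes>\<^sub>M expo \<rightarrow>\<^sub>M ?E \<Otimes>\<^sub>M expo" by measurable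
    from measurable_compose[OF this measurable_add_dim[of i I "\<lambda>_. expo"]] show ?thesis
      by (simp add: case_prod_unfold)
  qed
  have "(\<lambda>p. f ((fst p)(i := r * snd p)) * ennreal (exp ((1 - r) * snd p))) \<in> borel_measurable (?E \<Otimes>\<^sub>M expo)"
    using measurable_compose[OF upd_scale f] by (simp add: case_prod_unfold)
  from expo.borel_measurable_nn_integral_fst[OF this]
  have g: "g \<in> borel_measurable ?E" by (simp add: g_def[abs_def])
  have "(\<integral>\<^sup>+e. f e \<partial>PiM (insert i I) (\<lambda>_. expo)) = (\<integral>\<^sup>+x. \<integral>\<^sup>+y. f (x(i := y)) \<partial>expo \<partial>?E)"
    by (rule expo_prod.product_nn_integral_insert) auto
  also have "\<dots> = (\<integral>\<^sup>+x. ennreal r * g x \<partial>?E)"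
    unfolding g_def by (intro nn_integral_cong nn_integral_expo_scale f_upd r)
  also have "\<dots> = ennreal r * (\<integral>\<^sup>+x. g x \<partial>?E)" by (rule nn_integral_cmult[OF g])
  also have "\<dots> = ennreal (r * r ^ card I) *
      (\<integral>\<^sup>+x. g (\<lambda>i\<in>I. r * x i) * ennreal (exp ((1 - r) * (\<Sum>i\<in>I. x i))) \<partial>?E)"
    using r by (simp only: insert.IH[OF g] ennreal_mult'[OF less_imp_le[OF r]] mult.assoc)
  also have "(\<integral>\<^sup>+x. g (\<lambda>i\<in>I. r * x i) * ennreal (exp ((1 - r) * (\<Sum>i\<in>I. x i))) \<partial>?E)
      = (\<integral>\<^sup>+x. \<integral>\<^sup>+y. f (\<lambda>j\<in>insert i I. r * (x(i := y)) j) * ennreal (exp ((1 - r) * (\<Sum>j\<in>insert i I. (x(i := y)) j))) \<partial>expo \<partial>?E)"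
  proof (intro nn_integral_cong)
    fix x assume x: "x \<in> space ?E"
    have rx: "(\<lambda>i\<in>I. r * x i) \<in> space ?E" by (simp add: space_PiM)
    have meas: "(\<lambda>y. f ((\<lambda>i\<in>I. r * x i)(i := r * y)) * ennreal (exp ((1 - r) * y))) \<in> borel_measurable expo"
      using measurable_compose[OF _ f_upd[OF rx], of "\<lambda>y. r * y" expo] by simp
    have upd: "(\<lambda>i\<in>I. r * x i)(i := r * y) = (\<lambda>j\<in>insert i I. r * (x(i := y)) j)" for y
      by (auto simp: fun_eq_iff)
    have "(\<Sum>j\<in>I. if j = i then y else x j) = (\<Sum>j\<in>I. x j)" for y
      by (intro sum.cong) auto
    then have sum: "(\<Sum>j\<in>insert i I. (x(i := y)) j) = y + (\<Sum>j\<in>I. x j)" for y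
      by (simp add: fun_upd_def)
    show "g (\<lambda>i\<in>I. r * x i) * ennreal (exp ((1 - r) * (\<Sum>i\<in>I. x i)))
        = (\<integral>\<^sup>+y. f (\<lambda>j\<in>insert i I. r * (x(i := y)) j) * ennreal (exp ((1 - r) * (\<Sum>j\<in>insert i I. (x(i := y)) j))) \<partial>expo)"
      unfolding g_def
      by (subst nn_integral_multc[OF meas, symmetric])
        (simp only: upd sum distrib_left exp_add ennreal_mult'[OF exp_ge_zero] mult.assoc)
  qed
  also have "\<dots> = (\<integral>\<^sup>+e. f (\<lambda>j\<in>insert i I. r * e j) * ennreal (exp ((1 - r) * (\<Sum>j\<in>insert i I. e j))) \<partial>PiM (insert i I) (\<lambda>_. expo))"
  proof (rule expo_prod.product_nn_integral_insert[symmetric])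
    have "(\<lambda>e. \<lambda>j\<in>insert i I. r * e j) \<in> PiM (insert i I) (\<lambda>_. expo) \<rightarrow>\<^sub>M PiM (insert i I) (\<lambda>_. expo)"
      by measurable
    note [measurable] = measurable_compose[OF this f]
    show "(\<lambda>e. f (\<lambda>j\<in>insert i I. r * e j) * ennreal (exp ((1 - r) * (\<Sum>j\<in>insert i I. e j))))
        \<in> borel_measurable (PiM (insert i I) (\<lambda>_. expo))"
      by measurable
  qed auto
  also have "ennreal (r * r ^ card I) = ennreal (r ^ card (insert i I))" by simp
  finally show ?case .
qed

text \<open>Polar coordinates: all variables are measured in units of the last one.\<close>

lemma nn_integral_PiM_expo_polar:
  fixes f :: "(nat \<Rightarrow> real) \<Rightarrow> ennreal"
  assumes f: "f \<in> borel_measurable (PiM {..<Suc k} (\<lambda>_. expo))"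
  shows "(\<integral>\<^sup>+e. f e \<partial>PiM {..<Suc k} (\<lambda>_. expo)) = (\<integral>\<^sup>+e. \<integral>\<^sup>+x.
      ennreal (x ^ k * exp ((1 - x) * (\<Sum>i<k. e i))) * f ((\<lambda>i\<in>{..<k}. x * e i)(k := x)) \<partial>expo \<partial>PiM {..<k} (\<lambda>_. expo))"
proof -
  let ?E = "PiM {..<k} (\<lambda>_ :: nat. expo)"
  interpret E: prob_space ?E by (rule prob_space_PiM) (rule expo.prob_space_axioms)
  interpret pair_sigma_finite expo ?E ..
  have f [measurable]: "f \<in> borel_measurable (PiM (insert k {..<k}) (\<lambda>_. expo))"
    using f by (simp add: lessThan_Suc)
  have "(\<integral>\<^sup>+e. f e \<partial>PiM {..<Suc k} (\<lambda>_. expo)) = (\<integral>\<^sup>+x. \<integral>\<^sup>+e. f (e(k := x)) \<partial>?E \<partial>expo)"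
    unfolding lessThan_Suc by (rule expo_prod.product_nn_integral_insert_rev) auto
  also have "\<dots> = (\<integral>\<^sup>+x. \<integral>\<^sup>+e. ennreal (x ^ k * exp ((1 - x) * (\<Sum>i<k. e i))) * f ((\<lambda>i\<in>{..<k}. x * e i)(k := x)) \<partial>?E \<partial>expo)"
  proof (rule nn_integral_cong_AE)
    show "AE x in expo. (\<integral>\<^sup>+e. f (e(k := x)) \<partial>?E)
        = (\<integral>\<^sup>+e. ennreal (x ^ k * exp ((1 - x) * (\<Sum>i<k. e i))) * f ((\<lambda>i\<in>{..<k}. x * e i)(k := x)) \<partial>?E)"
      using AE_expo_pos
    proof eventually_elim
      case (elim x)
      have "(\<lambda>e. e(k := x)) \<in> ?E \<rightarrow>\<^sub>M PiM (insert k {..<k}) (\<lambda>_. expo)"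
        using measurable_compose[OF measurable_Pair2'[of x expo ?E] measurable_add_dim[of k "{..<k}" "\<lambda>_. expo"]] by simp
      note fx = measurable_compose[OF this f]
      have "(\<lambda>e. \<lambda>i\<in>{..<k}. x * e i) \<in> ?E \<rightarrow>\<^sub>M ?E" by measurable
      note [measurable] = measurable_compose[OF this fx]
      \<comment> \<open>With the last variable fixed at a positive \<open>x\<close>, the other
        \<open>k\<close> variables are rescaled by \<open>x\<close>, with Jacobian
        \<open>x ^ k\<close>.\<close>
      have "(\<integral>\<^sup>+e. f (e(k := x)) \<partial>?E) = ennreal (x ^ k) *
          (\<integral>\<^sup>+e. f ((\<lambda>i\<in>{..<k}. x * e i)(k := x)) * ennreal (exp ((1 - x) * (\<Sum>i<k. e i))) \<partial>?E)"
        using nn_integral_PiM_expo_scale[OF _ elim fx] by simp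
      also have "\<dots> = (\<integral>\<^sup>+e. ennreal (x ^ k) * (f ((\<lambda>i\<in>{..<k}. x * e i)(k := x)) * ennreal (exp ((1 - x) * (\<Sum>i<k. e i)))) \<partial>?E)"
        by (rule nn_integral_cmult[symmetric]) measurable
      also have "\<dots> = (\<integral>\<^sup>+e. ennreal (x ^ k * exp ((1 - x) * (\<Sum>i<k. e i))) * f ((\<lambda>i\<in>{..<k}. x * e i)(k := x)) \<partial>?E)"
        using elim by (simp add: ennreal_mult' mult_ac)
      finally show ?case .
    qed
  qed
  also have "\<dots> = (\<integral>\<^sup>+e. \<integral>\<^sup>+x. ennreal (x ^ k * exp ((1 - x) * (\<Sum>i<k. e i))) * f ((\<lambda>i\<in>{..<k}. x * e i)(k := x)) \<partial>expo \<partial>?E)"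
  proof (rule Fubini'[symmetric])
    have "(\<lambda>p. (\<lambda>i\<in>{..<k}. fst p * snd p i, fst p)) \<in> expo \<Otimes>\<^sub>M ?E \<rightarrow>\<^sub>M ?E \<Otimes>\<^sub>M expo"
      by measurable
    from measurable_compose[OF measurable_compose[OF this measurable_add_dim[of k "{..<k}" "\<lambda>_. expo"]] f]
    have [measurable]: "(\<lambda>p. f ((\<lambda>i\<in>{..<k}. fst p * snd p i)(k := fst p))) \<in> borel_measurable (expo \<Otimes>\<^sub>M ?E)"
      by simp
    show "(\<lambda>(x, e). ennreal (x ^ k * exp ((1 - x) * (\<Sum>i<k. e i))) * f ((\<lambda>i\<in>{..<k}. x * e i)(k := x)))
        \<in> borel_measurable (expo \<Otimes>\<^sub>M ?E)"
      unfolding case_prod_unfold by measurable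
  qed
  finally show ?thesis .
qed

text \<open>Normalized weights are homogeneous of degree 0, so in polar coordinates the radial
  integral is a Gamma integral. The unnormalized product of the \<open>exp ((1 - c i) * e i)\<close>
  gives the same function after radial integration, and its full integral factorizes by
  independence.\<close>

lemma nn_integral_normalized_expo:
  fixes c :: "nat \<Rightarrow> real"
  assumes n: "1 \<le> n" and c: "\<And>i. i < n \<Longrightarrow> 0 < c i"
  shows "(\<integral>\<^sup>+e. ennreal (1 / (\<Sum>i<n. e i / (\<Sum>j<n. e j) * c i) ^ n) \<partial>PiM {..<n} (\<lambda>_. expo))
    = (\<Prod>i<n. ennreal (1 / c i))"
proof -
  obtain k where n_eq: "n = Suc k" using n by (cases n) auto
  let ?E = "PiM {..<k} (\<lambda>_ :: nat. expo)"
  \<comment> \<open>The common value of the two radial integrals, at a fixed direction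
    \<open>e\<close>.\<close>
  define R where "R e = ennreal (exp (\<Sum>i<k. e i) * (fact k / (c k + (\<Sum>i<k. c i * e i)) ^ Suc k))" for e :: "nat \<Rightarrow> real"
  have "(\<integral>\<^sup>+e. ennreal (1 / (\<Sum>i<n. e i / (\<Sum>j<n. e j) * c i) ^ n) \<partial>PiM {..<n} (\<lambda>_. expo)) = (\<integral>\<^sup>+e. R e \<partial>?E)"
    unfolding n_eq
  proof (subst nn_integral_PiM_expo_polar)
    show "(\<integral>\<^sup>+e. \<integral>\<^sup>+x. ennreal (x ^ k * exp ((1 - x) * (\<Sum>i<k. e i))) *
        ennreal (1 / (\<Sum>i<Suc k. ((\<lambda>i\<in>{..<k}. x * e i)(k := x)) i / (\<Sum>j<Suc k. ((\<lambda>i\<in>{..<k}. x * e i)(k := x)) j) * c i) ^ Suc k)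
          \<partial>expo \<partial>?E) = (\<integral>\<^sup>+e. R e \<partial>?E)"
    proof (rule nn_integral_cong_AE)
      show "AE e in ?E. (\<integral>\<^sup>+x. ennreal (x ^ k * exp ((1 - x) * (\<Sum>i<k. e i))) *
        ennreal (1 / (\<Sum>i<Suc k. ((\<lambda>i\<in>{..<k}. x * e i)(k := x)) i / (\<Sum>j<Suc k. ((\<lambda>i\<in>{..<k}. x * e i)(k := x)) j) * c i) ^ Suc k)
          \<partial>expo) = R e"
        using AE_PiM_expo_pos[OF finite_lessThan]
      proof eventually_elim
        case (elim e)
        define P Q where "P = (\<Sum>i<k. e i)" and "Q = (\<Sum>i<k. c i * e i)"
        have P: "0 \<le> P" unfolding P_def using elim by (intro sum_nonneg) (auto simp: less_imp_le)
        have Q: "0 \<le> Q" unfolding Q_def using elim c by (intro sum_nonneg mult_nonneg_nonneg) (auto simp: n_eq less_imp_le)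
        have ck: "0 < c k" using c by (simp add: n_eq)
        \<comment> \<open>The normalization cancels the radius \<open>x\<close> in the weights,
          which leaves a Gamma integral with rate \<open>1 + P\<close>.\<close>
        have "(\<integral>\<^sup>+x. ennreal (x ^ k * exp ((1 - x) * (\<Sum>i<k. e i))) *
            ennreal (1 / (\<Sum>i<Suc k. ((\<lambda>i\<in>{..<k}. x * e i)(k := x)) i / (\<Sum>j<Suc k. ((\<lambda>i\<in>{..<k}. x * e i)(k := x)) j) * c i) ^ Suc k) \<partial>expo)
          = (\<integral>\<^sup>+x. ennreal (exp P * ((1 + P) / (c k + Q)) ^ Suc k) * ennreal (x ^ k * exp ((1 - (1 + P)) * x)) \<partial>expo)"
        proof (rule nn_integral_cong_AE)
          show "AE x in expo. ennreal (x ^ k * exp ((1 - x) * (\<Sum>i<k. e i))) *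
              ennreal (1 / (\<Sum>i<Suc k. ((\<lambda>i\<in>{..<k}. x * e i)(k := x)) i / (\<Sum>j<Suc k. ((\<lambda>i\<in>{..<k}. x * e i)(k := x)) j) * c i) ^ Suc k)
            = ennreal (exp P * ((1 + P) / (c k + Q)) ^ Suc k) * ennreal (x ^ k * exp ((1 - (1 + P)) * x))"
            using AE_expo_pos
          proof eventually_elim
            case x: (elim x)
            let ?e = "(\<lambda>i\<in>{..<k}. x * e i)(k := x)"
            have 1: "(\<Sum>j<Suc k. ?e j) = x * (1 + P)"
              by (simp add: P_def sum_distrib_left distrib_left)
            have "(\<Sum>i<Suc k. ?e i / (x * (1 + P)) * c i) = (\<Sum>i<Suc k. ?e i * c i) / (x * (1 + P))"
              by (simp only: sum_divide_distrib times_divide_eq_left)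
            also have "(\<Sum>i<Suc k. ?e i * c i) = x * (c k + Q)"
              by (simp add: Q_def sum_distrib_left distrib_left mult_ac)
            also have "x * (c k + Q) / (x * (1 + P)) = (c k + Q) / (1 + P)" using x by simp
            finally have 2: "(\<Sum>i<Suc k. ?e i / (\<Sum>j<Suc k. ?e j) * c i) = (c k + Q) / (1 + P)"
              unfolding 1 .
            have "exp ((1 - x) * P) = exp P * exp ((1 - (1 + P)) * x)"
              by (simp add: exp_add[symmetric] algebra_simps)
            moreover have "1 / ((c k + Q) / (1 + P)) ^ Suc k = ((1 + P) / (c k + Q)) ^ Suc k"
              by (simp add: power_divide del: power_Suc)
            ultimately show ?case
              unfolding 2 P_def[symmetric] using x P Q ck
              by (simp add: ennreal_mult'[symmetric] mult_ac del: power_Suc)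
          qed
        qed
        also have "\<dots> = ennreal (exp P * ((1 + P) / (c k + Q)) ^ Suc k) * ennreal (fact k / (1 + P) ^ Suc k)"
          using P by (intro nn_integral_expo_gamma_cmult) simp
        also have "\<dots> = R e"
          using P Q ck by (simp add: R_def P_def[symmetric] Q_def[symmetric] ennreal_mult'[symmetric] power_divide del: power_Suc)
        finally show ?case .
      qed
    qed
  qed measurable
  also have "\<dots> = (\<integral>\<^sup>+e. (\<Prod>i<n. ennreal (exp ((1 - c i) * e i))) \<partial>PiM {..<n} (\<lambda>_. expo))"
    unfolding n_eq
  proof (subst nn_integral_PiM_expo_polar)
    show "(\<integral>\<^sup>+e. R e \<partial>?E) = (\<integral>\<^sup>+e. \<integral>\<^sup>+x. ennreal (x ^ k * exp ((1 - x) * (\<Sum>i<k. e i))) *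
        (\<Prod>i<Suc k. ennreal (exp ((1 - c i) * ((\<lambda>i\<in>{..<k}. x * e i)(k := x)) i))) \<partial>expo \<partial>?E)"
    proof (rule nn_integral_cong_AE)
      show "AE e in ?E. R e = (\<integral>\<^sup>+x. ennreal (x ^ k * exp ((1 - x) * (\<Sum>i<k. e i))) *
        (\<Prod>i<Suc k. ennreal (exp ((1 - c i) * ((\<lambda>i\<in>{..<k}. x * e i)(k := x)) i))) \<partial>expo)"
        using AE_PiM_expo_pos[OF finite_lessThan]
      proof eventually_elim
        case (elim e)
        define P Q where "P = (\<Sum>i<k. e i)" and "Q = (\<Sum>i<k. c i * e i)"
        have Q: "0 \<le> Q" unfolding Q_def using elim c by (intro sum_nonneg mult_nonneg_nonneg) (auto simp: n_eq less_imp_le)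
        have ck: "0 < c k" using c by (simp add: n_eq)
        \<comment> \<open>Without normalization the exponents are linear in the radius and combine
          to the rate \<open>c k + Q\<close>.\<close>
        have "(\<integral>\<^sup>+x. ennreal (x ^ k * exp ((1 - x) * (\<Sum>i<k. e i))) *
            (\<Prod>i<Suc k. ennreal (exp ((1 - c i) * ((\<lambda>i\<in>{..<k}. x * e i)(k := x)) i))) \<partial>expo)
          = (\<integral>\<^sup>+x. ennreal (exp P) * ennreal (x ^ k * exp ((1 - (c k + Q)) * x)) \<partial>expo)"
        proof (rule nn_integral_cong)
          fix x
          let ?e = "(\<lambda>i\<in>{..<k}. x * e i)(k := x)"
          have "(\<Sum>i<Suc k. (1 - c i) * ?e i) = x * (P - Q) + (1 - c k) * x"
            by (simp add: P_def Q_def sum_distrib_left sum_subtractf[symmetric] algebra_simps)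
          then have "(\<Prod>i<Suc k. ennreal (exp ((1 - c i) * ?e i))) = ennreal (exp (x * (P - Q) + (1 - c k) * x))"
            by (simp only: prod_ennreal[OF exp_ge_zero] exp_sum[OF finite_lessThan, symmetric])
          moreover have "exp ((1 - x) * P) * exp (x * (P - Q) + (1 - c k) * x) = exp P * exp ((1 - (c k + Q)) * x)"
            by (simp add: exp_add[symmetric] algebra_simps)
          ultimately show "ennreal (x ^ k * exp ((1 - x) * (\<Sum>i<k. e i))) * (\<Prod>i<Suc k. ennreal (exp ((1 - c i) * ?e i)))
              = ennreal (exp P) * ennreal (x ^ k * exp ((1 - (c k + Q)) * x))"
            unfolding P_def[symmetric] by (simp add: ennreal_mult''[symmetric] ennreal_mult'[symmetric] mult_ac)
        qed
        also have "\<dots> = ennreal (exp P) * ennreal (fact k / (c k + Q) ^ Suc k)"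
          using Q ck by (intro nn_integral_expo_gamma_cmult) simp
        also have "\<dots> = R e"
          by (simp add: R_def P_def[symmetric] Q_def[symmetric] ennreal_mult'[symmetric] del: power_Suc)
        finally show ?case by simp
      qed
    qed
  qed measurable
  also have "\<dots> = (\<Prod>i<n. \<integral>\<^sup>+x. ennreal (exp ((1 - c i) * x)) \<partial>expo)"
    by (rule expo_prod.product_nn_integral_prod) auto
  also have "\<dots> = (\<Prod>i<n. ennreal (1 / c i))"
    using nn_integral_expo_gamma[OF c, of _ 0] by (intro prod.cong) auto
  finally show ?thesis .
qed

lemma sets_dirichlet_ones_law [simp, measurable_cong]:
  "sets (dirichlet_ones_law n) = sets (PiM {..<n} (\<lambda>_. borel))"
  by (simp add: dirichlet_ones_law_def)

lemma measurable_normalize: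
  "(\<lambda>e. \<lambda>i\<in>{..<n}. e i / (\<Sum>j<n. e j)) \<in> PiM {..<n} (\<lambda>_ :: nat. expo) \<rightarrow>\<^sub>M PiM {..<n} (\<lambda>_. borel)"
  by measurable

lemma AE_dirichlet_ones_law:
  assumes n: "1 \<le> n"
  shows "AE x in dirichlet_ones_law n. (\<forall>i<n. 0 \<le> x i) \<and> (\<Sum>i<n. x i) = 1"
  unfolding dirichlet_ones_law_def
proof (subst AE_distr_iff[OF measurable_normalize])
  show "{x \<in> space (PiM {..<n} (\<lambda>_. borel :: real measure)). (\<forall>i<n. 0 \<le> x i) \<and> (\<Sum>i<n. x i) = 1} \<in> sets (PiM {..<n} (\<lambda>_. borel))"
    by measurable
  show "AE e in PiM {..<n} (\<lambda>_ :: nat. expo). (\<forall>i<n. 0 \<le> (\<lambda>i\<in>{..<n}. e i / (\<Sum>j<n. e j)) i) \<and>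
      (\<Sum>i<n. (\<lambda>i\<in>{..<n}. e i / (\<Sum>j<n. e j)) i) = 1"
    using AE_PiM_expo_pos[OF finite_lessThan]
  proof eventually_elim
    case (elim e)
    then have "0 < (\<Sum>j<n. e j)" using n by (intro sum_pos) (auto simp: lessThan_empty_iff)
    then show ?case using elim by (auto simp: sum_divide_distrib[symmetric] less_imp_le)
  qed
qed

text \<open>Given the atoms, averaging over the weights yields the product of the
  \<open>1 / h (\<xi> i)\<close>; since the atoms are i.i.d., its expectation is an
  \<open>n\<close>-th power.\<close>

lemma dirichlet_weighted_sample_mean:
  assumes \<nu>: "\<nu> \<in> M1" and n: "1 \<le> n" and W: "dirichlet_weighted_sample P n \<nu> W"
  shows "prob_space P" and "AE \<omega> in P. W \<omega> \<in> M1"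
    and "\<And>h :: real \<Rightarrow> real. continuous_on S01 h \<Longrightarrow> (\<lambda>\<omega>. integral\<^sup>L (W \<omega>) h) \<in> borel_measurable P"
    and "\<And>h :: real \<Rightarrow> real. \<lbrakk>continuous_on S01 h; \<And>x. x \<in> S01 \<Longrightarrow> 0 < h x\<rbrakk> \<Longrightarrow>
      (\<integral>\<omega>. 1 / integral\<^sup>L (W \<omega>) h ^ n \<partial>P) = (\<integral>x. 1 / h x \<partial>\<nu>) ^ n"
proof -
  show P: "prob_space P" using W by (simp add: dirichlet_weighted_sample_def)
  interpret prob_space P by (rule P)
  obtain \<xi> X where \<xi>: "iid_with_law P \<nu> \<xi>"
    and X: "distr P (PiM {..<n} (\<lambda>_. borel)) (\<lambda>\<omega>. \<lambda>i\<in>{..<n}. X i \<omega>) = dirichlet_ones_law n"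
    and indep: "indep_var (PiM UNIV (\<lambda>_. borel_S01)) (\<lambda>\<omega> i. \<xi> i \<omega>)
      (PiM {..<n} (\<lambda>_. borel)) (\<lambda>\<omega>. \<lambda>i\<in>{..<n}. X i \<omega>)"
    and W_eq: "\<And>\<omega>. \<omega> \<in> space P \<Longrightarrow> W \<omega> = atomic_measure {..<n} (\<lambda>i. X i \<omega>) (\<lambda>i. \<xi> i \<omega>)"
    using W unfolding dirichlet_weighted_sample_def by blast
  have sets_\<nu>: "sets borel_S01 = sets \<nu>" using \<nu> by (simp add: M1_iff)
  note law_\<xi> = iid_with_law_distr[OF P \<xi> sets_\<nu>]
  have X_meas: "(\<lambda>\<omega>. \<lambda>i\<in>{..<n}. X i \<omega>) \<in> P \<rightarrow>\<^sub>M PiM {..<n} (\<lambda>_. borel)" by (rule indep_var_rv2[OF indep])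
  define A where "A = PiM (UNIV :: nat set) (\<lambda>_. \<nu>)"
  let ?D = "dirichlet_ones_law n"
  let ?pair = "\<lambda>\<omega>. (\<lambda>i. \<xi> i \<omega>, \<lambda>i\<in>{..<n}. X i \<omega>)"
  have joint: "distr P (PiM UNIV (\<lambda>_. borel_S01) \<Otimes>\<^sub>M PiM {..<n} (\<lambda>_. borel)) ?pair = A \<Otimes>\<^sub>M ?D"
    using indep law_\<xi>(2) X unfolding indep_var_distribution_eq A_def by simp
  have \<xi>_meas: "\<xi> i \<in> P \<rightarrow>\<^sub>M borel_S01" for i
    using measurable_compose[OF law_\<xi>(1) measurable_component_singleton[of i]] by simp
  have X_meas': "X i \<in> borel_measurable P" if "i < n" for i
    using measurable_compose[OF X_meas measurable_component_singleton[of i]] that by simp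
  have \<xi>_S01: "\<xi> i \<omega> \<in> S01" if "\<omega> \<in> space P" for i \<omega>
    using measurable_space[OF \<xi>_meas that] by (simp add: space_restrict_space)
  have mean: "integral\<^sup>L (W \<omega>) h = (\<Sum>i<n. max 0 (X i \<omega>) * h (\<xi> i \<omega>))"
    if "\<omega> \<in> space P" "continuous_on S01 h" for \<omega> and h :: "real \<Rightarrow> real"
    unfolding W_eq[OF that(1)] using \<xi>_S01[OF that(1)]
    by (subst integral_atomic_measure[OF _ that(2)]) (auto simp: lebesgue_integral_count_space_finite)
  have "AE x in distr P (PiM {..<n} (\<lambda>_. borel)) (\<lambda>\<omega>. \<lambda>i\<in>{..<n}. X i \<omega>). (\<forall>i<n. 0 \<le> x i) \<and> (\<Sum>i<n. x i) = 1"
    unfolding X by (rule AE_dirichlet_ones_law[OF n])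
  from AE_distrD[OF X_meas this] AE_space
  show W_M1: "AE \<omega> in P. W \<omega> \<in> M1"
  proof eventually_elim
    case (elim \<omega>)
    then have X0: "0 \<le> X i \<omega>" if "i < n" for i using that by auto
    have "(\<integral>\<^sup>+i. ennreal (X i \<omega>) \<partial>count_space {..<n}) = (\<Sum>i<n. ennreal (X i \<omega>))"
      by (rule nn_integral_count_space_finite) simp
    also have "\<dots> = ennreal (\<Sum>i<n. X i \<omega>)" using X0 by (intro sum_ennreal) auto
    also have "(\<Sum>i<n. X i \<omega>) = 1" using elim by simp
    finally show ?case
      unfolding W_eq[OF elim(2)] using \<xi>_S01[OF elim(2)] by (intro atomic_measure_in_M1) auto
  qed
  have h\<xi>: "(\<lambda>\<omega>. h (\<xi> i \<omega>)) \<in> borel_measurable P" if "continuous_on S01 h" for h :: "real \<Rightarrow> real" and i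
    by (rule measurable_compose[OF \<xi>_meas borel_measurable_continuous_on_restrict[OF that]])
  show meas: "(\<lambda>\<omega>. integral\<^sup>L (W \<omega>) h) \<in> borel_measurable P" if h: "continuous_on S01 h" for h :: "real \<Rightarrow> real"
    using h\<xi>[OF h] X_meas' by (subst measurable_cong[OF mean[OF _ h]]) auto
  show "(\<integral>\<omega>. 1 / integral\<^sup>L (W \<omega>) h ^ n \<partial>P) = (\<integral>x. 1 / h x \<partial>\<nu>) ^ n"
    if h: "continuous_on S01 h" "\<And>x. x \<in> S01 \<Longrightarrow> 0 < h x" for h :: "real \<Rightarrow> real"
  proof -
    have [measurable]: "(\<lambda>\<omega>. integral\<^sup>L (W \<omega>) h) \<in> borel_measurable P" by (rule meas[OF h(1)])
    define G where "G p = ennreal (1 / (\<Sum>i<n. max 0 (snd p i) * h (fst p i)) ^ n)" for p :: "(nat \<Rightarrow> real) \<times> (nat \<Rightarrow> real)"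
    have G_meas: "G \<in> borel_measurable (PiM UNIV (\<lambda>_. borel_S01) \<Otimes>\<^sub>M PiM {..<n} (\<lambda>_. borel))"
    proof -
      have [measurable]: "(\<lambda>p. h (fst p i)) \<in> borel_measurable (PiM UNIV (\<lambda>_. borel_S01) \<Otimes>\<^sub>M PiM {..<n} (\<lambda>_. borel :: real measure))" for i
        by (rule measurable_compose[OF _ borel_measurable_continuous_on_restrict[OF h(1)]]) measurable
      show ?thesis unfolding G_def by measurable
    qed
    have G_meas': "G \<in> borel_measurable (A \<Otimes>\<^sub>M ?D)"
      using G_meas unfolding joint[symmetric] by simp
    interpret D: prob_space ?D unfolding X[symmetric] by (rule prob_space_distr[OF X_meas])
    have A_S01: "x i \<in> S01" if "x \<in> space A" for x i
      using that M1_space[OF \<nu>] by (auto simp: A_def space_PiM PiE_iff)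
    have inner: "(\<integral>\<^sup>+x. G (\<zeta>, x) \<partial>?D) = (\<Prod>i<n. ennreal (1 / h (\<zeta> i)))" if \<zeta>: "\<zeta> \<in> space A" for \<zeta>
    proof -
      have "(\<lambda>x. G (\<zeta>, x)) \<in> borel_measurable ?D"
        by (rule measurable_compose[OF measurable_Pair1'[OF \<zeta>] G_meas'])
      then have "(\<integral>\<^sup>+x. G (\<zeta>, x) \<partial>?D) = (\<integral>\<^sup>+e. G (\<zeta>, \<lambda>i\<in>{..<n}. e i / (\<Sum>j<n. e j)) \<partial>PiM {..<n} (\<lambda>_ :: nat. expo))"
        unfolding dirichlet_ones_law_def by (subst nn_integral_distr[OF measurable_normalize]) auto
      also have "\<dots> = (\<integral>\<^sup>+e. ennreal (1 / (\<Sum>i<n. e i / (\<Sum>j<n. e j) * h (\<zeta> i)) ^ n) \<partial>PiM {..<n} (\<lambda>_ :: nat. expo))"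
      proof (rule nn_integral_cong_AE)
        show "AE e in PiM {..<n} (\<lambda>_ :: nat. expo). G (\<zeta>, \<lambda>i\<in>{..<n}. e i / (\<Sum>j<n. e j))
            = ennreal (1 / (\<Sum>i<n. e i / (\<Sum>j<n. e j) * h (\<zeta> i)) ^ n)"
          using AE_PiM_expo_pos[OF finite_lessThan]
        proof eventually_elim
          case (elim e)
          then have "0 \<le> (\<Sum>j<n. e j)" by (intro sum_nonneg) (auto simp: less_imp_le)
          then have "max 0 (e i / (\<Sum>j<n. e j)) = e i / (\<Sum>j<n. e j)" if "i < n" for i
            using elim that by (intro max_absorb2 divide_nonneg_nonneg) (auto simp: less_imp_le)
          then show ?case by (simp add: G_def)
        qed
      qed
      also have "\<dots> = (\<Prod>i<n. ennreal (1 / h (\<zeta> i)))"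
        by (rule nn_integral_normalized_expo[OF n h(2)[OF A_S01[OF \<zeta>]]])
      finally show ?thesis .
    qed
    have inv: "continuous_on S01 (\<lambda>x. 1 / h x)" using h by (intro continuous_intros) force+
    have "AE \<omega> in P. 0 \<le> 1 / integral\<^sup>L (W \<omega>) h ^ n"
      using W_M1
    proof eventually_elim
      case (elim \<omega>)
      have "0 < integral\<^sup>L (W \<omega>) h" by (rule M1_integral_pos[OF elim h])
      then show ?case by simp
    qed
    then have "(\<integral>\<omega>. 1 / integral\<^sup>L (W \<omega>) h ^ n \<partial>P) = enn2real (\<integral>\<^sup>+\<omega>. ennreal (1 / integral\<^sup>L (W \<omega>) h ^ n) \<partial>P)"
      by (intro integral_eq_nn_integral) measurable
    also have "(\<integral>\<^sup>+\<omega>. ennreal (1 / integral\<^sup>L (W \<omega>) h ^ n) \<partial>P) = (\<integral>\<^sup>+\<omega>. G (?pair \<omega>) \<partial>P)"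
      by (intro nn_integral_cong) (simp add: G_def mean[OF _ h(1)])
    also have "\<dots> = (\<integral>\<^sup>+p. G p \<partial>(A \<Otimes>\<^sub>M ?D))"
      unfolding joint[symmetric]
      by (rule nn_integral_distr[OF measurable_Pair[OF law_\<xi>(1) X_meas], symmetric]) (simp add: G_meas)
    also have "\<dots> = (\<integral>\<^sup>+\<zeta>. \<integral>\<^sup>+x. G (\<zeta>, x) \<partial>?D \<partial>A)"
      by (rule D.nn_integral_fst[OF G_meas', symmetric])
    also have "\<dots> = (\<integral>\<^sup>+\<zeta>. (\<Prod>i<n. ennreal (1 / h (\<zeta> i))) \<partial>A)"
      by (intro nn_integral_cong inner)
    also have "\<dots> = (\<integral>\<^sup>+x. ennreal (1 / h x) \<partial>\<nu>) ^ n"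
      unfolding A_def using M1_borel_measurable[OF \<nu> h(1)]
      by (intro nn_integral_PiM_prod_lessThan M1_prob_space \<nu>) measurable
    also have "(\<integral>\<^sup>+x. ennreal (1 / h x) \<partial>\<nu>) = ennreal (\<integral>x. 1 / h x \<partial>\<nu>)"
      using h(2) M1_space[OF \<nu>] by (intro nn_integral_eq_integral M1_integrable \<nu> inv AE_I2) (auto simp: less_imp_le)
    also have "enn2real (ennreal (\<integral>x. 1 / h x \<partial>\<nu>) ^ n) = (\<integral>x. 1 / h x \<partial>\<nu>) ^ n"
      using M1_integral_pos[OF \<nu> inv] h(2) by (simp add: ennreal_power less_imp_le)
    finally show ?thesis .
  qed
qed

section \<open>The large deviation principles\<close>

text \<open>By continuity a point with \<open>f x < c\<close> has a relative neighbourhood on which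
  \<open>f\<close> stays below \<open>c\<close>, and full support charges it.\<close>

lemma charges_belowI:
  assumes \<nu>: "\<nu> \<in> M1" and support: "topological_support \<nu> = S01" and f: "continuous_on S01 f"
  shows "charges_below \<nu> f"
  unfolding charges_below_def
proof (intro allI impI)
  fix c assume "\<exists>x\<in>S01. f x < c"
  then obtain x where x: "x \<in> S01" "f x < c" by blast
  interpret prob_space \<nu> using \<nu> by (rule M1_prob_space)
  obtain d where d: "0 < d" "\<And>y. y \<in> S01 \<Longrightarrow> dist y x < d \<Longrightarrow> dist (f y) (f x) < c - f x"
    using f x unfolding continuous_on_iff by (metis diff_gt_0_iff_gt)
  have sub: "ball x d \<inter> S01 \<subseteq> {y\<in>S01. f y \<le> c}"
  proof
    fix y assume y: "y \<in> ball x d \<inter> S01"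
    then have "dist (f y) (f x) < c - f x" by (intro d) (auto simp: dist_commute)
    then show "y \<in> {y\<in>S01. f y \<le> c}" using y by (auto simp: dist_real_def)
  qed
  have "{y\<in>S01. f y \<le> c} \<in> sets \<nu>"
    using borel_measurable_le[OF M1_borel_measurable[OF \<nu> f] borel_measurable_const, of c] M1_space[OF \<nu>]
    by simp
  then have "emeasure \<nu> (ball x d \<inter> S01) \<le> emeasure \<nu> {y\<in>S01. f y \<le> c}"
    by (rule emeasure_mono[OF sub])
  moreover have "0 < emeasure \<nu> (ball x d \<inter> S01)"
  proof -
    have "x \<in> topological_support \<nu>" using support x(1) by simp
    then show ?thesis using d(1) by (simp add: topological_support_def)
  qed
  ultimately show "0 < measure \<nu> {y\<in>S01. f y \<le> c}"
    by (auto simp: emeasure_eq_measure dest: less_le_trans)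
qed

lemma inverse_moment_affine:
  fixes V :: "'a \<Rightarrow> real measure" and g :: "real \<Rightarrow> real"
  assumes V: "AE \<omega> in N. V \<omega> \<in> M1"
    and meas: "\<And>h :: real \<Rightarrow> real. continuous_on S01 h \<Longrightarrow> (\<lambda>\<omega>. integral\<^sup>L (V \<omega>) h) \<in> borel_measurable N"
    and g: "continuous_on S01 g"
  shows "(\<integral>\<omega>. 1 / (1 + t * (integral\<^sup>L (V \<omega>) g - u)) ^ n \<partial>N)
    = (\<integral>\<omega>. 1 / integral\<^sup>L (V \<omega>) (\<lambda>x. 1 + t * (g x - u)) ^ n \<partial>N)"
proof (rule integral_cong_AE)
  have "(\<lambda>\<omega>. integral\<^sup>L (V \<omega>) (\<lambda>x. 1 + t * (g x - u))) \<in> borel_measurable N"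
    by (intro meas continuous_intros g)
  then show "(\<lambda>\<omega>. 1 / integral\<^sup>L (V \<omega>) (\<lambda>x. 1 + t * (g x - u)) ^ n) \<in> borel_measurable N"
    by measurable
  show "(\<lambda>\<omega>. 1 / (1 + t * (integral\<^sup>L (V \<omega>) g - u)) ^ n) \<in> borel_measurable N"
    using meas[OF g] by measurable
  show "AE \<omega> in N. 1 / (1 + t * (integral\<^sup>L (V \<omega>) g - u)) ^ n
      = 1 / integral\<^sup>L (V \<omega>) (\<lambda>x. 1 + t * (g x - u)) ^ n"
    using V by eventually_elim (simp only: M1_integral_affine[OF _ g])
qed

lemma random_means_dirichlet_process:
  assumes \<nu>: "\<nu> \<in> M1" and V: "\<And>n. 1 \<le> n \<Longrightarrow> dirichlet_process (P n) (real n) \<nu> (V n)"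
  shows "random_means \<nu> (log_kernel \<nu>) 1 P V"
proof (intro random_means.intro[OF dual_kernel_log[OF \<nu>]] random_means_axioms.intro)
  fix n :: nat assume n: "1 \<le> n"
  note mean = dirichlet_process_mean[OF \<nu> n V[OF n]]
  show "prob_space (P n)" "AE \<omega> in P n. V n \<omega> \<in> M1" by (rule mean)+
  fix g :: "real \<Rightarrow> real" and u t assume g: "continuous_on S01 g"
  show "(\<lambda>\<omega>. integral\<^sup>L (V n \<omega>) g) \<in> borel_measurable (P n)" by (rule mean(3)[OF g])
  assume adm: "admissible g u t"
  have "(\<integral>\<omega>. 1 / (1 + t * (integral\<^sup>L (V n \<omega>) g - u)) ^ n \<partial>P n)
      = (\<integral>\<omega>. 1 / integral\<^sup>L (V n \<omega>) (\<lambda>x. 1 + t * (g x - u)) ^ n \<partial>P n)"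
    by (rule inverse_moment_affine[OF mean(2,3) g])
  also have "\<dots> = exp (- real n * (\<integral>x. ln (1 + t * (g x - u)) \<partial>\<nu>))"
    by (rule mean(4)) (auto intro!: continuous_intros g admissible_pos[OF adm])
  finally show "(\<integral>\<omega>. 1 / (1 + t * (integral\<^sup>L (V n \<omega>) g - u)) ^ n \<partial>P n) = exp (real n * log_kernel \<nu> g u t)"
    by (simp add: log_kernel_def)
qed

lemma random_means_dirichlet_weighted_sample:
  assumes \<nu>: "\<nu> \<in> M1" and W: "\<And>n. 1 \<le> n \<Longrightarrow> dirichlet_weighted_sample (Q n) n \<nu> (W n)"
  shows "random_means \<nu> (inverse_kernel \<nu>) 2 Q W"
proof (intro random_means.intro[OF dual_kernel_inverse[OF \<nu>]] random_means_axioms.intro)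
  fix n :: nat assume n: "1 \<le> n"
  note mean = dirichlet_weighted_sample_mean[OF \<nu> n W[OF n]]
  show "prob_space (Q n)" "AE \<omega> in Q n. W n \<omega> \<in> M1" by (rule mean)+
  fix g :: "real \<Rightarrow> real" and u t assume g: "continuous_on S01 g"
  show "(\<lambda>\<omega>. integral\<^sup>L (W n \<omega>) g) \<in> borel_measurable (Q n)" by (rule mean(3)[OF g])
  assume adm: "admissible g u t"
  have "(\<integral>\<omega>. 1 / (1 + t * (integral\<^sup>L (W n \<omega>) g - u)) ^ n \<partial>Q n)
      = (\<integral>\<omega>. 1 / integral\<^sup>L (W n \<omega>) (\<lambda>x. 1 + t * (g x - u)) ^ n \<partial>Q n)"
    by (rule inverse_moment_affine[OF mean(2,3) g])
  also have "\<dots> = (\<integral>x. 1 / (1 + t * (g x - u)) \<partial>\<nu>) ^ n"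
    by (rule mean(4)) (auto intro!: continuous_intros g admissible_pos[OF adm])
  also have "\<dots> = exp (real n * inverse_kernel \<nu> g u t)"
    using M1_integral_pos[OF \<nu> continuous_on_admissible(2)[OF g adm]] admissible_pos[OF adm]
    by (simp add: inverse_kernel_def exp_of_nat_mult)
  finally show "(\<integral>\<omega>. 1 / (1 + t * (integral\<^sup>L (W n \<omega>) g - u)) ^ n \<partial>Q n) = exp (real n * inverse_kernel \<nu> g u t)" .
qed

text \<open>A first stick close to \<open>1\<close> at a point where \<open>h\<close> is small makes the mean of \<open>h\<close> small.\<close>

lemma dirichlet_process_mean_small:
  assumes \<nu>: "\<nu> \<in> M1" and low: "charges_below \<nu> h" and n: "1 \<le> n" and V: "dirichlet_process P (real n) \<nu> V"
    and h: "continuous_on S01 h" "\<And>x. x \<in> S01 \<Longrightarrow> 0 \<le> h x" "\<And>x. x \<in> S01 \<Longrightarrow> h x \<le> 1"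
    and zero: "x0 \<in> S01" "h x0 = 0" and c: "0 < c"
  shows "0 < measure P {\<omega>\<in>space P. integral\<^sup>L (V \<omega>) h \<le> c}"
proof -
  obtain \<xi> U where P: "prob_space P" and \<xi>: "iid_with_law P \<nu> \<xi>" and U: "iid_with_law P (beta_law 1 (real n)) U"
    and indep: "prob_space.indep_var P (PiM UNIV (\<lambda>_. borel_S01)) (\<lambda>\<omega> i. \<xi> i \<omega>) (PiM UNIV (\<lambda>_. borel)) (\<lambda>\<omega> i. U i \<omega>)"
    and V_eq: "\<And>\<omega>. \<omega> \<in> space P \<Longrightarrow> V \<omega> = stick_measure (\<lambda>i. U i \<omega>) (\<lambda>i. \<xi> i \<omega>)"
    and comp: "\<And>i. \<xi> i \<in> P \<rightarrow>\<^sub>M borel_S01" "\<And>i. U i \<in> borel_measurable P"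
    and \<xi>_S01: "\<And>i \<omega>. \<omega> \<in> space P \<Longrightarrow> \<xi> i \<omega> \<in> S01" and proper: "AE \<omega> in P. proper_sticks (\<lambda>i. U i \<omega>)"
    by (rule dirichlet_processE[OF \<nu> n V]) blast
  interpret prob_space P by (rule P)
  let ?\<beta> = "beta_law 1 (real n)"
  interpret \<beta>: prob_space ?\<beta> by (rule prob_space_beta_law_1[OF n])
  \<comment> \<open>The mean of \<open>h\<close> will be at most
    \<open>1 - (1 - \<delta>)\<^sup>2\<close>, hence at most \<open>2 * \<delta>\<close> and so at
    most \<open>c\<close>.\<close>
  define \<delta> where "\<delta> = min (c / 2) (1 / 2)"
  have \<delta>: "0 < \<delta>" "\<delta> < 1" "2 * \<delta> \<le> c" using c by (auto simp: \<delta>_def)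
  define A where "A = {x\<in>S01. h x \<le> \<delta>}"
  have sets_\<nu>: "sets \<nu> = sets borel_S01" using \<nu> by (simp add: M1_iff)
  have A: "A \<in> sets \<nu>"
    using borel_measurable_le[OF M1_borel_measurable[OF \<nu> h(1)] borel_measurable_const, of \<delta>] M1_space[OF \<nu>]
    by (simp add: A_def)
  have "\<exists>x\<in>S01. h x < \<delta>" using zero \<delta>(1) by force
  then have A_pos: "0 < measure \<nu> A" using low unfolding charges_below_def A_def by blast
  \<comment> \<open>The Beta density is positive between \<open>1 - \<delta>\<close> and 1, so a
    null set for the law would be Lebesgue null there.\<close>
  have "0 < measure ?\<beta> {1 - \<delta><..}"
  proof (rule ccontr)
    assume "\<not> 0 < measure ?\<beta> {1 - \<delta><..}"
    then have "measure ?\<beta> {1 - \<delta><..} = 0" using measure_nonneg[of ?\<beta> "{1 - \<delta><..}"] by linarith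
    then have "{1 - \<delta><..} \<in> null_sets ?\<beta>" by (auto simp: null_sets_def \<beta>.emeasure_eq_measure)
    then have "AE y in ?\<beta>. y \<notin> {1 - \<delta><..}" by (rule AE_not_in)
    then have "AE y in lborel. y \<notin> {1 - \<delta><..<1}"
      unfolding beta_law_1[OF n] using n \<delta> by (subst (asm) AE_density) (auto elim!: AE_mp simp: indicator_def)
    then have "{1 - \<delta><..<1} \<in> null_sets lborel" by (subst AE_iff_null_sets) auto
    then show False using \<delta> by (auto simp: null_sets_def)
  qed
  moreover have "measure ?\<beta> {1 - \<delta><..} = prob (U 0 -` {1 - \<delta><..} \<inter> space P)"
  proof -
    have "distr P ?\<beta> (U 0) = ?\<beta>" using U by (simp add: iid_with_law_def)
    moreover have "U 0 \<in> P \<rightarrow>\<^sub>M ?\<beta>" using comp(2) by simp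
    ultimately show ?thesis by (metis measure_distr sets_beta_law borel_open open_greaterThan)
  qed
  moreover have "measure \<nu> A = prob (\<xi> 0 -` A \<inter> space P)"
  proof -
    have "distr P \<nu> (\<xi> 0) = \<nu>" using \<xi> by (simp add: iid_with_law_def)
    moreover have "\<xi> 0 \<in> P \<rightarrow>\<^sub>M \<nu>" using comp(1) measurable_cong_sets[OF refl sets_\<nu>] by blast
    ultimately show ?thesis by (metis measure_distr A)
  qed
  ultimately have "0 < prob (\<xi> 0 -` A \<inter> space P) * prob (U 0 -` {1 - \<delta><..} \<inter> space P)"
    using A_pos by simp
  also have "\<dots> = prob {\<omega>\<in>space P. \<xi> 0 \<omega> \<in> A \<and> 1 - \<delta> < U 0 \<omega>}"
  proof -
    let ?A = "{\<zeta>\<in>space (PiM (UNIV :: nat set) (\<lambda>_. borel_S01)). \<zeta> 0 \<in> A}"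
    let ?B = "{u\<in>space (PiM (UNIV :: nat set) (\<lambda>_. borel :: real measure)). u 0 \<in> {1 - \<delta><..}}"
    have [measurable]: "A \<in> sets borel_S01" using A by (simp only: sets_\<nu>)
    have "?A \<in> sets (PiM UNIV (\<lambda>_. borel_S01))" "?B \<in> sets (PiM UNIV (\<lambda>_. borel))" by measurable
    from indep_varD[OF indep this]
    have "prob ((\<lambda>\<omega>. (\<lambda>i. \<xi> i \<omega>, \<lambda>i. U i \<omega>)) -` (?A \<times> ?B) \<inter> space P)
        = prob ((\<lambda>\<omega> i. \<xi> i \<omega>) -` ?A \<inter> space P) * prob ((\<lambda>\<omega> i. U i \<omega>) -` ?B \<inter> space P)" .
    moreover have "(\<lambda>\<omega>. (\<lambda>i. \<xi> i \<omega>, \<lambda>i. U i \<omega>)) -` (?A \<times> ?B) \<inter> space P = {\<omega>\<in>space P. \<xi> 0 \<omega> \<in> A \<and> 1 - \<delta> < U 0 \<omega>}"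
      using \<xi>_S01 by (auto simp: space_PiM space_restrict_space)
    moreover have "(\<lambda>\<omega> i. \<xi> i \<omega>) -` ?A \<inter> space P = \<xi> 0 -` A \<inter> space P"
      using \<xi>_S01 by (auto simp: space_PiM space_restrict_space)
    moreover have "(\<lambda>\<omega> i. U i \<omega>) -` ?B \<inter> space P = U 0 -` {1 - \<delta><..} \<inter> space P"
      by (auto simp: space_PiM)
    ultimately show ?thesis by simp
  qed
  also have "\<dots> \<le> prob {\<omega>\<in>space P. integral\<^sup>L (V \<omega>) h \<le> c}"
  proof (rule finite_measure_mono_AE)
    show "{\<omega>\<in>space P. integral\<^sup>L (V \<omega>) h \<le> c} \<in> events"
      using dirichlet_process_mean(3)[OF \<nu> n V h(1)] by measurable
    show "AE \<omega> in P. \<omega> \<in> {\<omega>\<in>space P. \<xi> 0 \<omega> \<in> A \<and> 1 - \<delta> < U 0 \<omega>} \<longrightarrow>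
        \<omega> \<in> {\<omega>\<in>space P. integral\<^sup>L (V \<omega>) h \<le> c}"
      using proper AE_space
    proof (eventually_elim, intro impI)
      fix \<omega> assume good: "proper_sticks (\<lambda>i. U i \<omega>)" and \<omega>: "\<omega> \<in> space P"
        and "\<omega> \<in> {\<omega>\<in>space P. \<xi> 0 \<omega> \<in> A \<and> 1 - \<delta> < U 0 \<omega>}"
      then have 0: "h (\<xi> 0 \<omega>) \<le> \<delta>" "1 - \<delta> < U 0 \<omega>" by (auto simp: A_def)
      have V\<omega>: "V \<omega> \<in> M1" unfolding V_eq[OF \<omega>] by (rule stick_measure_in_M1[OF good \<xi>_S01[OF \<omega>]])
      \<comment> \<open>For the nonnegative function \<open>1 - h\<close> the series of the mean is
        bounded below by its first term, the contribution of the first stick.\<close>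
      have "(\<lambda>i. stick_breaking (\<lambda>i. U i \<omega>) i * (1 + - 1 * (h (\<xi> i \<omega>) - 0))) sums (\<integral>x. 1 + - 1 * (h x - 0) \<partial>V \<omega>)"
        unfolding V_eq[OF \<omega>] by (intro stick_measure_mean_sums good \<xi>_S01 \<omega> continuous_intros h)
      then have "(\<Sum>i<1. stick_breaking (\<lambda>i. U i \<omega>) i * (1 + - 1 * (h (\<xi> i \<omega>) - 0))) \<le> (\<integral>x. 1 + - 1 * (h x - 0) \<partial>V \<omega>)"
        using stick_breaking_sums(2)[OF good] h(3)[OF \<xi>_S01[OF \<omega>]]
        by (intro sum_le_suminf[THEN order_trans[OF _ eq_refl[OF sums_unique[symmetric]]]]) (auto simp: sums_iff)
      then have "U 0 \<omega> * (1 - h (\<xi> 0 \<omega>)) \<le> 1 - integral\<^sup>L (V \<omega>) h"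
        by (simp only: M1_integral_affine[OF V\<omega> h(1)]) (simp add: stick_breaking_def)
      moreover have "(1 - \<delta>) * (1 - \<delta>) \<le> U 0 \<omega> * (1 - h (\<xi> 0 \<omega>))"
        using 0 \<delta> by (intro mult_mono) auto
      moreover have "1 - 2 * \<delta> \<le> (1 - \<delta>) * (1 - \<delta>)" by (simp add: algebra_simps)
      ultimately show "\<omega> \<in> {\<omega>\<in>space P. integral\<^sup>L (V \<omega>) h \<le> c}" using \<delta>(3) \<omega> by simp
    qed
  qed
  finally show ?thesis .
qed

text \<open>The inverse moment of order 1 equates the integral of
  \<open>1 / (1 + t * (x - u))\<close> under \<open>\<nu>1\<close> with the exponential of the
  logarithmic kernel of \<nu>, an identity of Markov-Krein type. Mass of \<open>\<nu>1\<close> near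
  0 and near 1, which the duality for \<open>rate2\<close> asks for, comes from a long first
  stick.\<close>

lemma first_mean_law:
  fixes V :: "'a \<Rightarrow> real measure"
  assumes \<nu>: "\<nu> \<in> M1" and support: "topological_support \<nu> = S01" and V: "dirichlet_process P 1 \<nu> V"
  defines "\<nu>1 \<equiv> restrict_space (mean_law P V (\<lambda>x. x)) S01"
  shows "\<nu>1 \<in> M1" and "charges_below \<nu>1 (\<lambda>x. x)" and "charges_below \<nu>1 (\<lambda>x. - x)"
    and "\<And>u t. admissible (\<lambda>x. x) u t \<Longrightarrow> inverse_kernel \<nu>1 (\<lambda>x. x) u t = log_kernel \<nu> (\<lambda>x. x) u t"
proof -
  have V1: "dirichlet_process P (real 1) \<nu> V" using V by simp
  note mean = dirichlet_process_mean[OF \<nu> order_refl V1]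
  interpret prob_space P by (rule mean(1))
  define m where "m \<omega> = integral\<^sup>L (V \<omega>) (\<lambda>x. x)" for \<omega>
  have m [measurable]: "m \<in> borel_measurable P" unfolding m_def by (rule mean(3)) (rule continuous_on_id)
  have m_S01: "AE \<omega> in P. m \<omega> \<in> S01"
    using mean(2)
  proof eventually_elim
    case (elim \<omega>)
    show ?case unfolding m_def
      using M1_integral_ge[OF elim continuous_on_id, of 0] M1_integral_le[OF elim continuous_on_id, of 1] by simp
  qed
  have law: "mean_law P V (\<lambda>x. x) = distr P borel m" by (simp add: mean_law_def m_def[abs_def])
  have "emeasure (distr P borel m) S01 = emeasure P (m -` S01 \<inter> space P)"
    by (rule emeasure_distr[OF m]) simp
  also have "\<dots> = 1" using m_S01 by (intro emeasure_eq_1_AE) auto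
  finally have "prob_space \<nu>1" unfolding \<nu>1_def law by (intro prob_space_restrict_space) auto
  moreover have "sets \<nu>1 = sets borel_S01" unfolding \<nu>1_def law by (intro sets_restrict_space_cong) simp
  ultimately show \<nu>1: "\<nu>1 \<in> M1" by (simp add: M1_iff)
  have measure_\<nu>1: "measure \<nu>1 B = prob {\<omega>\<in>space P. m \<omega> \<in> B}" if "B \<in> sets borel" "B \<subseteq> S01" for B
  proof -
    have "measure \<nu>1 B = measure (distr P borel m) B"
      unfolding \<nu>1_def law using that by (intro measure_restrict_space) auto
    also have "\<dots> = prob {\<omega>\<in>space P. m \<omega> \<in> B}"
      using that by (subst measure_distr[OF m]) (auto intro!: arg_cong[where f = prob])
    finally show ?thesis .
  qed
  show "charges_below \<nu>1 (\<lambda>x. x)"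
    unfolding charges_below_def
  proof (intro allI impI)
    fix c :: real assume "\<exists>x\<in>S01. x < c"
    then have c: "0 < c" by auto
    have "0 < prob {\<omega>\<in>space P. integral\<^sup>L (V \<omega>) (\<lambda>x. x) \<le> c}"
      by (rule dirichlet_process_mean_small[OF \<nu> charges_belowI[OF \<nu> support] order_refl V1, of _ 0])
        (auto simp: c intro: continuous_on_id)
    also have "\<dots> \<le> prob {\<omega>\<in>space P. m \<omega> \<in> {x\<in>S01. x \<le> c}}"
    proof (rule finite_measure_mono_AE)
      show "AE \<omega> in P. \<omega> \<in> {\<omega>\<in>space P. integral\<^sup>L (V \<omega>) (\<lambda>x. x) \<le> c} \<longrightarrow>
          \<omega> \<in> {\<omega>\<in>space P. m \<omega> \<in> {x\<in>S01. x \<le> c}}"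
        using m_S01 by eventually_elim (simp add: m_def)
    qed measurable
    also have "\<dots> = measure \<nu>1 {x\<in>S01. x \<le> c}" by (intro measure_\<nu>1[symmetric]) auto
    finally show "0 < measure \<nu>1 {x\<in>S01. x \<le> c}" .
  qed
  show "charges_below \<nu>1 (\<lambda>x. - x)"
    unfolding charges_below_def
  proof (intro allI impI)
    fix c :: real assume "\<exists>x\<in>S01. - x < c"
    then have c: "0 < 1 + c" by auto
    \<comment> \<open>Values near 1 are values of \<open>1 - x\<close> near 0; the affine form lets
      \<open>M1_integral_affine\<close> compute the mean.\<close>
    have h: "continuous_on S01 (\<lambda>x :: real. 1 + - 1 * (x - 0))" by (intro continuous_intros)
    have "0 < prob {\<omega>\<in>space P. (\<integral>x. 1 + - 1 * (x - 0) \<partial>V \<omega>) \<le> 1 + c}"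
      by (rule dirichlet_process_mean_small[OF \<nu> charges_belowI[OF \<nu> support h] order_refl V1 h, of 1])
        (auto simp: c)
    also have "\<dots> \<le> prob {\<omega>\<in>space P. m \<omega> \<in> {x\<in>S01. - x \<le> c}}"
    proof (rule finite_measure_mono_AE)
      show "AE \<omega> in P. \<omega> \<in> {\<omega>\<in>space P. (\<integral>x. 1 + - 1 * (x - 0) \<partial>V \<omega>) \<le> 1 + c} \<longrightarrow>
          \<omega> \<in> {\<omega>\<in>space P. m \<omega> \<in> {x\<in>S01. - x \<le> c}}"
        using mean(2) m_S01
      proof eventually_elim
        case (elim \<omega>)
        have "(\<integral>x. 1 + - 1 * (x - 0) \<partial>V \<omega>) = 1 - m \<omega>"
          unfolding m_def M1_integral_affine[OF elim(1) continuous_on_id] by simp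
        then show ?case using elim(2) by auto
      qed
    qed measurable
    also have "\<dots> = measure \<nu>1 {x\<in>S01. - x \<le> c}" by (intro measure_\<nu>1[symmetric]) auto
    finally show "0 < measure \<nu>1 {x\<in>S01. - x \<le> c}" .
  qed
  show "inverse_kernel \<nu>1 (\<lambda>x. x) u t = log_kernel \<nu> (\<lambda>x. x) u t" if adm: "admissible (\<lambda>x. x) u t" for u t
  proof -
    have "(\<integral>x. 1 / (1 + t * (x - u)) \<partial>\<nu>1) = (\<integral>x. indicator S01 x *\<^sub>R (1 / (1 + t * (x - u))) \<partial>distr P borel m)"
      unfolding \<nu>1_def law by (subst integral_restrict_space) auto
    also have "\<dots> = (\<integral>\<omega>. indicator S01 (m \<omega>) *\<^sub>R (1 / (1 + t * (m \<omega> - u))) \<partial>P)"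
      by (rule integral_distr[OF m]) measurable
    also have "\<dots> = (\<integral>\<omega>. 1 / (1 + t * (m \<omega> - u)) ^ 1 \<partial>P)"
      using m_S01 by (intro integral_cong_AE) (auto elim!: AE_mp)
    also have "\<dots> = (\<integral>\<omega>. 1 / integral\<^sup>L (V \<omega>) (\<lambda>x. 1 + t * (x - u)) ^ 1 \<partial>P)"
      unfolding m_def by (rule inverse_moment_affine[OF mean(2,3) continuous_on_id])
    also have "\<dots> = exp (- real 1 * (\<integral>x. ln (1 + t * (x - u)) \<partial>\<nu>))"
      by (rule mean(4)) (auto intro!: continuous_intros admissible_pos[OF adm])
    finally show ?thesis by (simp add: inverse_kernel_def log_kernel_def)
  qed
qed

theorem theorem4p1:
  fixes \<nu>0 :: "real measure" and f :: "real \<Rightarrow> real"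
    and P :: "nat \<Rightarrow> 'a measure" and V :: "nat \<Rightarrow> 'a \<Rightarrow> real measure"
    and Q :: "nat \<Rightarrow> 'b measure" and W :: "nat \<Rightarrow> 'b \<Rightarrow> real measure"
  assumes "\<nu>0 \<in> M1" and "topological_support \<nu>0 = S01" and "continuous_on S01 f"
    and "\<And>n. 1 \<le> n \<Longrightarrow> dirichlet_process (P n) (real n) \<nu>0 (V n)"
    and "\<And>n. 1 \<le> n \<Longrightarrow> dirichlet_weighted_sample (Q n) n \<nu>0 (W n)"
  shows "(LDP (\<lambda>n. mean_law (P n) (V n) f) (rate1 f \<nu>0) \<and> good_rate_function (rate1 f \<nu>0)) \<and>
    (LDP (\<lambda>n. mean_law (Q n) (W n) f) (rate2 f \<nu>0) \<and> good_rate_function (rate2 f \<nu>0)) \<and>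
    (let \<nu>1 = restrict_space (mean_law (P 1) (V 1) (\<lambda>x. x)) S01
     in \<forall>u. rate1 (\<lambda>x. x) \<nu>0 u = rate2 (\<lambda>x. x) \<nu>1 u)"
proof -
  note \<nu>0 = assms(1) and support = assms(2) and f = assms(3)
  have low: "charges_below \<nu>0 g" "charges_below \<nu>0 (\<lambda>x. - g x)" if "continuous_on S01 g" for g
    by (intro charges_belowI \<nu>0 support continuous_on_minus that)+
  interpret V: random_means \<nu>0 "log_kernel \<nu>0" 1 P V
    by (rule random_means_dirichlet_process[OF \<nu>0 assms(4)])
  interpret W: random_means \<nu>0 "inverse_kernel \<nu>0" 2 Q W
    by (rule random_means_dirichlet_weighted_sample[OF \<nu>0 assms(5)])
  have rate1: "rate1 f \<nu>0 = dual_rate (log_kernel \<nu>0) f"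
    by (intro ext rate1_eq_dual_rate \<nu>0 f low)
  have rate2: "rate2 f \<nu>0 = dual_rate (inverse_kernel \<nu>0) f"
    by (intro ext rate2_eq_dual_rate \<nu>0 f low)
  have "LDP (\<lambda>n. mean_law (P n) (V n) f) (rate1 f \<nu>0)"
    unfolding rate1 by (rule V.LDP_dual_rate[OF f low[OF f]])
  moreover have "LDP (\<lambda>n. mean_law (Q n) (W n) f) (rate2 f \<nu>0)"
    unfolding rate2 by (rule W.LDP_dual_rate[OF f low[OF f]])
  moreover have "rate1 (\<lambda>x. x) \<nu>0 u = rate2 (\<lambda>x. x) (restrict_space (mean_law (P 1) (V 1) (\<lambda>x. x)) S01) u" for u
  proof -
    have "dirichlet_process (P 1) 1 \<nu>0 (V 1)" using assms(4)[of 1] by simp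
    note \<nu>1 = first_mean_law[OF \<nu>0 support this]
    have "rate1 (\<lambda>x. x) \<nu>0 u = dual_rate (log_kernel \<nu>0) (\<lambda>x. x) u"
      by (intro rate1_eq_dual_rate \<nu>0 continuous_on_id low)
    \<comment> \<open>Admissibility does not involve the measure, so both suprema run over the same
      \<open>t\<close> and agree term by term.\<close>
    also have "\<dots> = dual_rate (inverse_kernel (restrict_space (mean_law (P 1) (V 1) (\<lambda>x. x)) S01)) (\<lambda>x. x) u"
      unfolding dual_rate_def by (intro SUP_cong refl) (simp only: mem_Collect_eq \<nu>1(4))
    also have "\<dots> = rate2 (\<lambda>x. x) (restrict_space (mean_law (P 1) (V 1) (\<lambda>x. x)) S01) u"
      by (intro rate2_eq_dual_rate[symmetric] \<nu>1 continuous_on_id)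
    finally show ?thesis .
  qed
  ultimately show ?thesis
    using good_rate_function_rate1[OF \<nu>0 f] good_rate_function_rate2[OF \<nu>0 f] by (simp add: Let_def)
qed

end
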